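(* For every positive integer $n$, the $\mathfrak{sp}(4)$ clasp $f_n$ of weight $(n,0)$ satisfies, in $\mathrm{Hom}(1^n,1^n)$, $$f_n=\sum_{i=0}^{n-1}\sum_{j=i+1}^{n}[2]^{\,i-j+1}\,\frac{[n+1]\,[n-j+1]\,[2n-2i+2]}{[n]\,[2n+2]\,[n-i+1]}\;D_{i,j},$$ where $D_{i,j}\in\mathrm{Hom}(1^n,1^n)$ are the webs, each containing one clasp $f_{n-1}$ of weight $(n-1,0)$, described in the context.
   Context: Ground field $K=\mathbb{C}(q^{1/2})$; $[n]=\frac{q^{n/2}-q^{-n/2}}{q^{1/2}-q^{-1/2}}$. Webs. An $\mathfrak{sp}(4)$ web in a rectangle is an unoriented planar graph (possibly with closed loops without vertices), up to isotopy, with edges of two types, type 1 (single) and type 2 (double), whose interior vertices are trivalent with two type 1 edges and one type 2 edge, and whose univalent vertices lie on the bottom and top sides. For words $s,t$ in the letters $1,2$, $\mathrm{Hom}(s,t)$ is the $K$-vector space spanned by webs whose bottom (top) endpoints have types $s$ (resp. $t$), left to right, modulo the local relations: a type 1 loop equals $-\frac{[6][2]}{[3]}$; a type 2 loop equals $\frac{[6][5]}{[3][2]}$; a type 2 edge ending at a vertex whose two type 1 half-edges form a loop bounding an empty disc equals $0$; a bigon of two type 1 edges with two type 2 legs equals $-[2]^2$ times a type 2 strand; a triangle of type 1 edges with three type 2 legs equals $0$; and, for four type 1 boundary points (top-left, top-right, bottom-left, bottom-right), $$I-J=U-V,$$ where $I$ joins the two top points at one vertex and the two bottom points at another vertex,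 connected by a vertical type 2 edge; $J$ joins the two left points at one vertex and the two right points at another, connected by a horizontal type 2 edge; $U$ joins the top two points by an arc and the bottom two points by an arc; $V$ consists of two vertical strands. Composition stacks diagrams (the left factor on top), $\otimes$ is juxtaposition. The tetravalent vertex (crossing of two type 1 strands) is by definition $X=J-V$ $(=I-U)$. Clasps. The weight of a word with $a$ letters $1$ and $b$ letters $2$ is $(a,b)$, meaning $a\lambda_1+b\lambda_2$ (fundamental weights of $\mathfrak{sp}(4)$, $\dim V_{\lambda_1}=4$, $\dim V_{\lambda_2}=5$). The partial order is generated by $(a,b)\succ(a-2,b+1)$ and $(a,b)\succ(a+2,b-2)$. The clasp of a word $s$ is the unique nonzero idempotent $P_s\in\mathrm{Hom}(s,s)$ such that $w\circ P_s=0$ for $w\in\mathrm{Hom}(s,t)$ and $P_s\circ w'=0$ for $w'\in\mathrm{Hom}(t,s)$ whenever the weight of $t$ is strictly less than that of $s$. Here $f_n=P_{1^n}$ ($f_0$ empty). The webs $D_{i,j}$, $0\le i<j\le n$. Place $f_{n-1}$ on the $n-1$ leftmost bottom endpoints. Call the remaining (rightmost) bottom endpoint "0", and label the $n$ top endpoints $1,\dots,n$ from right to left; so the $n+1$ points $0,1,\dots,n$ occur in this order along the region to the right of and above the clasp. Join the points $i$ and $j$ by an arc, and join the remaining $n-1$ points, in order, to the $n-1$ strands leaving the top of the clasp (the smallest remaining label to the rightmost strand, and so on) by pairwise disjoint type 1 strands; the arc crosses exactly once each of the $j-i-1$ strands ending at labels strictly between $i$ and $j$, and no other strand, and each crossing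 is a tetravalent vertex $X$. (Thus for $i\ge1$ the bottom point $0$ is joined by a cap to the rightmost top strand of the clasp, and $D_{0,1}=f_{n-1}\otimes\mathrm{id}_1$.) *)

theory Defs
  imports
    "HOL-Library.Poly_Mapping"
    "HOL-Computational_Algebra.Polynomial"
    "HOL-Computational_Algebra.Fraction_Field"
begin

section \<open>The ground field and quantum integers\<close>

text \<open>The field of rational functions over the complex numbers; its generator is \<open>q\<^bsup>1/2\<^esup>\<close>.\<close>

type_synonym K = "complex poly fract"

definition qhalf :: K where
  "qhalf = Fract [:0, 1:] 1"

definition qnum :: "int \<Rightarrow> K"  (\<open>[_]\<^sub>q\<close>) where
  "[n]\<^sub>q = (qhalf powi n - qhalf powi (- n)) / (qhalf - inverse qhalf)"


section \<open>Webs up to isotopy\<close>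

datatype strand = S1 | S2

text \<open>
  A web in general position is cut by horizontal lines into elementary pieces, and is recorded
  as an expression in these pieces: vertical strands, local minima (cups), local maxima (caps),
  a vertex with its two type 1 edges below (\<open>Merge\<close>) or above (\<open>Split\<close>) and its type 2 edge on
  the other side. Every other position of a vertex is obtained by bending edges.
  In \<open>v \<cdot> w\<close> the left factor \<open>v\<close> is on top; \<open>v \<parallel> w\<close> is juxtaposition.
\<close>

datatype web =
    Id "strand list"
  | Cup strand
  | Cap strand
  | Merge
  | Split
  | Comp web web  (infixr \<open>\<cdot>\<close> 70)
  | Tensor web web  (infixr \<open>\<parallel>\<close> 75)

text \<open>\<open>\<turnstile> w : s \<leadsto> t\<close>: bottom endpoints \<open>s\<close>, top endpoints \<open>t\<close>, read from left to right.\<close>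

inductive has_ends :: "web \<Rightarrow> strand list \<Rightarrow> strand list \<Rightarrow> bool"
    (\<open>(\<turnstile> _ : _ \<leadsto> _)\<close> [51, 51, 51] 50) where
  "\<turnstile> Id s : s \<leadsto> s"
| "\<turnstile> Cup a : [] \<leadsto> [a, a]"
| "\<turnstile> Cap a : [a, a] \<leadsto> []"
| "\<turnstile> Merge : [S1, S1] \<leadsto> [S2]"
| "\<turnstile> Split : [S2] \<leadsto> [S1, S1]"
| "\<turnstile> w : s \<leadsto> t \<Longrightarrow> \<turnstile> v : t \<leadsto> u \<Longrightarrow> \<turnstile> v \<cdot> w : s \<leadsto> u"
| "\<turnstile> v : s \<leadsto> t \<Longrightarrow> \<turnstile> w : s' \<leadsto> t' \<Longrightarrow> \<turnstile> v \<parallel> w : s @ s' \<leadsto> t @ t'"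

text \<open>
  Planar isotopy, generated by the usual elementary moves between pictures in general position:
  regrouping and inserting vertical strands, interchanging the heights of distant pieces,
  straightening a zigzag, and turning a vertex upside down, where the half turns in the two
  directions agree.
\<close>

inductive isotopic :: "web \<Rightarrow> web \<Rightarrow> bool"  (infix \<open>\<approx>\<close> 50) where
  refl: "w \<approx> w"
| sym: "v \<approx> w \<Longrightarrow> w \<approx> v"
| trans: "u \<approx> v \<Longrightarrow> v \<approx> w \<Longrightarrow> u \<approx> w"
| cong_comp: "v \<approx> v' \<Longrightarrow> w \<approx> w' \<Longrightarrow> v \<cdot> w \<approx> v' \<cdot> w'"
| cong_tensor: "v \<approx> v' \<Longrightarrow> w \<approx> w' \<Longrightarrow> v \<parallel> w \<approx> v' \<parallel> w'"
| comp_assoc: "(u \<cdot> v) \<cdot> w \<approx> u \<cdot> (v \<cdot> w)"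
| comp_id_left: "\<turnstile> w : s \<leadsto> t \<Longrightarrow> Id t \<cdot> w \<approx> w"
| comp_id_right: "\<turnstile> w : s \<leadsto> t \<Longrightarrow> w \<cdot> Id s \<approx> w"
| tensor_assoc: "(u \<parallel> v) \<parallel> w \<approx> u \<parallel> (v \<parallel> w)"
| tensor_empty_left: "Id [] \<parallel> w \<approx> w"
| tensor_empty_right: "w \<parallel> Id [] \<approx> w"
| tensor_id: "Id s \<parallel> Id t \<approx> Id (s @ t)"
| interchange: "\<turnstile> w : s \<leadsto> t \<Longrightarrow> \<turnstile> v : t \<leadsto> u \<Longrightarrow> \<turnstile> w' : s' \<leadsto> t' \<Longrightarrow> \<turnstile> v' : t' \<leadsto> u' \<Longrightarrow>
    (v \<parallel> v') \<cdot> (w \<parallel> w') \<approx> (v \<cdot> w) \<parallel> (v' \<cdot> w')"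
| zigzag_left: "(Cap a \<parallel> Id [a]) \<cdot> (Id [a] \<parallel> Cup a) \<approx> Id [a]"
| zigzag_right: "(Id [a] \<parallel> Cap a) \<cdot> (Cup a \<parallel> Id [a]) \<approx> Id [a]"
| turn_left: "(Cap S2 \<parallel> Id [S1, S1]) \<cdot> (Id [S2] \<parallel> Merge \<parallel> Id [S1, S1])
      \<cdot> (Id [S2] \<parallel> ((Id [S1] \<parallel> Cup S1 \<parallel> Id [S1]) \<cdot> Cup S1)) \<approx> Split"
| turn_right: "(Id [S1, S1] \<parallel> Cap S2) \<cdot> (Id [S1, S1] \<parallel> Merge \<parallel> Id [S2])
      \<cdot> (((Id [S1] \<parallel> Cup S1 \<parallel> Id [S1]) \<cdot> Cup S1) \<parallel> Id [S2]) \<approx> Split"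


section \<open>Linear combinations and local relations\<close>

type_synonym lweb = "web \<Rightarrow>\<^sub>0 K"

abbreviation lweb_of :: "web \<Rightarrow> lweb"  (\<open>\<langle>_\<rangle>\<close>) where
  "\<langle>w\<rangle> \<equiv> Poly_Mapping.single w 1"

definition lscale :: "K \<Rightarrow> lweb \<Rightarrow> lweb" where
  "lscale c x = Poly_Mapping.map ((*) c) x"

text \<open>The bilinear extension of an operation on webs.\<close>

definition bilinear_ext :: "(web \<Rightarrow> web \<Rightarrow> web) \<Rightarrow> lweb \<Rightarrow> lweb \<Rightarrow> lweb" where
  "bilinear_ext f x y =
     (\<Sum>a\<in>Poly_Mapping.keys x. \<Sum>b\<in>Poly_Mapping.keys y.
        Poly_Mapping.single (f a b) (Poly_Mapping.lookup x a * Poly_Mapping.lookup y b))"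

definition I_web :: web where
  "I_web = Split \<cdot> Merge"

text \<open>The horizontal type 2 edge runs from a vertex on the left strand to one on the right strand.\<close>

definition J_web :: web where
  "J_web = (Id [S1] \<parallel> ((Id [S1] \<parallel> Cap S1) \<cdot> (Split \<parallel> Id [S1])))
         \<cdot> (((Id [S1] \<parallel> Merge) \<cdot> (Cup S1 \<parallel> Id [S1])) \<parallel> Id [S1])"

definition U_web :: web where
  "U_web = Cup S1 \<cdot> Cap S1"

definition V_web :: web where
  "V_web = Id [S1, S1]"

text \<open>Each local relation, left side minus right side.\<close>

inductive_set local_rel :: "lweb set" where
  loop1: "\<langle>Cap S1 \<cdot> Cup S1\<rangle> - lscale (- ([6]\<^sub>q * [2]\<^sub>q / [3]\<^sub>q)) \<langle>Id []\<rangle> \<in> local_rel"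
| loop2: "\<langle>Cap S2 \<cdot> Cup S2\<rangle> - lscale ([6]\<^sub>q * [5]\<^sub>q / ([3]\<^sub>q * [2]\<^sub>q)) \<langle>Id []\<rangle> \<in> local_rel"
| monogon: "\<langle>Merge \<cdot> Cup S1\<rangle> \<in> local_rel"
| bigon: "\<langle>Merge \<cdot> Split\<rangle> - lscale (- ([2]\<^sub>q\<^sup>2)) \<langle>Id [S2]\<rangle> \<in> local_rel"
| triangle: "\<langle>Merge \<cdot> (Id [S1] \<parallel> Cap S1 \<parallel> Id [S1]) \<cdot> (Split \<parallel> Split)\<rangle> \<in> local_rel"
| square: "(\<langle>I_web\<rangle> - \<langle>J_web\<rangle>) - (\<langle>U_web\<rangle> - \<langle>V_web\<rangle>) \<in> local_rel"

text \<open>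
  The subspace generated by isotopies and by the local relations applied inside arbitrary webs.
  Expressions whose endpoints do not match are no webs and are set to zero as well; hence the
  quotient is the direct sum of all the spaces \<open>Hom s t\<close>, and mismatched composites vanish in it.
\<close>

inductive_set null :: "lweb set" where
  zero: "0 \<in> null"
| add: "x \<in> null \<Longrightarrow> y \<in> null \<Longrightarrow> x + y \<in> null"
| scale: "x \<in> null \<Longrightarrow> lscale c x \<in> null"
| ill_formed: "\<nexists>s t. \<turnstile> w : s \<leadsto> t \<Longrightarrow> \<langle>w\<rangle> \<in> null"
| isotopy: "v \<approx> w \<Longrightarrow> \<langle>v\<rangle> - \<langle>w\<rangle> \<in> null"
| local: "r \<in> local_rel \<Longrightarrow> r \<in> null"
| below: "r \<in> null \<Longrightarrow> bilinear_ext Comp x r \<in> null"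
| above: "r \<in> null \<Longrightarrow> bilinear_ext Comp r x \<in> null"
| right: "r \<in> null \<Longrightarrow> bilinear_ext Tensor x r \<in> null"
| left: "r \<in> null \<Longrightarrow> bilinear_ext Tensor r x \<in> null"


section \<open>The spaces of webs\<close>

lemma lookup_lscale [simp]: "Poly_Mapping.lookup (lscale c x) w = c * Poly_Mapping.lookup x w"
  unfolding lscale_def by transfer (simp add: when_def)

lemma lscale_minus_one: "lscale (- 1) x = - x"
  by (rule poly_mapping_eqI) simp

lemma bilinear_ext_superset:
  assumes "finite A" "Poly_Mapping.keys x \<subseteq> A" "finite B" "Poly_Mapping.keys y \<subseteq> B"
  shows "bilinear_ext f x y =
     (\<Sum>a\<in>A. \<Sum>b\<in>B.
        Poly_Mapping.single (f a b) (Poly_Mapping.lookup x a * Poly_Mapping.lookup y b))"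
proof -
  have "(\<Sum>b\<in>Poly_Mapping.keys y. Poly_Mapping.single (f a b) (Poly_Mapping.lookup x a * Poly_Mapping.lookup y b))
      = (\<Sum>b\<in>B. Poly_Mapping.single (f a b) (Poly_Mapping.lookup x a * Poly_Mapping.lookup y b))" for a
    by (rule sum.mono_neutral_left) (use assms in \<open>auto simp: in_keys_iff\<close>)
  moreover have "(\<Sum>a\<in>Poly_Mapping.keys x. \<Sum>b\<in>B.
        Poly_Mapping.single (f a b) (Poly_Mapping.lookup x a * Poly_Mapping.lookup y b))
      = (\<Sum>a\<in>A. \<Sum>b\<in>B.
        Poly_Mapping.single (f a b) (Poly_Mapping.lookup x a * Poly_Mapping.lookup y b))"
    by (rule sum.mono_neutral_left) (use assms in \<open>auto simp: in_keys_iff\<close>)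
  ultimately show ?thesis
    by (simp add: bilinear_ext_def)
qed

lemma bilinear_ext_diff_left: "bilinear_ext f (x - x') y = bilinear_ext f x y - bilinear_ext f x' y"
proof -
  define A where "A = Poly_Mapping.keys x \<union> Poly_Mapping.keys x' \<union> Poly_Mapping.keys (x - x')"
  have A: "finite A" "Poly_Mapping.keys x \<subseteq> A" "Poly_Mapping.keys x' \<subseteq> A"
      "Poly_Mapping.keys (x - x') \<subseteq> A"
    by (auto simp: A_def)
  note ext = bilinear_ext_superset[OF A(1) _ finite_keys order_refl]
  show ?thesis
    unfolding ext[OF A(2)] ext[OF A(3)] ext[OF A(4)]
    by (simp add: lookup_minus left_diff_distrib single_diff sum_subtractf)
qed

lemma bilinear_ext_diff_right: "bilinear_ext f x (y - y') = bilinear_ext f x y - bilinear_ext f x y'"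
proof -
  define B where "B = Poly_Mapping.keys y \<union> Poly_Mapping.keys y' \<union> Poly_Mapping.keys (y - y')"
  have B: "finite B" "Poly_Mapping.keys y \<subseteq> B" "Poly_Mapping.keys y' \<subseteq> B"
      "Poly_Mapping.keys (y - y') \<subseteq> B"
    by (auto simp: B_def)
  note ext = bilinear_ext_superset[OF finite_keys order_refl B(1)]
  show ?thesis
    unfolding ext[OF B(2)] ext[OF B(3)] ext[OF B(4)]
    by (simp add: lookup_minus right_diff_distrib single_diff sum_subtractf)
qed

lemma null_uminus: "x \<in> null \<Longrightarrow> - x \<in> null"
  using null.scale[of x "- 1"] by (simp add: lscale_minus_one)

definition skein_eq :: "lweb \<Rightarrow> lweb \<Rightarrow> bool" where
  "skein_eq x y \<longleftrightarrow> x - y \<in> null"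

lemma equivp_skein_eq: "equivp skein_eq"
proof (rule equivpI)
  show "reflp skein_eq"
    by (rule reflpI) (simp add: skein_eq_def null.zero)
  show "symp skein_eq"
  proof (rule sympI)
    fix x y assume "skein_eq x y"
    then show "skein_eq y x"
      using null_uminus[of "x - y"] by (simp add: skein_eq_def)
  qed
  show "transp skein_eq"
  proof (rule transpI)
    fix x y z assume "skein_eq x y" "skein_eq y z"
    then show "skein_eq x z"
      using null.add[of "x - y" "y - z"] by (simp add: skein_eq_def)
  qed
qed

quotient_type skein = lweb / skein_eq
  by (rule equivp_skein_eq)

instantiation skein :: ab_group_add
begin

lift_definition zero_skein :: skein is 0 .

lift_definition plus_skein :: "skein \<Rightarrow> skein \<Rightarrow> skein" is "(+)"
  by (simp add: skein_eq_def add_diff_add null.add)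

lift_definition uminus_skein :: "skein \<Rightarrow> skein" is uminus
  using null_uminus by (fastforce simp: skein_eq_def)

lift_definition minus_skein :: "skein \<Rightarrow> skein \<Rightarrow> skein" is "(-)"
proof -
  fix x x' y y' assume "skein_eq x x'" "skein_eq y y'"
  then show "skein_eq (x - y) (x' - y')"
    using null.add[of "x - x'" "- (y - y')"] null_uminus[of "y - y'"]
    by (simp add: skein_eq_def algebra_simps)
qed

instance
  by standard (transfer; simp add: skein_eq_def null.zero algebra_simps)+

end

lift_definition skein_scale :: "K \<Rightarrow> skein \<Rightarrow> skein"  (infixr \<open>*\<^sub>K\<close> 75) is lscale
proof -
  fix c x y assume "skein_eq x y"
  moreover have "lscale c x - lscale c y = lscale c (x - y)"
    by (rule poly_mapping_eqI) (simp add: lookup_minus right_diff_distrib)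
  ultimately show "skein_eq (lscale c x) (lscale c y)"
    by (simp add: skein_eq_def null.scale)
qed

lemma lscale_add_right: "lscale c (x + y) = lscale c x + lscale c y"
  by (rule poly_mapping_eqI) (simp add: lookup_add distrib_left)

lemma lscale_add_left: "lscale (c + d) x = lscale c x + lscale d x"
  by (rule poly_mapping_eqI) (simp add: lookup_add distrib_right)

lemma lscale_lscale: "lscale c (lscale d x) = lscale (c * d) x"
  by (rule poly_mapping_eqI) (simp add: mult.assoc)

lemma lscale_one: "lscale 1 x = x"
  by (rule poly_mapping_eqI) simp

global_interpretation skein: vector_space skein_scale
  by standard
    (transfer; simp add: lscale_add_right lscale_add_left lscale_lscale lscale_one
       skein_eq_def null.zero)+

lift_definition web_class :: "web \<Rightarrow> skein" is "\<lambda>w. \<langle>w\<rangle>" .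

lemma skein_eq_bilinear_ext:
  assumes "\<And>r x. r \<in> null \<Longrightarrow> bilinear_ext f x r \<in> null"
    and "\<And>r x. r \<in> null \<Longrightarrow> bilinear_ext f r x \<in> null"
    and "skein_eq x x'" "skein_eq y y'"
  shows "skein_eq (bilinear_ext f x y) (bilinear_ext f x' y')"
proof -
  have "bilinear_ext f (x - x') y + bilinear_ext f x' (y - y') \<in> null"
    using assms by (auto simp: skein_eq_def intro: null.add)
  then show ?thesis
    by (simp add: bilinear_ext_diff_left bilinear_ext_diff_right skein_eq_def)
qed

lift_definition skein_comp :: "skein \<Rightarrow> skein \<Rightarrow> skein"  (infixr \<open>\<odot>\<close> 80) is "bilinear_ext Comp"
  by (rule skein_eq_bilinear_ext[OF null.below null.above])

lift_definition skein_tensor :: "skein \<Rightarrow> skein \<Rightarrow> skein"  (infixr \<open>\<otimes>\<close> 85) is "bilinear_ext Tensor"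
  by (rule skein_eq_bilinear_ext[OF null.right null.left])

definition Hom :: "strand list \<Rightarrow> strand list \<Rightarrow> skein set" where
  "Hom s t = skein.span {web_class w | w. \<turnstile> w : s \<leadsto> t}"


section \<open>Clasps\<close>

definition weight :: "strand list \<Rightarrow> int \<times> int" where
  "weight s = (int (count_list s S1), int (count_list s S2))"

text \<open>
  The strict order on all integral weights (not only the dominant ones): chains may pass through
  weights with a negative coordinate, e.g. \<open>(2, 0)\<close>, \<open>(0, 1)\<close>, \<open>(- 2, 2)\<close>, \<open>(0, 0)\<close>.
\<close>

inductive weight_less :: "int \<times> int \<Rightarrow> int \<times> int \<Rightarrow> bool"  (infix \<open>\<prec>\<close> 50) where
  "(a - 2, b + 1) \<prec> (a, b)"
| "(a + 2, b - 2) \<prec> (a, b)"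
| "\<mu> \<prec> \<nu> \<Longrightarrow> \<nu> \<prec> \<rho> \<Longrightarrow> \<mu> \<prec> \<rho>"

definition is_clasp :: "strand list \<Rightarrow> skein \<Rightarrow> bool" where
  "is_clasp s P \<longleftrightarrow> P \<in> Hom s s \<and> P \<noteq> 0 \<and> P \<odot> P = P \<and>
     (\<forall>t. weight t \<prec> weight s \<longrightarrow>
        (\<forall>w \<in> Hom s t. w \<odot> P = 0) \<and> (\<forall>w \<in> Hom t s. P \<odot> w = 0))"

definition clasp :: "strand list \<Rightarrow> skein" where
  "clasp s = (THE P. is_clasp s P)"

definition f_clasp :: "nat \<Rightarrow> skein" where
  "f_clasp n = clasp (replicate n S1)"


section \<open>The webs \<open>D_web n i j\<close>\<close>

abbreviation id1 :: "nat \<Rightarrow> skein" where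
  "id1 n \<equiv> web_class (Id (replicate n S1))"

text \<open>The tetravalent vertex.\<close>

definition X_web :: skein where
  "X_web = web_class J_web - web_class V_web"

text \<open>
  \<open>arc_web n i k\<close> has the arc of \<open>D_web n i (i + k + 1)\<close>, which crosses \<open>k\<close> strands. Top points are
  numbered from right to left. Without crossings, the arc joins the adjacent points \<open>i\<close> and
  \<open>i + 1\<close>; for \<open>i > 0\<close> this is a cup, and the bottom point \<open>0\<close> is joined to the rightmost top
  strand of the clasp by a cap. Each further crossing is put on top of the points \<open>i + k + 1\<close>
  and \<open>i + k + 2\<close>: it moves the left end of the arc from \<open>i + k + 1\<close> to \<open>i + k + 2\<close>, across
  the strand that now ends at \<open>i + k + 1\<close>.
\<close>

primrec arc_web :: "nat \<Rightarrow> nat \<Rightarrow> nat \<Rightarrow> skein" where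
  "arc_web n i 0 =
     (if i = 0 then f_clasp (n - 1) \<otimes> id1 1
      else (id1 (n - 1 - i) \<otimes> web_class (Cup S1) \<otimes> id1 (i - 1))
           \<odot> (id1 (n - 2) \<otimes> web_class (Cap S1))
           \<odot> (f_clasp (n - 1) \<otimes> id1 1))"
| "arc_web n i (Suc k) = (id1 (n - (i + k + 2)) \<otimes> X_web \<otimes> id1 (i + k)) \<odot> arc_web n i k"

text \<open>Meaningful for \<open>i < j \<le> n\<close>.\<close>

definition D_web :: "nat \<Rightarrow> nat \<Rightarrow> nat \<Rightarrow> skein" where
  "D_web n i j = arc_web n i (j - i - 1)"

end

theory Submission
  imports Defs
begin

text \<open>
  Write \<open>F\<close> for \<open>f\<^sub>n\<^sub>-\<^sub>1 \<otimes> 1\<close>. The clasp satisfies a recursion with only three terms,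
  \<open>f\<^sub>n = F + x\<^sub>n F X F + y\<^sub>n F U F\<close>, with \<open>X\<close> and \<open>U\<close> on the two rightmost strands,
  \<open>x\<^sub>n = [n-1] / ([2][n])\<close> and \<open>y\<^sub>n = [n-1] g\<^sub>n / ([n] g\<^sub>n\<^sub>+\<^sub>1)\<close>, \<open>g\<^sub>m = [2m] / [m]\<close>. That the right
  side is killed by \<open>X\<close> and \<open>U\<close> from both sides needs the expansion of \<open>f\<^sub>n\<^sub>-\<^sub>1\<close> by the same
  recursion, and comes down to four identities between quantum integers. Expanding the left factor
  \<open>F\<close> again and again, all terms but those of the asserted sum vanish, because \<open>U\<^sub>j D\<^sub>i\<^sub>,\<^sub>j = 0\<close>
  unless \<open>j = i + 1\<close>; the coefficients are telescoping products of the \<open>x\<^sub>m\<close> and \<open>y\<^sub>m\<close>.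

  That this element is the clasp, and the only one, requires that every web on the word \<open>1\<^sup>n\<close> is a
  combination of products of \<open>X\<close>'s and \<open>U\<close>'s. Type 2 strands are replaced by pairs of type 1
  strands, and cups and caps are cancelled with the help of the decomposition
  \<open>A\<^sub>m\<^sub>+\<^sub>1 = A\<^sub>m + A\<^sub>m X A\<^sub>m + A\<^sub>m U A\<^sub>m\<close> of the algebra generated by \<open>X\<close> and \<open>U\<close>. That the
  element is not zero is seen in the vector representation of quantum \<open>sp(4)\<close>: \<open>X\<close> and \<open>U\<close>
  kill the tensor power of the highest weight vector, so \<open>f\<^sub>n\<close> has the same matrix coefficient
  there as the identity.
\<close>

section \<open>The web category as a ring\<close>

text \<open>\<open>X\<close> is a better generator than \<open>I\<close> or \<open>J\<close> because
  it is invariant under a quarter turn: it equals both \<open>J - V\<close> and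
  \<open>I - U\<close>, and bending a strand carries one form to the other. For this reason every
  product of a right, a left and a right generator on three strands collapses to terms with one
  right generator. Type 2 strands can be doubled without loss, since \<open>mrg * spl\<close> is a
  nonzero multiple of the identity; likewise a cap is recovered from \<open>U\<close> because the
  loop value is not zero. Hence being killed by \<open>X\<close> and \<open>U\<close> is as strong
  as being killed by all webs to lower words. In the proof of the recursion one term resists: a word
  in which a generator on the inner pair stands next to \<open>U\<close> on the last pair. It cannot
  be reduced and has to cancel, which is one of the four scalar identities. Nonvanishing of the
  clasp is the one fact that rewriting cannot supply, because a presentation by relations does not
  exclude a collapse of the quotient; it calls for a linear functional that vanishes on
  \<open>null\<close>.\<close>

lemma bilinear_ext_add_left: "bilinear_ext f (x + x') y = bilinear_ext f x y + bilinear_ext f x' y"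
  using bilinear_ext_diff_left[of f "x + x'" x' y] by (simp add: algebra_simps)

lemma bilinear_ext_add_right: "bilinear_ext f x (y + y') = bilinear_ext f x y + bilinear_ext f x y'"
  using bilinear_ext_diff_right[of f x "y + y'" y'] by (simp add: algebra_simps)

lemma lscale_single: "lscale c (Poly_Mapping.single w d) = Poly_Mapping.single w (c * d)"
  by (rule poly_mapping_eqI) (simp add: lookup_single when_def)

lemma lscale_zero_right [simp]: "lscale c 0 = 0"
  by (rule poly_mapping_eqI) simp

lemma keys_lscale_subset: "Poly_Mapping.keys (lscale c x) \<subseteq> Poly_Mapping.keys x"
  by (auto simp: in_keys_iff)

lemma lscale_sum: "lscale c (sum g A) = (\<Sum>a\<in>A. lscale c (g a))"
  by (induction A rule: infinite_finite_induct) (auto simp: lscale_add_right)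

lemma bilinear_ext_lscale_left: "bilinear_ext f (lscale c x) y = lscale c (bilinear_ext f x y)"
proof -
  have "bilinear_ext f (lscale c x) y =
     (\<Sum>a\<in>Poly_Mapping.keys x. \<Sum>b\<in>Poly_Mapping.keys y.
        Poly_Mapping.single (f a b) (Poly_Mapping.lookup (lscale c x) a * Poly_Mapping.lookup y b))"
    by (rule bilinear_ext_superset) (use keys_lscale_subset in auto)
  also have "\<dots> = lscale c (bilinear_ext f x y)"
    by (simp add: bilinear_ext_def lscale_sum lscale_single mult.assoc)
  finally show ?thesis .
qed

lemma bilinear_ext_lscale_right: "bilinear_ext f x (lscale c y) = lscale c (bilinear_ext f x y)"
proof -
  have "bilinear_ext f x (lscale c y) =
     (\<Sum>a\<in>Poly_Mapping.keys x. \<Sum>b\<in>Poly_Mapping.keys y.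
        Poly_Mapping.single (f a b) (Poly_Mapping.lookup x a * Poly_Mapping.lookup (lscale c y) b))"
    by (rule bilinear_ext_superset) (use keys_lscale_subset in auto)
  also have "\<dots> = lscale c (bilinear_ext f x y)"
    by (simp add: bilinear_ext_def lscale_sum lscale_single mult.left_commute)
  finally show ?thesis .
qed

lemma bilinear_ext_lweb_of [simp]: "bilinear_ext f \<langle>v\<rangle> \<langle>w\<rangle> = \<langle>f v w\<rangle>"
  by (simp add: bilinear_ext_def)

lemma web_class_comp: "web_class v \<odot> web_class w = web_class (v \<cdot> w)"
  by transfer (simp add: skein_eq_def null.zero)

lemma web_class_tensor: "web_class v \<otimes> web_class w = web_class (v \<parallel> w)"
  by transfer (simp add: skein_eq_def null.zero)

lemma skein_comp_add_left: "(x + y) \<odot> z = x \<odot> z + y \<odot> z"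
  by transfer (simp add: bilinear_ext_add_left skein_eq_def null.zero)

lemma skein_comp_add_right: "x \<odot> (y + z) = x \<odot> y + x \<odot> z"
  by transfer (simp add: bilinear_ext_add_right skein_eq_def null.zero)

lemma skein_comp_scale_left: "(c *\<^sub>K x) \<odot> y = c *\<^sub>K (x \<odot> y)"
  by transfer (simp add: bilinear_ext_lscale_left skein_eq_def null.zero)

lemma skein_comp_scale_right: "x \<odot> (c *\<^sub>K y) = c *\<^sub>K (x \<odot> y)"
  by transfer (simp add: bilinear_ext_lscale_right skein_eq_def null.zero)

lemma web_class_single: "c *\<^sub>K web_class w = abs_skein (Poly_Mapping.single w c)"
  by (metis (no_types) lscale_single mult.right_neutral skein_scale.abs_eq web_class.abs_eq)

lemma abs_skein_add: "abs_skein (x + y) = abs_skein x + abs_skein y"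
  by (simp add: plus_skein.abs_eq)

lemma lweb_induct [case_names zero add]:
  assumes "P 0" "\<And>x c w. P x \<Longrightarrow> P (x + lscale c \<langle>w\<rangle>)"
  shows "P (x :: lweb)"
proof (induction x rule: update_induct)
  case const
  then show ?case by (rule assms(1))
next
  case (update f a b)
  have "Poly_Mapping.update a b f = f + lscale b \<langle>a\<rangle>"
    by (rule poly_mapping_eqI)
      (use update(1) in \<open>auto simp: lookup_add lookup_update lookup_single in_keys_iff when_def\<close>)
  then show ?case using assms(2)[OF update(3)] by simp
qed

text \<open>Multilinear identities between skeins are proved by applying this rule to one argument
  after another, until only webs are left and an isotopy move finishes.\<close>

lemma skein_induct [case_names zero add]:
  assumes "P 0" "\<And>x c w. P x \<Longrightarrow> P (x + c *\<^sub>K web_class w)"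
  shows "P x"
proof (induction x rule: skein.abs_induct)
  case (1 y)
  show ?case
  proof (induction y rule: lweb_induct)
    case zero
    then show ?case using assms(1) by (simp add: zero_skein_def)
  next
    case (add x c w)
    then show ?case
      using assms(2)[OF add, of c w] by (simp add: web_class_single lscale_single abs_skein_add)
  qed
qed

lemma web_class_isotopic: "v \<approx> w \<Longrightarrow> web_class v = web_class w"
  by transfer (simp add: skein_eq_def null.isotopy)

lemma skein_comp_zero [simp]: "0 \<odot> x = 0" "x \<odot> 0 = 0"
  using skein_comp_add_left[of 0 0 x] skein_comp_add_right[of x 0 0] by simp_all

lemma skein_comp_assoc: "(x \<odot> y) \<odot> z = x \<odot> (y \<odot> z)"
proof (induction x rule: skein_induct)
  case (add x c u)
  have "(web_class u \<odot> y) \<odot> z = web_class u \<odot> (y \<odot> z)"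
  proof (induction y rule: skein_induct)
    case (add y c v)
    have "(web_class u \<odot> web_class v) \<odot> z = web_class u \<odot> (web_class v \<odot> z)"
    proof (induction z rule: skein_induct)
      case (add z c w)
      then show ?case
        by (simp add: skein_comp_add_right skein_comp_scale_right web_class_comp
            web_class_isotopic[OF isotopic.comp_assoc])
    qed simp
    with add show ?case
      by (simp add: skein_comp_add_left skein_comp_add_right skein_comp_scale_left
          skein_comp_scale_right)
  qed simp
  with add show ?case
    by (simp add: skein_comp_add_left skein_comp_scale_left)
qed simp

text \<open>A ring without unit: each \<open>ident s\<close> is neutral only for matching endpoints,
  and composites that do not fit are zero. The instance provides associativity and distributivity of
  stacking to the simplifier.\<close>

instantiation skein :: ring
begin

definition times_skein :: "skein \<Rightarrow> skein \<Rightarrow> skein" where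
  "times_skein x y = x \<odot> y"

instance
  by standard (simp_all add: times_skein_def skein_comp_assoc skein_comp_add_left
      skein_comp_add_right)

end

lemma comp_eq_times: "x \<odot> y = x * y"
  by (simp add: times_skein_def)

lemma scale_times [simp]:
  "(c *\<^sub>K x) * y = c *\<^sub>K (x * y)" "x * (c *\<^sub>K y) = c *\<^sub>K (x * y)" for x y :: skein
  by (simp_all add: times_skein_def skein_comp_scale_left skein_comp_scale_right)

lemma web_class_times: "web_class v * web_class w = web_class (v \<cdot> w)"
  by (simp add: times_skein_def web_class_comp)

lemma tensor_add_left: "(x + y) \<otimes> z = x \<otimes> z + y \<otimes> z"
  by transfer (simp add: bilinear_ext_add_left skein_eq_def null.zero)

lemma tensor_add_right: "x \<otimes> (y + z) = x \<otimes> y + x \<otimes> z"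
  by transfer (simp add: bilinear_ext_add_right skein_eq_def null.zero)

lemma tensor_diff_left: "(x - y) \<otimes> z = x \<otimes> z - y \<otimes> z"
  by transfer (simp add: bilinear_ext_diff_left skein_eq_def null.zero)

lemma tensor_diff_right: "x \<otimes> (y - z) = x \<otimes> y - x \<otimes> z"
  by transfer (simp add: bilinear_ext_diff_right skein_eq_def null.zero)

lemma tensor_scale [simp]:
  "(c *\<^sub>K x) \<otimes> y = c *\<^sub>K (x \<otimes> y)" "x \<otimes> (c *\<^sub>K y) = c *\<^sub>K (x \<otimes> y)"
  by (transfer; simp add: bilinear_ext_lscale_left bilinear_ext_lscale_right skein_eq_def
      null.zero)+

lemma tensor_zero [simp]: "0 \<otimes> x = 0" "x \<otimes> 0 = 0"
  using tensor_add_left[of 0 0 x] tensor_add_right[of x 0 0] by simp_all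

lemma tensor_assoc: "(x \<otimes> y) \<otimes> z = x \<otimes> (y \<otimes> z)"
proof (induction x rule: skein_induct)
  case (add x c u)
  have "(web_class u \<otimes> y) \<otimes> z = web_class u \<otimes> (y \<otimes> z)"
  proof (induction y rule: skein_induct)
    case (add y c v)
    have "(web_class u \<otimes> web_class v) \<otimes> z = web_class u \<otimes> (web_class v \<otimes> z)"
    proof (induction z rule: skein_induct)
      case (add z c w)
      then show ?case
        by (simp add: tensor_add_right web_class_tensor
            web_class_isotopic[OF isotopic.tensor_assoc])
    qed simp
    with add show ?case
      by (simp add: tensor_add_left tensor_add_right)
  qed simp
  with add show ?case
    by (simp add: tensor_add_left)
qed simp

abbreviation ident :: "strand list \<Rightarrow> skein" where
  "ident s \<equiv> web_class (Id s)"

lemma tensor_empty [simp]: "ident [] \<otimes> x = x" "x \<otimes> ident [] = x"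
proof (induction x rule: skein_induct)
  case (add x c w)
  {
    case 1
    with add show ?case
      by (simp add: tensor_add_right web_class_tensor
          web_class_isotopic[OF isotopic.tensor_empty_left])
  next
    case 2
    with add show ?case
      by (simp add: tensor_add_left web_class_tensor
          web_class_isotopic[OF isotopic.tensor_empty_right])
  }
qed simp_all

lemma ident_tensor: "ident s \<otimes> ident t = ident (s @ t)"
  by (simp add: web_class_tensor web_class_isotopic[OF isotopic.tensor_id])

section \<open>Typing\<close>

lemma Hom_induct [consumes 1, case_names zero add]:
  assumes "x \<in> Hom s t" "P 0"
    "\<And>x c w. x \<in> Hom s t \<Longrightarrow> P x \<Longrightarrow> \<turnstile> w : s \<leadsto> t \<Longrightarrow> P (x + c *\<^sub>K web_class w)"
  shows "P x"
proof -
  have "x \<in> Hom s t \<and> P x"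
    using assms(1)[unfolded Hom_def]
  proof (induction rule: skein.span_induct_alt)
    case base
    then show ?case by (simp add: Hom_def skein.span_zero assms(2))
  next
    case (step c x y)
    then have "P (y + c *\<^sub>K x)" "y + c *\<^sub>K x \<in> Hom s t"
      using assms(3) unfolding Hom_def
      by (auto intro!: skein.span_add skein.span_scale intro: skein.span_base)
    then show ?case by (simp add: add.commute)
  qed
  then show ?thesis by simp
qed

lemma Hom_web: "\<turnstile> w : s \<leadsto> t \<Longrightarrow> web_class w \<in> Hom s t"
  unfolding Hom_def by (rule skein.span_base) auto

lemma Hom_add [intro]: "x \<in> Hom s t \<Longrightarrow> y \<in> Hom s t \<Longrightarrow> x + y \<in> Hom s t"
  unfolding Hom_def by (rule skein.span_add)

lemma Hom_diff [intro]: "x \<in> Hom s t \<Longrightarrow> y \<in> Hom s t \<Longrightarrow> x - y \<in> Hom s t"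
  unfolding Hom_def by (rule skein.span_diff)

lemma Hom_scale [intro]: "x \<in> Hom s t \<Longrightarrow> c *\<^sub>K x \<in> Hom s t"
  unfolding Hom_def by (rule skein.span_scale)

lemma Hom_zero [intro, simp]: "0 \<in> Hom s t"
  unfolding Hom_def by (rule skein.span_zero)

lemma Hom_ident [intro, simp]: "ident s \<in> Hom s s"
  by (intro Hom_web has_ends.intros)

lemma Hom_times [intro]: "x \<in> Hom t u \<Longrightarrow> y \<in> Hom s t \<Longrightarrow> x * y \<in> Hom s u"
proof (induction x rule: Hom_induct)
  case (add x c v)
  have "web_class v * y \<in> Hom s u" using \<open>y \<in> Hom s t\<close>
  proof (induction y rule: Hom_induct)
    case (add y d w)
    then have "web_class (v \<cdot> w) \<in> Hom s u"
      using \<open>\<turnstile> v : t \<leadsto> u\<close> by (intro Hom_web has_ends.intros)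
    with add show ?case by (auto simp: distrib_left web_class_times)
  qed simp
  with add show ?case by (auto simp: distrib_right)
qed simp

lemma Hom_tensor: "x \<in> Hom s t \<Longrightarrow> y \<in> Hom s' t' \<Longrightarrow> x \<otimes> y \<in> Hom (s @ s') (t @ t')"
proof (induction x rule: Hom_induct)
  case (add x c v)
  have "web_class v \<otimes> y \<in> Hom (s @ s') (t @ t')" using \<open>y \<in> Hom s' t'\<close>
  proof (induction y rule: Hom_induct)
    case (add y d w)
    then have "web_class (v \<parallel> w) \<in> Hom (s @ s') (t @ t')"
      using \<open>\<turnstile> v : s \<leadsto> t\<close> by (intro Hom_web has_ends.intros)
    with add show ?case by (auto simp: tensor_add_right web_class_tensor)
  qed simp
  with add show ?case by (auto simp: tensor_add_left)
qed simp

lemma ident_times: "x \<in> Hom s t \<Longrightarrow> ident t * x = x"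
proof (induction x rule: Hom_induct)
  case (add x c w)
  then show ?case
    by (simp add: distrib_left web_class_times web_class_isotopic[OF isotopic.comp_id_left])
qed simp

lemma times_ident: "x \<in> Hom s t \<Longrightarrow> x * ident s = x"
proof (induction x rule: Hom_induct)
  case (add x c w)
  then show ?case
    by (simp add: distrib_right web_class_times web_class_isotopic[OF isotopic.comp_id_right])
qed simp

lemma interchange:
  assumes "v \<in> Hom t u" "w \<in> Hom s t" "v' \<in> Hom t' u'" "w' \<in> Hom s' t'"
  shows "(v \<otimes> v') * (w \<otimes> w') = (v * w) \<otimes> (v' * w')"
  using assms(1)
proof (induction v rule: Hom_induct)
  case (add x c a)
  have "(web_class a \<otimes> v') * (w \<otimes> w') = (web_class a * w) \<otimes> (v' * w')"
    using assms(2)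
  proof (induction w rule: Hom_induct)
    case (add x d b)
    have "(web_class a \<otimes> v') * (web_class b \<otimes> w') = (web_class a * web_class b) \<otimes> (v' * w')"
      using assms(3)
    proof (induction v' rule: Hom_induct)
      case (add x e a')
      have "(web_class a \<otimes> web_class a') * (web_class b \<otimes> w')
          = (web_class a * web_class b) \<otimes> (web_class a' * w')"
        using assms(4)
      proof (induction w' rule: Hom_induct)
        case (add x f b')
        have "(a \<parallel> a') \<cdot> (b \<parallel> b') \<approx> (a \<cdot> b) \<parallel> (a' \<cdot> b')"
          by (rule isotopic.interchange) fact+
        then have "web_class ((a \<parallel> a') \<cdot> (b \<parallel> b')) = web_class ((a \<cdot> b) \<parallel> (a' \<cdot> b'))"
          by (rule web_class_isotopic)
        with add show ?case
          by (simp add: tensor_add_right distrib_left web_class_times web_class_tensor)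
      qed simp
      with add show ?case
        by (simp add: tensor_add_right tensor_add_left distrib_right)
    qed simp
    with add show ?case
      by (simp add: tensor_add_left distrib_left)
  qed simp
  with add show ?case
    by (simp add: tensor_add_left distrib_right)
qed simp

section \<open>Relations between the elementary webs\<close>

abbreviation one :: skein (\<open>\<one>\<close>) where "\<one> \<equiv> ident [S1]"

definition cup :: skein where "cup = web_class (Cup S1)"
definition cap :: skein where "cap = web_class (Cap S1)"
definition cup2 :: skein where "cup2 = web_class (Cup S2)"
definition cap2 :: skein where "cap2 = web_class (Cap S2)"
definition mrg :: skein where "mrg = web_class Merge"
definition spl :: skein where "spl = web_class Split"
definition X :: skein where "X = X_web"
definition U :: skein where "U = cup * cap"

text \<open>\<open>\<alpha>\<close> is the value of the bigon and \<open>- \<delta>\<close> that of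
  the type 1 loop; \<open>\<delta>\<close> reappears as the eigenvalue of \<open>X\<close> on a
  cup.\<close>

definition qa :: K (\<open>\<alpha>\<close>) where "\<alpha> = - ([2]\<^sub>q\<^sup>2)"
definition qd :: K (\<open>\<delta>\<close>) where "\<delta> = [6]\<^sub>q * [2]\<^sub>q / [3]\<^sub>q"

named_theorems typing

lemma Hom_gen [typing]:
  "cup \<in> Hom [] [S1, S1]" "cap \<in> Hom [S1, S1] []"
  "cup2 \<in> Hom [] [S2, S2]" "cap2 \<in> Hom [S2, S2] []"
  "mrg \<in> Hom [S1, S1] [S2]" "spl \<in> Hom [S2] [S1, S1]"
  by (auto simp: cup_def cap_def cup2_def cap2_def mrg_def spl_def intro!: Hom_web has_ends.intros)

text \<open>The composite words are variables tied by equations because a concrete list does not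
  unify with an append; the simplifier checks the equations afterwards.\<close>

lemma Hom_tensorI [typing]:
  "x \<in> Hom s t \<Longrightarrow> y \<in> Hom s' t' \<Longrightarrow> r = s @ s' \<Longrightarrow> u = t @ t' \<Longrightarrow> x \<otimes> y \<in> Hom r u"
  by (simp add: Hom_tensor)

declare Hom_times [typing] Hom_ident [typing]

lemma cut_left:
  assumes "v \<in> Hom s t" "w \<in> Hom s' t'"
  shows "v \<otimes> w = (v \<otimes> ident t') * (ident s \<otimes> w)"
  using interchange[OF assms(1) Hom_ident Hom_ident assms(2)] assms
  by (simp add: ident_times times_ident)

lemma cut_right:
  assumes "v \<in> Hom s t" "w \<in> Hom s' t'"
  shows "v \<otimes> w = (ident t \<otimes> w) * (v \<otimes> ident s')"
  using interchange[OF Hom_ident assms(1) assms(2) Hom_ident] assms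
  by (simp add: ident_times times_ident)

lemma tensor_times_ident:
  assumes "v \<in> Hom t u" "w \<in> Hom s t"
  shows "(v * w) \<otimes> ident r = (v \<otimes> ident r) * (w \<otimes> ident r)"
  using interchange[OF assms Hom_ident Hom_ident, of r]
  by (simp add: ident_times[OF Hom_ident])

lemma ident_tensor_times:
  assumes "v \<in> Hom t u" "w \<in> Hom s t"
  shows "ident r \<otimes> (v * w) = (ident r \<otimes> v) * (ident r \<otimes> w)"
  using interchange[OF Hom_ident Hom_ident assms, of r]
  by (simp add: ident_times[OF Hom_ident])

lemma tensor_commute:
  assumes "v \<in> Hom s t" "w \<in> Hom s' t'"
  shows "(v \<otimes> ident t') * (ident s \<otimes> w) = (ident t \<otimes> w) * (v \<otimes> ident s')"
  using cut_left[OF assms] cut_right[OF assms] by simp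

lemma zigzag [simp]:
  "(cap \<otimes> \<one>) * (\<one> \<otimes> cup) = \<one>" "(\<one> \<otimes> cap) * (cup \<otimes> \<one>) = \<one>"
  "(cap2 \<otimes> ident [S2]) * (ident [S2] \<otimes> cup2) = ident [S2]"
  by (simp_all add: cup_def cap_def cup2_def cap2_def web_class_times web_class_tensor
      web_class_isotopic[OF isotopic.zigzag_left] web_class_isotopic[OF isotopic.zigzag_right])

lemma skein_eq_null: "r \<in> null \<Longrightarrow> abs_skein r = 0"
  by (simp add: zero_skein_def skein.abs_eq_iff skein_eq_def)

lemma web_class_abs: "web_class w = abs_skein \<langle>w\<rangle>"
  by (simp add: web_class.abs_eq)

lemma abs_skein_diff: "abs_skein (x - y) = abs_skein x - abs_skein y"
  by (simp add: minus_skein.abs_eq)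

lemma abs_skein_scale: "abs_skein (lscale c x) = c *\<^sub>K abs_skein x"
  by (simp add: skein_scale.abs_eq)

lemma local_relation: "x - y \<in> local_rel \<Longrightarrow> abs_skein x = abs_skein y"
  using skein_eq_null[OF null.local, of "x - y"] by (simp add: abs_skein_diff)

lemma cap_cup: "cap * cup = - \<delta> *\<^sub>K ident []"
  using local_relation[OF loop1]
  by (simp add: cap_def cup_def web_class_times qd_def abs_skein_scale web_class_abs[symmetric])

lemma mrg_cup [simp]: "mrg * cup = 0"
  using skein_eq_null[OF null.local[OF monogon]]
  by (simp add: mrg_def cup_def web_class_times web_class_abs[symmetric])

lemma mrg_spl: "mrg * spl = \<alpha> *\<^sub>K ident [S2]"
  using local_relation[OF bigon]
  by (simp add: mrg_def spl_def web_class_times qa_def abs_skein_scale web_class_abs[symmetric])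

lemma triangle_zero: "mrg * (\<one> \<otimes> cap \<otimes> \<one>) * (spl \<otimes> spl) = 0"
  using skein_eq_null[OF null.local[OF triangle]] unfolding mult.assoc
  by (simp add: mrg_def spl_def cap_def web_class_times web_class_tensor flip: web_class_abs)

text \<open>The two halves of \<open>J_web\<close>, cut across its horizontal type 2 edge:
  \<open>rot_spl\<close> is the vertex on the right strand, \<open>rot_mrg\<close> the one on the
  left strand.\<close>

definition rot_spl :: skein where "rot_spl = (\<one> \<otimes> cap) * (spl \<otimes> \<one>)"
definition rot_mrg :: skein where "rot_mrg = (\<one> \<otimes> mrg) * (cup \<otimes> \<one>)"

lemma rot_typ [typing]: "rot_spl \<in> Hom [S2, S1] [S1]" "rot_mrg \<in> Hom [S1] [S1, S2]"
  unfolding rot_spl_def rot_mrg_def by (rule typing | simp; fail)+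

lemma X_eq_J: "X = (\<one> \<otimes> rot_spl) * (rot_mrg \<otimes> \<one>) - ident [S1, S1]"
  by (simp add: X_def X_web_def J_web_def V_web_def rot_spl_def rot_mrg_def cup_def cap_def
      spl_def mrg_def web_class_times web_class_tensor)

lemma X_eq_I: "X = spl * mrg - U"
proof -
  have "web_class I_web - web_class J_web - (web_class U_web - web_class V_web) = 0"
    using skein_eq_null[OF null.local[OF square]] by (simp add: abs_skein_diff flip: web_class_abs)
  moreover have "spl * mrg = web_class I_web" "U = web_class U_web"
    by (simp_all add: I_web_def U_web_def U_def spl_def mrg_def cup_def cap_def web_class_times)
  ultimately show ?thesis
    by (simp add: X_def X_web_def algebra_simps)
qed

lemma X_typ [typing]: "U \<in> Hom [S1, S1] [S1, S1]" "X \<in> Hom [S1, S1] [S1, S1]"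
proof -
  show U: "U \<in> Hom [S1, S1] [S1, S1]"
    unfolding U_def by (rule typing)+
  have "spl * mrg \<in> Hom [S1, S1] [S1, S1]" by (rule typing)+
  then show "X \<in> Hom [S1, S1] [S1, S1]"
    unfolding X_eq_I using U by blast
qed

lemmas word_assoc = tensor_assoc ident_tensor mult.assoc

definition cup_cup :: skein where "cup_cup = (\<one> \<otimes> cup \<otimes> \<one>) * cup"
definition cap_cap :: skein where "cap_cap = cap * (\<one> \<otimes> cap \<otimes> \<one>)"
definition cap_mrg :: skein where "cap_mrg = cap2 * (mrg \<otimes> ident [S2])"

lemma nested_typing [typing]:
  "cup_cup \<in> Hom [] [S1, S1, S1, S1]" "cap_cap \<in> Hom [S1, S1, S1, S1] []"
  "cap_mrg \<in> Hom [S1, S1, S2] []"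
  unfolding cup_cup_def cap_cap_def cap_mrg_def by (rule typing | simp; fail)+

lemma spl_turn: "spl = (ident [S1, S1] \<otimes> cap_mrg) * (cup_cup \<otimes> ident [S2])"
proof -
  have "spl = (ident [S1, S1] \<otimes> cap2) * (ident [S1, S1] \<otimes> mrg \<otimes> ident [S2]) * (cup_cup \<otimes> ident [S2])"
    unfolding mult.assoc
    by (simp add: spl_def cap2_def mrg_def cup_cup_def cup_def web_class_times web_class_tensor
        web_class_isotopic[OF turn_right])
  also have "(ident [S1, S1] \<otimes> cap2) * (ident [S1, S1] \<otimes> mrg \<otimes> ident [S2]) = ident [S1, S1] \<otimes> cap_mrg"
    unfolding cap_mrg_def by (subst ident_tensor_times) (rule typing | simp; fail)+
  finally show ?thesis .
qed

lemma cap_cup_cup: "(cap \<otimes> ident [S1, S1]) * cup_cup = cup"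
proof -
  have "(cap \<otimes> ident [S1, S1]) * cup_cup = (((cap \<otimes> \<one>) * (\<one> \<otimes> cup)) \<otimes> \<one>) * cup"
    unfolding cup_cup_def
    by (subst tensor_times_ident, (rule typing | simp; fail)+) (simp add: word_assoc)
  then show ?thesis
    by (simp add: ident_tensor ident_times[OF Hom_gen(1)])
qed

text \<open>The monogon relation is given only for a merge. Turning the vertex upside down carries
  the cap to the bottom of a merge, where it is a cup and that relation applies.\<close>

lemma cap_spl [simp]: "cap * spl = 0"
proof -
  have "cap * spl = (cap \<otimes> ident []) * (ident [S1, S1] \<otimes> cap_mrg) * (cup_cup \<otimes> ident [S2])"
    by (simp add: mult.assoc flip: spl_turn)
  also have "(cap \<otimes> ident []) * (ident [S1, S1] \<otimes> cap_mrg) = (ident [] \<otimes> cap_mrg) * (cap \<otimes> ident [S1, S1, S2])"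
    by (rule tensor_commute) (rule typing)+
  also have "(ident [] \<otimes> cap_mrg) * (cap \<otimes> ident [S1, S1, S2]) * (cup_cup \<otimes> ident [S2])
      = cap_mrg * (((cap \<otimes> ident [S1, S1]) * cup_cup) \<otimes> ident [S2])"
    by (subst tensor_times_ident, (rule typing | simp; fail)+) (simp add: word_assoc)
  also have "\<dots> = cap2 * ((mrg * cup) \<otimes> ident [S2])"
    unfolding cap_cup_cup cap_mrg_def
    by (subst tensor_times_ident, (rule typing | simp; fail)+) (simp add: word_assoc)
  finally show ?thesis by simp
qed

text \<open>A vertex is dragged along a type 2 cup to the other leg and arrives there upside down,
  above two nested type 1 cups. With its mirror image \<open>cap_cap_spl\<close> this eliminates
  type 2 cups and caps in \<open>lay_web\<close>.\<close>

lemma spl_cup2: "(spl \<otimes> ident [S2]) * cup2 = (ident [S1, S1] \<otimes> mrg) * cup_cup"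
proof -
  have "(cap_mrg \<otimes> ident [S2]) * (ident [S1, S1] \<otimes> cup2)
      = (cap2 \<otimes> ident [S2]) * ((mrg \<otimes> ident [S2, S2]) * (ident [S1, S1] \<otimes> cup2))"
    unfolding cap_mrg_def
    by (subst tensor_times_ident, (rule typing | simp; fail)+) (simp add: word_assoc)
  also have "(mrg \<otimes> ident [S2, S2]) * (ident [S1, S1] \<otimes> cup2) = (ident [S2] \<otimes> cup2) * (mrg \<otimes> ident [])"
    by (rule tensor_commute) (rule typing)+
  finally have cap_mrg: "(cap_mrg \<otimes> ident [S2]) * (ident [S1, S1] \<otimes> cup2) = mrg"
    by (simp add: ident_times[OF Hom_gen(5)] flip: mult.assoc)
  have "(spl \<otimes> ident [S2]) * cup2
      = (ident [S1, S1] \<otimes> cap_mrg \<otimes> ident [S2]) * ((cup_cup \<otimes> ident [S2, S2]) * (ident [] \<otimes> cup2))"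
    unfolding spl_turn
    by (subst tensor_times_ident, (rule typing | simp; fail)+) (simp add: word_assoc)
  also have "(cup_cup \<otimes> ident [S2, S2]) * (ident [] \<otimes> cup2) = (ident [S1, S1, S1, S1] \<otimes> cup2) * (cup_cup \<otimes> ident [])"
    by (rule tensor_commute) (rule typing)+
  also have "(ident [S1, S1] \<otimes> cap_mrg \<otimes> ident [S2]) * ((ident [S1, S1, S1, S1] \<otimes> cup2) * (cup_cup \<otimes> ident []))
      = (ident [S1, S1] \<otimes> ((cap_mrg \<otimes> ident [S2]) * (ident [S1, S1] \<otimes> cup2))) * cup_cup"
    by (subst ident_tensor_times, (rule typing | simp; fail)+)
      (simp add: mult.assoc flip: tensor_assoc, simp add: tensor_assoc ident_tensor)
  finally show ?thesis
    unfolding cap_mrg .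
qed

text \<open>The zigzag move for a cable of two parallel strands, straightened one strand at a
  time.\<close>

lemma cap_cap_cup_cup: "(cap_cap \<otimes> ident [S1, S1]) * (ident [S1, S1] \<otimes> cup_cup) = ident [S1, S1]"
proof -
  have "(\<one> \<otimes> cap \<otimes> ident [S1, S1, S1]) * (ident [S1, S1, S1] \<otimes> cup \<otimes> \<one>)
      = ((\<one> \<otimes> cap) \<otimes> ident [S1, S1, S1]) * (ident [S1, S1, S1] \<otimes> (cup \<otimes> \<one>))"
    by (simp add: word_assoc)
  also have "\<dots> = (\<one> \<otimes> (cup \<otimes> \<one>)) * ((\<one> \<otimes> cap) \<otimes> \<one>)"
    by (rule tensor_commute) (rule typing | simp; fail)+
  finally have mid: "(\<one> \<otimes> cap \<otimes> ident [S1, S1, S1]) * (ident [S1, S1, S1] \<otimes> cup \<otimes> \<one>)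
      = (\<one> \<otimes> cup \<otimes> \<one>) * (\<one> \<otimes> cap \<otimes> \<one>)"
    by (simp add: word_assoc)
  have "(cap_cap \<otimes> ident [S1, S1]) = (cap \<otimes> ident [S1, S1]) * (\<one> \<otimes> cap \<otimes> ident [S1, S1, S1])"
    unfolding cap_cap_def
    by (subst tensor_times_ident, (rule typing | simp; fail)+) (simp add: word_assoc)
  moreover have "(ident [S1, S1] \<otimes> cup_cup) = (ident [S1, S1, S1] \<otimes> cup \<otimes> \<one>) * (ident [S1, S1] \<otimes> cup)"
    unfolding cup_cup_def
    by (subst ident_tensor_times, (rule typing | simp; fail)+)
      (simp add: mult.assoc flip: tensor_assoc, simp add: tensor_assoc ident_tensor)
  ultimately have "(cap_cap \<otimes> ident [S1, S1]) * (ident [S1, S1] \<otimes> cup_cup)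
     = (cap \<otimes> ident [S1, S1]) * ((\<one> \<otimes> cap \<otimes> ident [S1, S1, S1]) * (ident [S1, S1, S1] \<otimes> cup \<otimes> \<one>))
        * (ident [S1, S1] \<otimes> cup)"
    by (simp only: mult.assoc)
  also have "\<dots> = ((cap \<otimes> ident [S1, S1]) * (\<one> \<otimes> cup \<otimes> \<one>)) * ((\<one> \<otimes> cap \<otimes> \<one>) * (ident [S1, S1] \<otimes> cup))"
    unfolding mid by (simp only: mult.assoc)
  also have "(cap \<otimes> ident [S1, S1]) * (\<one> \<otimes> cup \<otimes> \<one>) = ((cap \<otimes> \<one>) * (\<one> \<otimes> cup)) \<otimes> \<one>"
    by (subst tensor_times_ident, (rule typing | simp; fail)+) (simp add: word_assoc)
  also have "(\<one> \<otimes> cap \<otimes> \<one>) * (ident [S1, S1] \<otimes> cup) = \<one> \<otimes> ((cap \<otimes> \<one>) * (\<one> \<otimes> cup))"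
    by (subst ident_tensor_times, (rule typing | simp; fail)+)
      (simp add: mult.assoc flip: tensor_assoc, simp add: tensor_assoc ident_tensor)
  finally show ?thesis
    by (simp add: ident_tensor ident_times[OF Hom_ident])
qed

lemma cap_cap_spl: "cap_cap * (ident [S1, S1] \<otimes> spl) = cap2 * (mrg \<otimes> ident [S2])"
proof -
  have "cap_cap * (ident [S1, S1] \<otimes> spl)
     = ((cap_cap \<otimes> ident []) * (ident [S1, S1, S1, S1] \<otimes> cap_mrg)) * (ident [S1, S1] \<otimes> cup_cup \<otimes> ident [S2])"
    unfolding spl_turn
    by (subst ident_tensor_times, (rule typing | simp; fail)+)
      (simp add: mult.assoc flip: tensor_assoc, simp add: tensor_assoc ident_tensor)
  also have "(cap_cap \<otimes> ident []) * (ident [S1, S1, S1, S1] \<otimes> cap_mrg) = (ident [] \<otimes> cap_mrg) * (cap_cap \<otimes> ident [S1, S1, S2])"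
    by (rule tensor_commute) (rule typing)+
  also have "(ident [] \<otimes> cap_mrg) * (cap_cap \<otimes> ident [S1, S1, S2]) * (ident [S1, S1] \<otimes> cup_cup \<otimes> ident [S2])
     = cap_mrg * (((cap_cap \<otimes> ident [S1, S1]) * (ident [S1, S1] \<otimes> cup_cup)) \<otimes> ident [S2])"
    by (subst tensor_times_ident, (rule typing | simp; fail)+) (simp add: word_assoc)
  finally show ?thesis
    unfolding cap_cap_cup_cup by (simp add: ident_tensor times_ident[OF nested_typing(3)]) (simp add: cap_mrg_def)
qed

section \<open>Quarter turns of the tetravalent vertex\<close>

lemma rot_spl_cup: "(rot_spl \<otimes> \<one>) * (ident [S2] \<otimes> cup) = spl"
proof -
  have "(rot_spl \<otimes> \<one>) * (ident [S2] \<otimes> cup)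
      = (\<one> \<otimes> cap \<otimes> \<one>) * ((spl \<otimes> ident [S1, S1]) * (ident [S2] \<otimes> cup))"
    unfolding rot_spl_def
    by (subst tensor_times_ident, (rule typing | simp; fail)+) (simp add: word_assoc)
  also have "(spl \<otimes> ident [S1, S1]) * (ident [S2] \<otimes> cup) = (ident [S1, S1] \<otimes> cup) * (spl \<otimes> ident [])"
    by (rule tensor_commute) (rule typing)+
  also have "(\<one> \<otimes> cap \<otimes> \<one>) * ((ident [S1, S1] \<otimes> cup) * (spl \<otimes> ident []))
      = (\<one> \<otimes> ((cap \<otimes> \<one>) * (\<one> \<otimes> cup))) * spl"
    by (subst ident_tensor_times, (rule typing | simp; fail)+)
      (simp add: mult.assoc flip: tensor_assoc, simp add: tensor_assoc ident_tensor)
  also have "\<dots> = spl"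
    by (simp add: ident_tensor ident_times[OF Hom_gen(6)])
  finally show ?thesis .
qed

lemma cap_rot_mrg: "(cap \<otimes> ident [S2]) * (\<one> \<otimes> rot_mrg) = mrg"
proof -
  have "(cap \<otimes> ident [S2]) * (\<one> \<otimes> rot_mrg)
      = ((cap \<otimes> ident [S2]) * (ident [S1, S1] \<otimes> mrg)) * (\<one> \<otimes> cup \<otimes> \<one>)"
    unfolding rot_mrg_def
    by (subst ident_tensor_times, (rule typing | simp; fail)+) (simp add: word_assoc flip: tensor_assoc)
  also have "(cap \<otimes> ident [S2]) * (ident [S1, S1] \<otimes> mrg) = (ident [] \<otimes> mrg) * (cap \<otimes> ident [S1, S1])"
    by (rule tensor_commute) (rule typing)+
  also have "((ident [] \<otimes> mrg) * (cap \<otimes> ident [S1, S1])) * (\<one> \<otimes> cup \<otimes> \<one>)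
      = mrg * (((cap \<otimes> \<one>) * (\<one> \<otimes> cup)) \<otimes> \<one>)"
    by (subst tensor_times_ident, (rule typing | simp; fail)+)
      (simp add: mult.assoc tensor_assoc ident_tensor)
  also have "\<dots> = mrg"
    by (simp add: ident_tensor times_ident[OF Hom_gen(5)])
  finally show ?thesis .
qed


text \<open>Invariance of \<open>X\<close> under a quarter turn. On the left
  \<open>X = J - V\<close> is used, on the right \<open>X = I - U\<close>; bending a strand carries
  \<open>J\<close> to \<open>I\<close> and \<open>V\<close> to \<open>U\<close>.\<close>

lemma X_rotate_cup: "(X \<otimes> \<one>) * (\<one> \<otimes> cup) = (\<one> \<otimes> X) * (cup \<otimes> \<one>)"
proof -
  have "((\<one> \<otimes> rot_spl) * (rot_mrg \<otimes> \<one>)) \<otimes> \<one> * (\<one> \<otimes> cup)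
     = (\<one> \<otimes> rot_spl \<otimes> \<one>) * ((rot_mrg \<otimes> ident [S1, S1]) * (\<one> \<otimes> cup))"
    by (subst tensor_times_ident, (rule typing | simp; fail)+) (simp add: word_assoc)
  also have "(rot_mrg \<otimes> ident [S1, S1]) * (\<one> \<otimes> cup) = (ident [S1, S2] \<otimes> cup) * (rot_mrg \<otimes> ident [])"
    by (rule tensor_commute) (rule typing)+
  also have "(\<one> \<otimes> rot_spl \<otimes> \<one>) * ((ident [S1, S2] \<otimes> cup) * (rot_mrg \<otimes> ident []))
     = (\<one> \<otimes> ((rot_spl \<otimes> \<one>) * (ident [S2] \<otimes> cup))) * rot_mrg"
    by (subst ident_tensor_times, (rule typing | simp; fail)+)
      (simp add: mult.assoc flip: tensor_assoc, simp add: tensor_assoc ident_tensor)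
  also have "\<dots> = (\<one> \<otimes> (spl * mrg)) * (cup \<otimes> \<one>)"
    unfolding rot_spl_cup rot_mrg_def
    by (subst ident_tensor_times, (rule typing | simp; fail)+) (simp add: mult.assoc)
  finally have J: "((\<one> \<otimes> rot_spl) * (rot_mrg \<otimes> \<one>)) \<otimes> \<one> * (\<one> \<otimes> cup) = (\<one> \<otimes> (spl * mrg)) * (cup \<otimes> \<one>)" .
  have "(\<one> \<otimes> U) * (cup \<otimes> \<one>) = (\<one> \<otimes> cup) * ((\<one> \<otimes> cap) * (cup \<otimes> \<one>))"
    unfolding U_def by (subst ident_tensor_times, (rule typing | simp; fail)+) (simp add: mult.assoc)
  also have "\<dots> = \<one> \<otimes> cup"
    by simp (rule times_ident, (rule typing | simp; fail)+)
  finally have "(\<one> \<otimes> X) * (cup \<otimes> \<one>) = (\<one> \<otimes> (spl * mrg)) * (cup \<otimes> \<one>) - \<one> \<otimes> cup"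
    by (simp add: X_eq_I tensor_diff_right left_diff_distrib)
  moreover have "ident [S1, S1, S1] * (\<one> \<otimes> cup) = \<one> \<otimes> cup"
    by (rule ident_times) (rule typing | simp; fail)+
  ultimately show ?thesis
    using J by (simp add: X_eq_J tensor_diff_left left_diff_distrib ident_tensor)
qed

lemma X_rotate_cap: "(\<one> \<otimes> cap) * (X \<otimes> \<one>) = (cap \<otimes> \<one>) * (\<one> \<otimes> X)"
proof -
  have "(cap \<otimes> \<one>) * (\<one> \<otimes> ((\<one> \<otimes> rot_spl) * (rot_mrg \<otimes> \<one>)))
     = ((cap \<otimes> \<one>) * (ident [S1, S1] \<otimes> rot_spl)) * (\<one> \<otimes> rot_mrg \<otimes> \<one>)"
    by (subst ident_tensor_times, (rule typing | simp; fail)+)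
      (simp add: mult.assoc flip: tensor_assoc, simp add: tensor_assoc ident_tensor)
  also have "(cap \<otimes> \<one>) * (ident [S1, S1] \<otimes> rot_spl) = (ident [] \<otimes> rot_spl) * (cap \<otimes> ident [S2, S1])"
    by (rule tensor_commute) (rule typing)+
  also have "((ident [] \<otimes> rot_spl) * (cap \<otimes> ident [S2, S1])) * (\<one> \<otimes> rot_mrg \<otimes> \<one>)
     = rot_spl * (((cap \<otimes> ident [S2]) * (\<one> \<otimes> rot_mrg)) \<otimes> \<one>)"
    by (subst tensor_times_ident, (rule typing | simp; fail)+) (simp add: word_assoc)
  also have "\<dots> = (\<one> \<otimes> cap) * ((spl * mrg) \<otimes> \<one>)"
    unfolding cap_rot_mrg rot_spl_def
    by (subst tensor_times_ident, (rule typing | simp; fail)+) (simp add: mult.assoc)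
  finally have J: "(cap \<otimes> \<one>) * (\<one> \<otimes> ((\<one> \<otimes> rot_spl) * (rot_mrg \<otimes> \<one>))) = (\<one> \<otimes> cap) * ((spl * mrg) \<otimes> \<one>)" .
  have "(\<one> \<otimes> cap) * (U \<otimes> \<one>) = ((\<one> \<otimes> cap) * (cup \<otimes> \<one>)) * (cap \<otimes> \<one>)"
    unfolding U_def by (subst tensor_times_ident, (rule typing | simp; fail)+) (simp only: mult.assoc)
  also have "\<dots> = cap \<otimes> \<one>"
    by simp (rule ident_times, (rule typing | simp; fail)+)
  finally have "(\<one> \<otimes> cap) * (X \<otimes> \<one>) = (\<one> \<otimes> cap) * ((spl * mrg) \<otimes> \<one>) - cap \<otimes> \<one>"
    by (simp add: X_eq_I tensor_diff_left right_diff_distrib)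
  moreover have "(cap \<otimes> \<one>) * ident [S1, S1, S1] = cap \<otimes> \<one>"
    by (rule times_ident) (rule typing | simp; fail)+
  ultimately show ?thesis
    using J by (simp add: X_eq_J tensor_diff_right right_diff_distrib ident_tensor)
qed

text \<open>\<open>spl\<close>, \<open>mrg\<close> and the right vertex of \<open>J\<close> bound a
  triangle of type 1 edges. Its type 2 legs are the bottom end, the top end and the horizontal edge
  of \<open>J\<close>.\<close>

lemma J_triangle: "(\<one> \<otimes> mrg) * (((\<one> \<otimes> rot_spl) * (rot_mrg \<otimes> \<one>)) \<otimes> \<one>) * (\<one> \<otimes> spl) = 0"
proof -
  have "(\<one> \<otimes> mrg) * (((\<one> \<otimes> rot_spl) * (rot_mrg \<otimes> \<one>)) \<otimes> \<one>) * (\<one> \<otimes> spl)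
      = (\<one> \<otimes> mrg) * (\<one> \<otimes> rot_spl \<otimes> \<one>) * ((rot_mrg \<otimes> ident [S1, S1]) * (\<one> \<otimes> spl))"
    by (subst tensor_times_ident, (rule typing | simp; fail)+) (simp add: word_assoc)
  also have "(rot_mrg \<otimes> ident [S1, S1]) * (\<one> \<otimes> spl) = (ident [S1, S2] \<otimes> spl) * (rot_mrg \<otimes> ident [S2])"
    by (rule tensor_commute) (rule typing)+
  also have "(\<one> \<otimes> mrg) * (\<one> \<otimes> rot_spl \<otimes> \<one>) * ((ident [S1, S2] \<otimes> spl) * (rot_mrg \<otimes> ident [S2]))
      = (\<one> \<otimes> (mrg * ((rot_spl \<otimes> \<one>) * (ident [S2] \<otimes> spl)))) * (rot_mrg \<otimes> ident [S2])"
    by (subst ident_tensor_times, (rule typing | simp; fail)+,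
        subst ident_tensor_times, (rule typing | simp; fail)+)
      (simp add: mult.assoc flip: tensor_assoc, simp add: tensor_assoc ident_tensor)
  also have "(rot_spl \<otimes> \<one>) * (ident [S2] \<otimes> spl)
      = (\<one> \<otimes> cap \<otimes> \<one>) * ((spl \<otimes> ident [S1, S1]) * (ident [S2] \<otimes> spl))"
    unfolding rot_spl_def
    by (subst tensor_times_ident, (rule typing | simp; fail)+) (simp add: word_assoc)
  also have "(spl \<otimes> ident [S1, S1]) * (ident [S2] \<otimes> spl) = spl \<otimes> spl"
    by (rule cut_left[symmetric]) (rule typing)+
  finally show ?thesis
    using triangle_zero by (simp add: mult.assoc)
qed

section \<open>Webs between type 1 words, indexed by numbers of strands\<close>

definition sid :: "nat \<Rightarrow> skein" where "sid n = id1 n"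
abbreviation place :: "nat \<Rightarrow> skein \<Rightarrow> nat \<Rightarrow> skein" where
  "place l x r \<equiv> sid l \<otimes> x \<otimes> sid r"

definition H :: "nat \<Rightarrow> nat \<Rightarrow> skein set" where "H n m = Hom (replicate n S1) (replicate m S1)"

named_theorems htyping

lemma sid_tensor [simp]: "sid a \<otimes> sid b = sid (a + b)" "sid a \<otimes> sid b \<otimes> x = sid (a + b) \<otimes> x"
proof -
  show "sid a \<otimes> sid b = sid (a + b)"
    by (simp add: sid_def ident_tensor replicate_add)
  then show "sid a \<otimes> sid b \<otimes> x = sid (a + b) \<otimes> x"
    by (simp flip: tensor_assoc)
qed

lemma sid_0 [simp]: "sid 0 \<otimes> x = x" "x \<otimes> sid 0 = x"
  by (simp_all add: sid_def)

lemma one_eq_sid: "\<one> = sid 1" and ident2_eq_sid: "ident [S1, S1] = sid 2"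
  by (simp_all add: sid_def numeral_2_eq_2)

lemma H_sid [htyping, intro, simp]: "sid n \<in> H n n"
  by (simp add: H_def sid_def)

lemma H_gen [htyping, intro, simp]: "cup \<in> H 0 2" "cap \<in> H 2 0" "X \<in> H 2 2" "U \<in> H 2 2"
  using Hom_gen X_typ by (simp_all add: H_def numeral_2_eq_2)

lemma H_times [htyping]: "x \<in> H m l \<Longrightarrow> y \<in> H n m \<Longrightarrow> x * y \<in> H n l"
  by (auto simp: H_def)

lemma H_tensor [htyping]:
  "x \<in> H a b \<Longrightarrow> y \<in> H c d \<Longrightarrow> n = a + c \<Longrightarrow> m = b + d \<Longrightarrow> x \<otimes> y \<in> H n m"
  using Hom_tensor[of x "replicate a S1" "replicate b S1" y "replicate c S1" "replicate d S1"]
  by (simp add: H_def replicate_add)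

lemma H_add [intro]: "x \<in> H n m \<Longrightarrow> y \<in> H n m \<Longrightarrow> x + y \<in> H n m"
  and H_scale [intro]: "x \<in> H n m \<Longrightarrow> c *\<^sub>K x \<in> H n m"
  and H_zero [intro, simp]: "0 \<in> H n m"
  by (auto simp: H_def)

lemma sid_times [simp]: "x \<in> H n m \<Longrightarrow> sid m * x = x"
  and times_sid [simp]: "x \<in> H n m \<Longrightarrow> x * sid n = x"
  by (simp_all add: H_def sid_def ident_times times_ident)

lemma tensor_sid_times: "v \<in> H m l \<Longrightarrow> w \<in> H n m \<Longrightarrow> (v * w) \<otimes> sid r = (v \<otimes> sid r) * (w \<otimes> sid r)"
  unfolding H_def sid_def by (rule tensor_times_ident)

lemma sid_tensor_times: "v \<in> H m l \<Longrightarrow> w \<in> H n m \<Longrightarrow> sid r \<otimes> (v * w) = (sid r \<otimes> v) * (sid r \<otimes> w)"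
  unfolding H_def sid_def by (rule ident_tensor_times)

lemma sid_commute:
  "v \<in> H a b \<Longrightarrow> w \<in> H c d \<Longrightarrow> (v \<otimes> sid d) * (sid a \<otimes> w) = (sid b \<otimes> w) * (v \<otimes> sid c)"
  unfolding H_def sid_def by (rule tensor_commute)

lemma sid_cut: "v \<in> H a b \<Longrightarrow> w \<in> H c d \<Longrightarrow> v \<otimes> w = (v \<otimes> sid d) * (sid a \<otimes> w)"
  unfolding H_def sid_def by (rule cut_left)

lemma tensor_minus [simp]: "(- x) \<otimes> y = - (x \<otimes> y)" "x \<otimes> (- y) = - (x \<otimes> y)"
  using tensor_diff_left[of 0 x y] tensor_diff_right[of x 0 y] by simp_all

abbreviation qb :: K (\<open>\<beta>\<close>) where "\<beta> \<equiv> \<alpha> - \<delta>"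

lemma cup_times_empty: "cup * ident [] = cup" and empty_times_cap: "ident [] * cap = cap"
  by (rule times_ident ident_times, rule typing)+

lemma X_cup: "X * cup = \<delta> *\<^sub>K cup"
  using cap_cup by (simp add: X_eq_I U_def left_diff_distrib mult.assoc cup_times_empty)

lemma cap_X: "cap * X = \<delta> *\<^sub>K cap"
proof -
  have "cap * U = - \<delta> *\<^sub>K cap"
    by (simp add: U_def cap_cup empty_times_cap flip: mult.assoc)
  moreover have "cap * (spl * mrg) = 0"
    by (simp flip: mult.assoc)
  ultimately show ?thesis
    by (simp add: X_eq_I right_diff_distrib)
qed

lemma U_mult: "U * U = - \<delta> *\<^sub>K U" "X * U = \<delta> *\<^sub>K U" "U * X = \<delta> *\<^sub>K U"
proof -
  have "U * U = cup * (cap * cup) * cap" by (simp add: U_def mult.assoc)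
  then show "U * U = - \<delta> *\<^sub>K U"
    by (simp add: cap_cup U_def cup_times_empty)
  show "X * U = \<delta> *\<^sub>K U"
    by (simp add: U_def X_cup flip: mult.assoc)
  show "U * X = \<delta> *\<^sub>K U"
    by (simp add: U_def cap_X mult.assoc)
qed

text \<open>The bigon relation makes \<open>I = X + U\<close> idempotent up to scale,
  \<open>I * I = \<alpha> *\<^sub>K I\<close>; the mixed products come from
  \<open>U_mult\<close>.\<close>

lemma X_square: "X * X = \<alpha> *\<^sub>K X + \<beta> *\<^sub>K U"
proof -
  have "(spl * mrg) * (spl * mrg) = spl * (mrg * spl) * mrg"
    by (simp add: mult.assoc)
  then have I: "(X + U) * (X + U) = \<alpha> *\<^sub>K (X + U)"
    by (simp add: X_eq_I mrg_spl times_ident[OF Hom_gen(6)])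
  have "X * X = (X + U) * (X + U) - X * U - U * X - U * U"
    by (simp add: algebra_simps)
  then show ?thesis
    unfolding I U_mult by (simp add: skein.scale_right_distrib skein.scale_left_diff_distrib)
qed

section \<open>Relations on three strands\<close>

abbreviation "xl \<equiv> X \<otimes> sid 1"
abbreviation "xr \<equiv> sid 1 \<otimes> X"
abbreviation "ul \<equiv> U \<otimes> sid 1"
abbreviation "ur \<equiv> sid 1 \<otimes> U"
abbreviation "cl \<equiv> cup \<otimes> sid 1"
abbreviation "cr \<equiv> sid 1 \<otimes> cup"
abbreviation "dl \<equiv> cap \<otimes> sid 1"
abbreviation "dr \<equiv> sid 1 \<otimes> cap"

lemma H_three [htyping]:
  "xl \<in> H 3 3" "xr \<in> H 3 3" "ul \<in> H 3 3" "ur \<in> H 3 3"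
  "cl \<in> H 1 3" "cr \<in> H 1 3" "dl \<in> H 3 1" "dr \<in> H 3 1"
  by (rule H_tensor, (rule htyping)+, simp, simp)+

lemma u_eq: "ul = cl * dl" "ur = cr * dr"
  unfolding U_def by (rule tensor_sid_times sid_tensor_times, (rule htyping)+)+

lemma snake: "dl * cr = sid 1" "dr * cl = sid 1"
  using zigzag(1,2) by (simp_all add: one_eq_sid)

lemma rotate: "xl * cr = xr * cl" "dr * xl = dl * xr"
  using X_rotate_cup X_rotate_cap by (simp_all add: one_eq_sid)

lemma unit_cups: "cr * sid 1 = cr" "sid 1 * dr = dr"
  by (rule times_sid sid_times, rule htyping)+

lemma xr_cup: "xr * cr = \<delta> *\<^sub>K cr"
  by (subst sid_tensor_times[symmetric], (rule htyping)+) (simp add: X_cup)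

lemma xr_mult: "xr * xr = \<alpha> *\<^sub>K xr + \<beta> *\<^sub>K ur" "xr * ur = \<delta> *\<^sub>K ur" "ur * xr = \<delta> *\<^sub>K ur"
    "ur * ur = - \<delta> *\<^sub>K ur"
  by (subst sid_tensor_times[symmetric], (rule htyping)+,
      simp add: X_square U_mult tensor_add_right)+

lemma cup_three:
  "xr * xl * cr = \<alpha> *\<^sub>K (xl * cr) + \<beta> *\<^sub>K cr" "ur * xl * cr = \<delta> *\<^sub>K cr"
  "xr * ul * cr = xl * cr" "ur * ul * cr = cr"
proof -
  have "xr * xl * cr = (xr * xr) * cl"
    by (simp only: rotate mult.assoc)
  also have "\<dots> = \<alpha> *\<^sub>K (xr * cl) + \<beta> *\<^sub>K (cr * (dr * cl))"
    unfolding xr_mult by (simp only: u_eq distrib_right mult.assoc scale_times)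
  finally show "xr * xl * cr = \<alpha> *\<^sub>K (xl * cr) + \<beta> *\<^sub>K cr"
    unfolding snake unit_cups rotate .
  have "ur * xl * cr = cr * (dl * (xr * cr))"
    by (simp only: u_eq mult.assoc rotate(2)[unfolded mult.assoc, symmetric] flip: mult.assoc)
  also have "\<dots> = \<delta> *\<^sub>K (cr * (dl * cr))"
    unfolding xr_cup by simp
  finally show "ur * xl * cr = \<delta> *\<^sub>K cr"
    unfolding snake unit_cups .
  have "xr * ul * cr = (xr * cl) * (dl * cr)"
    by (simp only: u_eq mult.assoc)
  also have "\<dots> = xl * (cr * sid 1)"
    unfolding rotate[symmetric] snake by (simp only: mult.assoc)
  finally show "xr * ul * cr = xl * cr"
    unfolding unit_cups .
  have "ur * ul * cr = cr * (dr * cl) * (dl * cr)"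
    by (simp only: u_eq mult.assoc)
  then show "ur * ul * cr = cr"
    unfolding snake unit_cups .
qed

lemma trace_three: "dr * xl * cr = \<delta> *\<^sub>K sid 1" "dr * ul * cr = sid 1"
proof -
  have "dr * xl * cr = dl * (xr * cr)" by (simp only: rotate mult.assoc)
  then show "dr * xl * cr = \<delta> *\<^sub>K sid 1"
    unfolding xr_cup scale_times snake .
  have "dr * ul * cr = (dr * cl) * (dl * cr)" by (simp only: u_eq mult.assoc)
  moreover have "sid 1 * sid 1 = sid 1" by (rule sid_times) (rule htyping)
  ultimately show "dr * ul * cr = sid 1"
    unfolding snake by (simp only:)
qed

text \<open>\<open>U\<close> factors through a cup and a cap, which rotate or straighten whatever
  they meet. Together with \<open>X_braid\<close> this covers all eight products of a right, a left
  and a right generator, each rewritten with exactly one right generator; the double coset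
  decomposition below rests on that.\<close>

lemma three_strands:
  "xr * xl * ur = \<alpha> *\<^sub>K (xl * ur) + \<beta> *\<^sub>K ur"
  "ur * xl * xr = \<alpha> *\<^sub>K (ur * xl) + \<beta> *\<^sub>K ur"
  "ur * xl * ur = \<delta> *\<^sub>K ur"
  "xr * ul * xr = xl * ur * xl"
  "xr * ul * ur = xl * ur"
  "ur * ul * xr = ur * xl"
  "ur * ul * ur = ur"
proof -
  have cup: "y * z * ur = (y * z * cr) * dr" for y z
    by (simp only: u_eq mult.assoc)
  show "xr * xl * ur = \<alpha> *\<^sub>K (xl * ur) + \<beta> *\<^sub>K ur"
    unfolding cup cup_three by (simp only: u_eq distrib_right mult.assoc scale_times)
  show "ur * xl * ur = \<delta> *\<^sub>K ur" "ur * ul * ur = ur" "xr * ul * ur = xl * ur"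
    unfolding cup cup_three by (simp_all only: u_eq mult.assoc scale_times)
  have dba: "dr * xl * xr = \<alpha> *\<^sub>K (dr * xl) + \<beta> *\<^sub>K dr"
  proof -
    have "dr * xl * xr = dl * (xr * xr)" unfolding rotate by (simp only: mult.assoc)
    also have "\<dots> = \<alpha> *\<^sub>K (dl * xr) + \<beta> *\<^sub>K ((dl * cr) * dr)"
      unfolding xr_mult by (simp only: u_eq distrib_left mult.assoc scale_times)
    finally show ?thesis
      unfolding snake unit_cups rotate .
  qed
  have "ur * xl * xr = cr * (dr * xl * xr)" by (simp only: u_eq mult.assoc)
  then show "ur * xl * xr = \<alpha> *\<^sub>K (ur * xl) + \<beta> *\<^sub>K ur"
    unfolding dba by (simp only: u_eq distrib_left mult.assoc scale_times)
  have "xr * ul * xr = (xr * cl) * (dl * xr)" by (simp only: u_eq mult.assoc)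
  then show "xr * ul * xr = xl * ur * xl"
    unfolding rotate[symmetric] by (simp only: u_eq mult.assoc)
  have "ur * ul * xr = cr * (dr * cl) * (dl * xr)" by (simp only: u_eq mult.assoc)
  then show "ur * ul * xr = ur * xl"
    unfolding snake unit_cups rotate[symmetric] by (simp only: u_eq mult.assoc)
qed

text \<open>The lower cap of \<open>ul\<close> rotates the crossing next to it onto the left pair.
  In the resulting form \<open>xl\<close> acts first, which is what \<open>U_D_zero\<close>
  uses.\<close>

lemma cap_slide: "ul * xr = ul * ur * xl"
proof -
  have "ul * ur * xl = cl * (dl * cr) * (dr * xl)" by (simp only: u_eq mult.assoc)
  also have "cl * (dl * cr) = cl" unfolding snake by (rule times_sid) (rule htyping)
  finally show ?thesis unfolding rotate by (simp only: u_eq mult.assoc)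
qed

text \<open>The triangle relation, read through \<open>spl * mrg = X + U\<close> and \<open>J = X + V\<close>.\<close>

lemma X_braid:
  "xr * xl * xr = - \<alpha> *\<^sub>K xr - \<alpha> *\<^sub>K (xl * ur + ur * xl) + (\<delta> - 3 * \<alpha>) *\<^sub>K ur"
proof -
  have J: "xl + sid 3 = ((\<one> \<otimes> rot_spl) * (rot_mrg \<otimes> \<one>)) \<otimes> \<one>"
    by (simp add: X_eq_J tensor_diff_left ident2_eq_sid one_eq_sid)
  have I: "xr + ur = (\<one> \<otimes> spl) * (\<one> \<otimes> mrg)"
    by (subst ident_tensor_times[symmetric], (rule typing)+)
      (simp add: X_eq_I tensor_diff_right one_eq_sid)
  have "(xr + ur) * (xl + sid 3) * (xr + ur) = (\<one> \<otimes> spl) *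
      ((\<one> \<otimes> mrg) * (((\<one> \<otimes> rot_spl) * (rot_mrg \<otimes> \<one>)) \<otimes> \<one>) * (\<one> \<otimes> spl)) * (\<one> \<otimes> mrg)"
    unfolding I J by (simp only: mult.assoc)
  then have "(xr + ur) * (xl + sid 3) * (xr + ur) = 0"
    unfolding J_triangle by simp
  moreover have "xr * sid 3 = xr" "ur * sid 3 = ur"
    by (rule times_sid, rule htyping)+
  then have "(xr + ur) * (xl + sid 3) * (xr + ur)
     = xr * xl * xr + xr * xl * ur + ur * xl * xr + ur * xl * ur
       + (xr * xr + xr * ur + ur * xr + ur * ur)"
    by (simp only: distrib_left distrib_right add_ac)
  ultimately have "xr * xl * xr + (\<alpha> *\<^sub>K (xl * ur) + \<beta> *\<^sub>K ur) + (\<alpha> *\<^sub>K (ur * xl) + \<beta> *\<^sub>K ur)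
      + \<delta> *\<^sub>K ur + (\<alpha> *\<^sub>K xr + \<beta> *\<^sub>K ur + \<delta> *\<^sub>K ur + \<delta> *\<^sub>K ur - \<delta> *\<^sub>K ur) = 0"
    unfolding three_strands xr_mult by simp
  moreover have "(\<alpha> * 3) *\<^sub>K ur = \<alpha> *\<^sub>K ur + (\<alpha> *\<^sub>K ur + \<alpha> *\<^sub>K ur)"
    by (simp flip: skein.scale_left_distrib)
  ultimately show ?thesis
    by (simp add: skein.scale_right_distrib add_eq_0_iff algebra_simps)
qed

section \<open>The algebra generated by \<open>X\<close> and \<open>U\<close>\<close>

text \<open>Words grow at their left end, so that inductions treat one topmost generator at a time;
  closure under products is derived in \<open>alg_times\<close>.\<close>

inductive_set alg :: "nat \<Rightarrow> skein set" for n where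
  sid [intro, simp]: "sid n \<in> alg n"
| add [intro]: "a \<in> alg n \<Longrightarrow> b \<in> alg n \<Longrightarrow> a + b \<in> alg n"
| scale [intro]: "a \<in> alg n \<Longrightarrow> c *\<^sub>K a \<in> alg n"
| gen: "a \<in> alg n \<Longrightarrow> y \<in> {X, U} \<Longrightarrow> n = l + 2 + r \<Longrightarrow> (place l y r) * a \<in> alg n"

lemma H_XU [htyping]: "y \<in> {X, U} \<Longrightarrow> y \<in> H 2 2"
  by auto

lemma H_place [htyping]:
  "y \<in> {X, U} \<Longrightarrow> n = l + 2 + r \<Longrightarrow> m = n \<Longrightarrow> place l y r \<in> H n m"
  by (rule H_tensor[where b = l and d = "2 + r"], (rule htyping | simp; fail)+)

lemma alg_H [htyping]: "a \<in> alg n \<Longrightarrow> a \<in> H n n"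
proof (induction rule: alg.induct)
  case (gen a y l r)
  then show ?case by (intro H_times H_place) auto
qed auto

lemma alg_minus [intro]: "a \<in> alg n \<Longrightarrow> - a \<in> alg n"
  using alg.scale[of a n "- 1"] by simp

lemma alg_times [intro]: "a \<in> alg n \<Longrightarrow> b \<in> alg n \<Longrightarrow> a * b \<in> alg n"
proof (induction rule: alg.induct)
  case sid
  then show ?case by (simp add: sid_times[OF alg_H])
next
  case (gen a y l r)
  then show ?case by (simp add: mult.assoc alg.gen)
qed (auto simp: distrib_right)

lemma alg_gen: "y \<in> {X, U} \<Longrightarrow> n = l + 2 + r \<Longrightarrow> place l y r \<in> alg n"
  using alg.gen[OF alg.sid, of y n l r] times_sid[OF H_place[of y n l r n]] by simp

lemma alg_gen_last: "y \<in> {X, U} \<Longrightarrow> n = l + 2 \<Longrightarrow> sid l \<otimes> y \<in> alg n"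
  using alg_gen[of y n l 0] by simp

lemma alg_tensor_sid [intro]: "a \<in> alg n \<Longrightarrow> m = n + k \<Longrightarrow> a \<otimes> sid k \<in> alg m"
proof (induction arbitrary: m rule: alg.induct)
  case (gen a y l r)
  have "(place l y r * a) \<otimes> sid k = place l y (r + k) * (a \<otimes> sid k)"
    by (subst tensor_sid_times[OF H_place alg_H]) (use gen in \<open>auto simp: tensor_assoc\<close>)
  also have "\<dots> \<in> alg m"
    using gen by (intro alg.gen) auto
  finally show ?case .
qed (auto simp: tensor_add_left)

lemma sid_tensor_alg [intro]: "a \<in> alg n \<Longrightarrow> m = k + n \<Longrightarrow> sid k \<otimes> a \<in> alg m"
proof (induction arbitrary: m rule: alg.induct)
  case (gen a y l r)
  have "sid k \<otimes> (place l y r * a) = place (k + l) y r * (sid k \<otimes> a)"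
    by (subst sid_tensor_times[OF H_place alg_H]) (use gen in \<open>auto\<close>)
  also have "\<dots> \<in> alg m"
    using gen by (intro alg.gen) auto
  finally show ?case .
qed (auto simp: tensor_add_right)

text \<open>Double cosets of the algebra on the first \<open>m\<close> strands, inside the algebra
  on \<open>m + 1\<close> strands; the index is the smaller number. The middle generator acts on the
  strands \<open>m\<close> and \<open>m + 1\<close>, hence \<open>m = Suc k\<close>.\<close>

inductive_set dc :: "nat \<Rightarrow> skein set" for m where
  base: "a \<in> alg m \<Longrightarrow> a \<otimes> sid 1 \<in> dc m"
| add [intro]: "x \<in> dc m \<Longrightarrow> y \<in> dc m \<Longrightarrow> x + y \<in> dc m"
| step: "a \<in> alg m \<Longrightarrow> b \<in> alg m \<Longrightarrow> y \<in> {X, U} \<Longrightarrow> m = Suc k \<Longrightarrow>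
    (a \<otimes> sid 1) * (sid k \<otimes> y) * (b \<otimes> sid 1) \<in> dc m"

lemma dc_left: "x \<in> dc m \<Longrightarrow> a \<in> alg m \<Longrightarrow> (a \<otimes> sid 1) * x \<in> dc m"
proof (induction rule: dc.induct)
  case (base b)
  have "(a * b) \<otimes> sid 1 \<in> dc m"
    using base by (intro dc.base alg_times)
  then show ?case
    using base by (subst (asm) tensor_sid_times[OF alg_H alg_H]) auto
next
  case (step b c y k)
  have "((a * b) \<otimes> sid 1) * (sid k \<otimes> y) * (c \<otimes> sid 1) \<in> dc m"
    using step by (intro dc.step alg_times)
  then show ?case
    using step by (subst (asm) tensor_sid_times[OF alg_H alg_H]) (auto simp: mult.assoc)
qed (auto simp: distrib_left)

lemma dc_right: "x \<in> dc m \<Longrightarrow> a \<in> alg m \<Longrightarrow> x * (a \<otimes> sid 1) \<in> dc m"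
proof (induction rule: dc.induct)
  case (base b)
  have "(b * a) \<otimes> sid 1 \<in> dc m"
    using base by (intro dc.base alg_times)
  then show ?case
    using base by (subst (asm) tensor_sid_times[OF alg_H alg_H]) auto
next
  case (step b c y k)
  have "(b \<otimes> sid 1) * (sid k \<otimes> y) * ((c * a) \<otimes> sid 1) \<in> dc m"
    using step by (intro dc.step alg_times)
  then show ?case
    using step by (subst (asm) tensor_sid_times[OF alg_H alg_H]) (auto simp: mult.assoc)
qed (auto simp: distrib_right)

lemma dc_scale [intro]: "x \<in> dc m \<Longrightarrow> c *\<^sub>K x \<in> dc m"
proof (induction rule: dc.induct)
  case (base a)
  then show ?case using dc.base[of "c *\<^sub>K a" m] by auto
next
  case (step a b y k)
  then show ?case using dc.step[of "c *\<^sub>K a" m b y k] by auto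
qed (auto simp: skein.scale_right_distrib)

lemma dc_diff [intro]: "x \<in> dc m \<Longrightarrow> y \<in> dc m \<Longrightarrow> x - y \<in> dc m"
  using dc.add[of x m "- y"] dc_scale[of y m "- 1"] by simp

lemma dc_minus [intro]: "x \<in> dc m \<Longrightarrow> - x \<in> dc m"
  using dc_scale[of x m "- 1"] by simp

lemma dc_gen: assumes "y \<in> {X, U}" "m = Suc k" shows "sid k \<otimes> y \<in> dc m"
proof -
  have "sid k \<otimes> y \<in> H (Suc m) (Suc m)"
    by (rule H_tensor[OF H_sid H_XU]) (use assms in auto)
  then show ?thesis
    using dc.step[OF alg.sid alg.sid assms] by simp
qed

lemma sid_tensor_dc: "x \<in> dc m \<Longrightarrow> n = j + m \<Longrightarrow> sid j \<otimes> x \<in> dc n"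
proof (induction rule: dc.induct)
  case (base a)
  then have "(sid j \<otimes> a) \<otimes> sid 1 \<in> dc n"
    by (intro dc.base) auto
  then show ?case by (simp add: tensor_assoc)
next
  case (step a b y k)
  have ty: "a \<otimes> sid 1 \<in> H (Suc m) (Suc m)" "b \<otimes> sid 1 \<in> H (Suc m) (Suc m)" "sid k \<otimes> y \<in> H (Suc m) (Suc m)"
    using step by (auto intro!: H_tensor[OF alg_H H_sid] H_tensor[OF H_sid H_XU])
  have "sid j \<otimes> ((a \<otimes> sid 1) * (sid k \<otimes> y) * (b \<otimes> sid 1))
      = ((sid j \<otimes> a) \<otimes> sid 1) * (sid (j + k) \<otimes> y) * ((sid j \<otimes> b) \<otimes> sid 1)"
    by (simp add: sid_tensor_times[OF H_times[OF ty(1,3)] ty(2)] sid_tensor_times[OF ty(1,3)]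
        tensor_assoc del: One_nat_def)
  also have "\<dots> \<in> dc n"
    using step by (intro dc.step sid_tensor_alg) auto
  finally show ?case .
qed (auto simp: tensor_add_right)

lemma dc_three:
  assumes "y \<in> {X, U}" "z \<in> {X, U}" "w \<in> {X, U}"
  shows "(sid 1 \<otimes> y) * (z \<otimes> sid 1) * (sid 1 \<otimes> w) \<in> dc 2"
proof -
  have gen: "xr \<in> dc 2" "ur \<in> dc 2"
    using dc_gen[of _ 2 1] by auto
  have a: "X \<in> alg 2" "U \<in> alg 2"
    using alg_gen_last[of _ 2 0] by auto
  have [intro]: "xl * ur \<in> dc 2" "ur * xl \<in> dc 2" "xl * ur * xl \<in> dc 2"
    using gen a by (auto intro!: dc_left dc_right simp del: One_nat_def)
  show ?thesis
    using assms gen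
    by (auto simp del: One_nat_def simp: three_strands X_braid
        intro!: dc.add dc_scale dc_diff dc_minus)
qed

text \<open>Expanding \<open>a\<close> one level down gives two kinds of terms. Either it commutes
  with the last generators, and these multiply on two strands; or it contains one generator on the
  pair before, the remaining algebra elements commute out, and a product on three strands is left
  for \<open>dc_three\<close>.\<close>

lemma dc_mult:
  assumes "alg (Suc k) \<subseteq> dc k" and y: "y \<in> {X, U}" and w: "w \<in> {X, U}" and a: "a \<in> alg (Suc k)"
  shows "(sid k \<otimes> y) * (a \<otimes> sid 1) * (sid k \<otimes> w) \<in> dc (Suc k)"
proof -
  have "a \<in> dc k" using assms by auto
  then show ?thesis
  proof (induction rule: dc.induct)
    case (base a)
    have "(sid k \<otimes> y) * (a \<otimes> sid 2) = (a \<otimes> sid 2) * (sid k \<otimes> y)"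
      using sid_commute[OF alg_H[OF base] H_XU[OF y]] by simp
    then have "(sid k \<otimes> y) * ((a \<otimes> sid 1) \<otimes> sid 1) * (sid k \<otimes> w) = ((a \<otimes> sid 1) \<otimes> sid 1) * ((sid k \<otimes> y) * (sid k \<otimes> w))"
      by (simp add: tensor_assoc numeral_2_eq_2 flip: mult.assoc)
    also have "(sid k \<otimes> y) * (sid k \<otimes> w) = sid k \<otimes> (y * w)"
      by (rule sid_tensor_times[symmetric, OF H_XU[OF y] H_XU[OF w]])
    finally have *: "(sid k \<otimes> y) * ((a \<otimes> sid 1) \<otimes> sid 1) * (sid k \<otimes> w) = ((a \<otimes> sid 1) \<otimes> sid 1) * (sid k \<otimes> (y * w))" .
    have "sid k \<otimes> (y * w) \<in> dc (Suc k)"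
      using y w dc_gen[of X "Suc k" k] dc_gen[of U "Suc k" k]
      by (auto simp: X_square U_mult tensor_add_right
          intro!: dc.add dc_scale dc_minus)
    then show ?case
      unfolding * using base by (intro dc_left alg_tensor_sid) auto
  next
    case (add a b)
    then show ?case
      by (auto simp: tensor_add_left distrib_left distrib_right)
  next
    case (step a b z j)
    have ty: "a \<otimes> sid 1 \<in> H (Suc k) (Suc k)" "b \<otimes> sid 1 \<in> H (Suc k) (Suc k)" "sid j \<otimes> z \<in> H (Suc k) (Suc k)"
      using step by (auto intro!: H_tensor[OF alg_H H_sid] H_tensor[OF H_sid H_XU])
    have "(sid k \<otimes> y) * (a \<otimes> sid 2) = (a \<otimes> sid 2) * (sid k \<otimes> y)"
      using sid_commute[OF alg_H[OF step(1)] H_XU[OF y]] by simp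
    moreover have "(b \<otimes> sid 2) * (sid k \<otimes> w) = (sid k \<otimes> w) * (b \<otimes> sid 2)"
      using sid_commute[OF alg_H[OF step(2)] H_XU[OF w]] by simp
    moreover have "((a \<otimes> sid 1) * (sid j \<otimes> z) * (b \<otimes> sid 1)) \<otimes> sid 1
       = (a \<otimes> sid 2) * place j z 1 * (b \<otimes> sid 2)"
      by (simp add: tensor_sid_times[OF H_times[OF ty(1,3)] ty(2)] tensor_sid_times[OF ty(1,3)]
        tensor_assoc del: One_nat_def)
    ultimately have "(sid k \<otimes> y) * (((a \<otimes> sid 1) * (sid j \<otimes> z) * (b \<otimes> sid 1)) \<otimes> sid 1) * (sid k \<otimes> w)
       = (a \<otimes> sid 2) * ((sid k \<otimes> y) * place j z 1 * (sid k \<otimes> w)) * (b \<otimes> sid 2)"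
      by (metis mult.assoc)
    also have "(sid k \<otimes> y) * place j z 1 * (sid k \<otimes> w)
       = sid j \<otimes> ((sid 1 \<otimes> y) * (z \<otimes> sid 1) * (sid 1 \<otimes> w))"
    proof -
      have ty: "sid 1 \<otimes> y \<in> H 3 3" "z \<otimes> sid 1 \<in> H 3 3" "sid 1 \<otimes> w \<in> H 3 3"
        using y w step(3) by (auto intro!: H_tensor[OF H_sid H_XU] H_tensor[OF H_XU H_sid])
      note ty = ty[unfolded One_nat_def]
      show ?thesis
        using step(4)
        by (simp add: sid_tensor_times[OF H_times[OF ty(1,2)] ty(3)] sid_tensor_times[OF ty(1,2)])
    qed
    finally have *: "(sid k \<otimes> y) * (((a \<otimes> sid 1) * (sid j \<otimes> z) * (b \<otimes> sid 1)) \<otimes> sid 1) * (sid k \<otimes> w)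
       = ((a \<otimes> sid 1) \<otimes> sid 1) * (sid j \<otimes> ((sid 1 \<otimes> y) * (z \<otimes> sid 1) * (sid 1 \<otimes> w))) * ((b \<otimes> sid 1) \<otimes> sid 1)"
      by (simp add: tensor_assoc numeral_2_eq_2)
    have "sid j \<otimes> ((sid 1 \<otimes> y) * (z \<otimes> sid 1) * (sid 1 \<otimes> w)) \<in> dc (Suc k)"
      using step by (intro sid_tensor_dc[OF dc_three]) (use y w in auto)
    then show ?case
      unfolding * using step(1,2) by (intro dc_right dc_left alg_tensor_sid) auto
  qed
qed

text \<open>Generators within the first \<open>m\<close> strands are absorbed by the outer factors
  of a double coset. A generator on the last pair meets at most one other of its kind, and
  \<open>dc_mult\<close> merges the two, using the decomposition one level below.\<close>

lemma alg_subset_dc: "alg (Suc m) \<subseteq> dc m"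
proof (induction m)
  case 0
  have "a \<in> dc 0" if "a \<in> alg (Suc 0)" for a
    using that
  proof (induction rule: alg.induct)
    case sid
    show ?case using dc.base[OF alg.sid, of 0] by simp
  qed auto
  then show ?case by blast
next
  case (Suc k)
  have "x \<in> dc (Suc k)" if "x \<in> alg (Suc (Suc k))" for x
    using that
  proof (induction rule: alg.induct)
    case sid
    show ?case using dc.base[OF alg.sid, of "Suc k"] by simp
  next
    case (gen x y l r)
    show ?case
    proof (cases r)
      case (Suc r')
      then have "place l y r = place l y r' \<otimes> sid 1"
        by (simp add: tensor_assoc)
      then show ?thesis
        using gen Suc by (simp only:) (intro dc_left alg_gen; simp)
    next
      case 0
      then have l: "l = k" using gen by simp
      have "(sid k \<otimes> y) * x \<in> dc (Suc k)"
        using gen(4)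
      proof (induction rule: dc.induct)
        case (base a)
        then show ?case using dc_right[OF dc_gen[OF gen(2)]] by auto
      next
        case (step a b w k')
        then have "(sid k \<otimes> y) * (a \<otimes> sid 1) * (sid k \<otimes> w) \<in> dc (Suc k)"
          by (intro dc_mult Suc gen) auto
        from dc_right[OF this step(2)] step(4) show ?case
          by (simp add: mult.assoc)
      qed (auto simp: distrib_left)
      then show ?thesis using l 0 by simp
    qed
  qed auto
  then show ?case by blast
qed

section \<open>Cups and caps at the right end\<close>

abbreviation "cu m \<equiv> sid m \<otimes> cup"
abbreviation "ca m \<equiv> sid m \<otimes> cap"

lemma H_cu [htyping]: "n = m + 2 \<Longrightarrow> cu m \<in> H m n" "n = m + 2 \<Longrightarrow> ca m \<in> H n m"
  by (rule H_tensor, (rule htyping)+, simp, simp)+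

lemma XU_cup: assumes "y \<in> {X, U}" shows "\<exists>c. y * cup = c *\<^sub>K cup"
proof -
  have "U * cup = - \<delta> *\<^sub>K cup"
    by (simp add: U_def cap_cup mult.assoc cup_times_empty)
  then show ?thesis
    using assms X_cup by blast
qed

text \<open>Above a cup on the two right strands, a right generator is traded for one on the left
  pair or for a scalar.\<close>

lemma cup_three_alg:
  assumes "y \<in> {X, U}" "z \<in> {X, U}"
  shows "\<exists>w \<in> alg 2. (sid 1 \<otimes> y) * (z \<otimes> sid 1) * cr = (w \<otimes> sid 1) * cr"
proof -
  have a: "X \<in> alg 2" "U \<in> alg 2"
    using alg_gen_last[of _ 2 0] by auto
  have c: "(sid 2 \<otimes> sid 1) * cr = cr"
    unfolding sid_tensor by (rule sid_times) (use H_three in simp)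
  have "xr * xl * cr = ((\<alpha> *\<^sub>K X + \<beta> *\<^sub>K sid 2) \<otimes> sid 1) * cr"
    unfolding cup_three tensor_add_left distrib_right tensor_scale scale_times c ..
  moreover have "ur * xl * cr = ((\<delta> *\<^sub>K sid 2) \<otimes> sid 1) * cr"
    unfolding cup_three tensor_scale scale_times c ..
  moreover have "ur * ul * cr = (sid 2 \<otimes> sid 1) * cr"
    unfolding cup_three c ..
  moreover have "\<alpha> *\<^sub>K X + \<beta> *\<^sub>K sid 2 \<in> alg 2" "\<delta> *\<^sub>K sid 2 \<in> alg 2" "sid 2 \<in> alg 2"
    using a by (auto intro!: alg.add alg.scale)
  ultimately show ?thesis
    using assms a cup_three(3) by blast
qed

lemma dc_step_cups:
  assumes a: "a \<in> alg m" and b: "b \<in> alg m" and z: "z \<in> {X, U}" and m: "m = Suc k"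
  shows "(((a \<otimes> sid 1) * (sid k \<otimes> z) * (b \<otimes> sid 1)) \<otimes> sid 1)
      = (a \<otimes> sid 2) * place k z 1 * (b \<otimes> sid 2)"
    and "(b \<otimes> sid 2) * cu m = cu m * b" and "ca m * (a \<otimes> sid 2) = a * ca m"
proof -
  have ty: "a \<otimes> sid 1 \<in> H (Suc m) (Suc m)" "b \<otimes> sid 1 \<in> H (Suc m) (Suc m)" "sid k \<otimes> z \<in> H (Suc m) (Suc m)"
    using assms by (auto intro!: H_tensor[OF alg_H H_sid] H_tensor[OF H_sid H_XU])
  show "(((a \<otimes> sid 1) * (sid k \<otimes> z) * (b \<otimes> sid 1)) \<otimes> sid 1)
      = (a \<otimes> sid 2) * place k z 1 * (b \<otimes> sid 2)"
    by (simp add: tensor_sid_times[OF H_times[OF ty(1,3)] ty(2)] tensor_sid_times[OF ty(1,3)]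
        tensor_assoc del: One_nat_def)
  show "(b \<otimes> sid 2) * cu m = cu m * b"
    using sid_commute[OF alg_H[OF b] H_gen(1)] by simp
  show "ca m * (a \<otimes> sid 2) = a * ca m"
    using sid_commute[OF alg_H[OF a] H_gen(2)] by simp
qed

lemma three_place:
  assumes y: "y \<in> {X, U}" and z: "z \<in> {X, U}" and m: "m = Suc k"
  shows "(sid m \<otimes> y) * place k z 1 * cu m = sid k \<otimes> ((sid 1 \<otimes> y) * (z \<otimes> sid 1) * cr)"
    and "ca m * place k z 1 * cu m = sid k \<otimes> (dr * (z \<otimes> sid 1) * cr)"
proof -
  have ty: "sid 1 \<otimes> y \<in> H 3 3" "z \<otimes> sid 1 \<in> H 3 3" "cr \<in> H 1 3" "dr \<in> H 3 1"
    using y z H_three by blast+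
  note ty = ty[unfolded One_nat_def]
  show "(sid m \<otimes> y) * place k z 1 * cu m = sid k \<otimes> ((sid 1 \<otimes> y) * (z \<otimes> sid 1) * cr)"
    using m by (simp add: sid_tensor_times[OF H_times[OF ty(1,2)] ty(3)] sid_tensor_times[OF ty(1,2)])
  show "ca m * place k z 1 * cu m = sid k \<otimes> (dr * (z \<otimes> sid 1) * cr)"
    using m by (simp add: sid_tensor_times[OF H_times[OF ty(4,2)] ty(3)] sid_tensor_times[OF ty(4,2)])
qed

text \<open>The right leg of the cup can be freed of generators. Only a new generator on the last
  pair has to be treated: after expansion of \<open>b\<close> in \<open>dc m\<close> it either
  slides down to the cup and acts by a scalar, or meets one generator \<open>z\<close> and is
  absorbed by the formula on three strands.\<close>

lemma alg_cup:
  assumes "a \<in> alg (Suc (Suc m))"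
  shows "\<exists>b \<in> alg (Suc m). a * cu m = (b \<otimes> sid 1) * cu m"
  using assms
proof (induction rule: alg.induct)
  case sid
  have "sid (Suc (Suc m)) = sid (Suc m) \<otimes> sid 1" by simp
  then show ?case by (intro bexI[of _ "sid (Suc m)"]) auto
next
  case (add a b)
  then obtain a' b' where "a' \<in> alg (Suc m)" "b' \<in> alg (Suc m)"
    "a * cu m = (a' \<otimes> sid 1) * cu m" "b * cu m = (b' \<otimes> sid 1) * cu m" by blast
  then show ?case
    by (intro bexI[of _ "a' + b'"]) (auto simp: distrib_right tensor_add_left)
next
  case (scale a c)
  then obtain a' where "a' \<in> alg (Suc m)" "a * cu m = (a' \<otimes> sid 1) * cu m" by blast
  then show ?case
    by (intro bexI[of _ "c *\<^sub>K a'"]) auto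
next
  case (gen a y l r)
  then obtain b where b: "b \<in> alg (Suc m)" "a * cu m = (b \<otimes> sid 1) * cu m" by blast
  show ?case
  proof (cases r)
    case (Suc r')
    have "place l y r * a * cu m = ((place l y r' * b) \<otimes> sid 1) * cu m"
      using gen Suc b
      by (simp add: mult.assoc tensor_assoc tensor_sid_times[OF H_place[of y "Suc m"] alg_H[OF b(1)]])
    then show ?thesis
      using gen Suc b by (intro bexI) (assumption, intro alg.gen, auto)
  next
    case 0
    then have l: "l = m" using gen by simp
    have "b \<in> dc m" using b alg_subset_dc by blast
    then have "\<exists>b' \<in> alg (Suc m). (sid m \<otimes> y) * (b \<otimes> sid 1) * cu m = (b' \<otimes> sid 1) * cu m"
    proof (induction rule: dc.induct)
      case (base a)
      obtain c where c: "y * cup = c *\<^sub>K cup" using XU_cup gen by blast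
      have "(sid m \<otimes> y) * (a \<otimes> sid 2) = (a \<otimes> sid 2) * (sid m \<otimes> y)"
        using sid_commute[OF alg_H[OF base] H_XU[OF gen(2)]] by simp
      then have "(sid m \<otimes> y) * ((a \<otimes> sid 1) \<otimes> sid 1) * cu m = ((a \<otimes> sid 1) \<otimes> sid 1) * ((sid m \<otimes> y) * cu m)"
        by (simp add: tensor_assoc numeral_2_eq_2 flip: mult.assoc)
      also have "(sid m \<otimes> y) * cu m = c *\<^sub>K cu m"
        by (subst sid_tensor_times[symmetric, OF H_XU[OF gen(2)] H_gen(1)]) (simp add: c)
      finally show ?case
        using base by (intro bexI[of _ "(c *\<^sub>K a) \<otimes> sid 1"]) (auto intro!: alg.scale)
    next
      case (add a b)
      then obtain a' b' where "a' \<in> alg (Suc m)" "b' \<in> alg (Suc m)"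
        "(sid m \<otimes> y) * (a \<otimes> sid 1) * cu m = (a' \<otimes> sid 1) * cu m"
        "(sid m \<otimes> y) * (b \<otimes> sid 1) * cu m = (b' \<otimes> sid 1) * cu m" by blast
      then show ?case
        by (intro bexI[of _ "a' + b'"]) (auto simp: distrib_right distrib_left tensor_add_left)
    next
      case (step a b z k)
      note cups = dc_step_cups[OF step]
      obtain w where w: "w \<in> alg 2" "(sid 1 \<otimes> y) * (z \<otimes> sid 1) * cr = (w \<otimes> sid 1) * cr"
        using cup_three_alg gen step by blast
      have comm: "(sid m \<otimes> y) * (a \<otimes> sid 2) = (a \<otimes> sid 2) * (sid m \<otimes> y)"
        using sid_commute[OF alg_H[OF step(1)] H_XU[OF gen(2)]] by simp
      have "sid k \<otimes> ((w \<otimes> sid 1) * cr) = ((sid k \<otimes> w) \<otimes> sid 1) * cu m"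
      proof -
        have "w \<otimes> sid 1 \<in> H 3 3" by (rule H_tensor[OF alg_H[OF w(1)] H_sid]) auto
        then show ?thesis
          using step by (subst sid_tensor_times[OF _ H_three(6)]) (auto simp: tensor_assoc)
      qed
      then have place: "(sid m \<otimes> y) * place k z 1 * cu m = ((sid k \<otimes> w) \<otimes> sid 1) * cu m"
        using three_place(1)[OF gen(2) step(3,4)] w(2) by simp
      have "(sid m \<otimes> y) * (((a \<otimes> sid 1) * (sid k \<otimes> z) * (b \<otimes> sid 1)) \<otimes> sid 1) * cu m
          = (sid m \<otimes> y) * (a \<otimes> sid 2) * place k z 1 * ((b \<otimes> sid 2) * cu m)"
        unfolding cups(1) by (simp only: mult.assoc)
      also have "\<dots> = (a \<otimes> sid 2) * ((sid m \<otimes> y) * place k z 1 * cu m) * b"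
        unfolding comm cups(2) by (simp only: mult.assoc)
      also have "\<dots> = (a \<otimes> sid 2) * ((sid k \<otimes> w) \<otimes> sid 1) * (cu m * b)"
        unfolding place by (simp only: mult.assoc)
      also have "\<dots> = ((a \<otimes> sid 1) \<otimes> sid 1) * ((sid k \<otimes> w) \<otimes> sid 1) * ((b \<otimes> sid 1) \<otimes> sid 1) * cu m"
        unfolding cups(2)[symmetric] by (simp add: tensor_assoc numeral_2_eq_2 mult.assoc)
      finally have eq: "(sid m \<otimes> y) * (((a \<otimes> sid 1) * (sid k \<otimes> z) * (b \<otimes> sid 1)) \<otimes> sid 1) * cu m
          = ((a \<otimes> sid 1) \<otimes> sid 1) * ((sid k \<otimes> w) \<otimes> sid 1) * ((b \<otimes> sid 1) \<otimes> sid 1) * cu m" .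
      have al: "a \<otimes> sid 1 \<in> alg (Suc m)" "sid k \<otimes> w \<in> alg (Suc m)" "b \<otimes> sid 1 \<in> alg (Suc m)"
        using step w by auto
      have "((a \<otimes> sid 1) \<otimes> sid 1) * ((sid k \<otimes> w) \<otimes> sid 1) * ((b \<otimes> sid 1) \<otimes> sid 1)
         = ((a \<otimes> sid 1) * (sid k \<otimes> w) * (b \<otimes> sid 1)) \<otimes> sid 1"
        by (simp only: tensor_sid_times[OF alg_H[OF al(1)] alg_H[OF al(2)]]
            tensor_sid_times[OF alg_H[OF alg_times[OF al(1,2)]] alg_H[OF al(3)]])
      then show ?case
        unfolding eq using al by (intro bexI[of _ "(a \<otimes> sid 1) * (sid k \<otimes> w) * (b \<otimes> sid 1)"]) auto
    qed
    then show ?thesis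
      using l 0 b by (simp add: mult.assoc)
  qed
qed

text \<open>Once the right leg of the cup is free, cap and cup close up the last strand of an
  element on \<open>m + 1\<close> strands: a partial trace. On double cosets it takes the loop value
  \<open>- \<delta>\<close> and, by \<open>trace_three\<close>, the values \<open>\<delta>\<close>
  for \<open>X\<close> and 1 for \<open>U\<close>.\<close>

lemma alg_trace:
  assumes "a \<in> alg (Suc (Suc m))"
  shows "ca m * a * cu m \<in> alg m"
proof -
  obtain b where b: "b \<in> alg (Suc m)" "a * cu m = (b \<otimes> sid 1) * cu m"
    using alg_cup[OF assms] by blast
  have "b \<in> dc m" using b alg_subset_dc by blast
  then have "ca m * (b \<otimes> sid 1) * cu m \<in> alg m"
  proof (induction rule: dc.induct)
    case (base a)
    have "ca m * (a \<otimes> sid 2) = a * ca m"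
      using sid_commute[OF alg_H[OF base] H_gen(2)] by simp
    then have "ca m * ((a \<otimes> sid 1) \<otimes> sid 1) * cu m = a * (ca m * cu m)"
      by (simp add: tensor_assoc numeral_2_eq_2 mult.assoc)
    also have "ca m * cu m = - \<delta> *\<^sub>K sid m"
      by (subst sid_tensor_times[symmetric, OF H_gen(2,1)]) (simp add: cap_cup)
    finally show ?case
      using base by (simp add: times_sid[OF alg_H] alg_minus alg.scale)
  next
    case (add a b)
    then show ?case
      by (auto simp: distrib_right distrib_left tensor_add_left)
  next
    case (step a b z k)
    note cups = dc_step_cups[OF step]
    have "dr * (z \<otimes> sid 1) * cr = \<delta> *\<^sub>K sid 1 \<or> dr * (z \<otimes> sid 1) * cr = sid 1"
      using step(3) trace_three by blast
    then have "sid k \<otimes> (dr * (z \<otimes> sid 1) * cr) = \<delta> *\<^sub>K sid m \<or> sid k \<otimes> (dr * (z \<otimes> sid 1) * cr) = sid m"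
      using step(4) by auto
    then obtain c where c: "ca m * place k z 1 * cu m = c *\<^sub>K sid m"
      unfolding three_place(2)[OF step(3) step(3,4)] by (metis skein.scale_one)
    have "ca m * (((a \<otimes> sid 1) * (sid k \<otimes> z) * (b \<otimes> sid 1)) \<otimes> sid 1) * cu m
        = ca m * (a \<otimes> sid 2) * place k z 1 * ((b \<otimes> sid 2) * cu m)"
      unfolding cups(1) by (simp only: mult.assoc)
    also have "\<dots> = a * (ca m * place k z 1 * cu m) * b"
      unfolding cups by (simp only: mult.assoc)
    also have "\<dots> = c *\<^sub>K (a * b)"
      unfolding c using step(1) by (simp add: times_sid[OF alg_H])
    finally show ?case
      using step by (auto intro!: alg.scale)
  qed
  then show ?thesis by (simp add: b(2) mult.assoc)
qed

section \<open>Quantum integers\<close>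

lemma qhalf_power: "qhalf ^ n = Fract (monom 1 n) 1"
  by (induction n) (simp_all add: qhalf_def One_fract_def monom_Suc)

lemma qhalf_nonzero [simp]: "qhalf \<noteq> 0"
  by (simp add: qhalf_def Zero_fract_def eq_fract)

text \<open>Degrees of monomials show that the generator of the field is not a root of unity; this
  makes all quantum integers except that of 0 invertible.\<close>

lemma qhalf_power_eq_1: "qhalf ^ n = 1 \<longleftrightarrow> n = 0"
proof
  assume "qhalf ^ n = 1"
  then have "(monom 1 n :: complex poly) = 1"
    by (simp add: qhalf_power One_fract_def eq_fract)
  then have "degree (monom 1 n :: complex poly) = 0"
    by simp
  then show "n = 0"
    by (simp add: degree_monom_eq)
qed simp

lemma qhalf_powi_eq_1: "qhalf powi k = 1 \<longleftrightarrow> k = 0"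
proof
  assume *: "qhalf powi k = 1"
  have "qhalf ^ nat \<bar>k\<bar> = 1"
  proof (cases "k \<ge> 0")
    case False
    with * show ?thesis by (simp add: power_int_def power_inverse)
  qed (use * in \<open>simp add: power_int_def\<close>)
  then show "k = 0"
    by (simp add: qhalf_power_eq_1)
qed simp

lemma qhalf_diff_nonzero: "qhalf - inverse qhalf \<noteq> 0"
proof
  assume "qhalf - inverse qhalf = 0"
  then have "qhalf ^ 2 = 1"
    by (simp add: field_simps power2_eq_square)
  then show False by (simp add: qhalf_power_eq_1)
qed

lemma qnum_nonzero: "n \<noteq> 0 \<Longrightarrow> [n]\<^sub>q \<noteq> 0"
proof
  assume "n \<noteq> 0" "[n]\<^sub>q = 0"
  then have "qhalf powi n = qhalf powi (- n)"
    using qhalf_diff_nonzero by (simp add: qnum_def)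
  then have "qhalf powi n * qhalf powi n = 1"
    by (metis power_int_minus power_int_not_zero qhalf_nonzero right_inverse)
  then have "qhalf powi (n + n) = 1"
    by (subst power_int_add) auto
  then show False using \<open>n \<noteq> 0\<close> by (simp add: qhalf_powi_eq_1)
qed

lemma qa_nonzero [simp]: "\<alpha> \<noteq> 0" and qd_nonzero [simp]: "\<delta> \<noteq> 0"
  by (simp_all add: qa_def qd_def qnum_nonzero)

section \<open>A normal form for webs between type 1 words\<close>

text \<open>Combinations of layered webs, each layer being a generator or a cup or cap at the right
  end. Juxtaposition is left out of the rules, which keeps the induction for the normal form short;
  it is recovered in \<open>lay_tensor\<close>.\<close>

inductive lay :: "nat \<Rightarrow> nat \<Rightarrow> skein \<Rightarrow> bool" for n where
  sid: "lay n n (sid n)"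
| add: "lay n m g \<Longrightarrow> lay n m h \<Longrightarrow> lay n m (g + h)"
| scale: "lay n m g \<Longrightarrow> lay n m (c *\<^sub>K g)"
| gen: "lay n m g \<Longrightarrow> y \<in> {X, U} \<Longrightarrow> m = l + 2 + r \<Longrightarrow> lay n m (place l y r * g)"
| cup: "lay n m g \<Longrightarrow> m' = m + 2 \<Longrightarrow> lay n m' (cu m * g)"
| cap: "lay n m' g \<Longrightarrow> m' = m + 2 \<Longrightarrow> lay n m (ca m * g)"

lemma lay_H: "lay n m g \<Longrightarrow> g \<in> H n m"
proof (induction rule: lay.induct)
  case (gen m g y l r)
  then show ?case by (intro H_times[OF H_place]) auto
next
  case (cup m g m')
  then show ?case by (intro H_times[OF H_cu(1)]) auto
next
  case (cap m' g m)
  then show ?case by (intro H_times[OF H_cu(2)]) auto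
qed auto

fun caps :: "nat \<Rightarrow> nat \<Rightarrow> skein" where
  "caps m 0 = sid m"
| "caps m (Suc k) = ca m * caps (m + 2) k"

fun cups :: "nat \<Rightarrow> nat \<Rightarrow> skein" where
  "cups n 0 = sid n"
| "cups n (Suc k) = cu (n + 2 * k) * cups n k"

lemma caps_slide:
  assumes "y \<in> {X, U}" "m = l + 2 + r"
  shows "place l y r * caps m k = caps m k * place l y (r + 2 * k)"
  using assms(2)
proof (induction k arbitrary: m r)
  case 0
  then show ?case using H_place[OF assms(1), of m l r m] by simp
next
  case (Suc k)
  have "place l y r * ca m = ca m * place l y (r + 2)"
    using sid_commute[OF H_place[OF assms(1) Suc.prems HOL.refl] H_gen(2)] by (simp add: tensor_assoc)
  moreover have "place l y (r + 2) * caps (m + 2) k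
      = caps (m + 2) k * place l y (r + 2 + 2 * k)"
    by (rule Suc.IH) (use Suc.prems in simp)
  ultimately have "place l y r * caps m (Suc k)
      = caps m (Suc k) * place l y (r + 2 + 2 * k)"
    by (metis caps.simps(2) mult.assoc)
  then show ?case by (simp add: add.assoc)
qed

text \<open>Cups and caps do not occur together: there are only cups, at the bottom, if
  \<open>m\<close> is larger, and only caps, at the top, if \<open>n\<close> is larger. For
  \<open>n = m\<close> an element of the algebra remains.\<close>

definition nf :: "nat \<Rightarrow> nat \<Rightarrow> skein \<Rightarrow> bool" where
  "nf n m g \<longleftrightarrow> (\<exists>k a. m = n + 2 * k \<and> a \<in> alg m \<and> g = a * cups n k)
    \<or> (\<exists>k a. n = m + 2 * k \<and> a \<in> alg n \<and> g = caps m k * a)"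

lemma nf_cups: "m = n + 2 * k \<Longrightarrow> a \<in> alg m \<Longrightarrow> nf n m (a * cups n k)"
  and nf_caps: "n = m + 2 * k \<Longrightarrow> a \<in> alg n \<Longrightarrow> nf n m (caps m k * a)"
  unfolding nf_def by blast+

text \<open>The overlap \<open>k = 0\<close> of the two alternatives is assigned to the cups, so
  that the numbers \<open>n\<close> and \<open>m\<close> decide the case.\<close>

lemma nf_cases [consumes 1, case_names cups caps]:
  assumes "nf n m g"
  obtains k a where "m = n + 2 * k" "a \<in> alg m" "g = a * cups n k"
  | k a where "n = m + 2 * Suc k" "a \<in> alg n" "g = caps m (Suc k) * a"
proof -
  from assms consider (a) k a where "m = n + 2 * k" "a \<in> alg m" "g = a * cups n k"
    | (b) k a where "n = m + 2 * k" "a \<in> alg n" "g = caps m k * a"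
    unfolding nf_def by blast
  then show thesis
  proof cases
    case b
    show thesis
    proof (cases k)
      case 0
      with b show thesis
        using that(1)[of 0 a] alg_H[OF b(2)] by simp
    qed (use b that(2) in blast)
  qed (use that(1) in blast)
qed

lemma lay_nf: "lay n m g \<Longrightarrow> nf n m g"
proof (induction rule: lay.induct)
  case sid
  show ?case using nf_cups[of n n 0 "sid n"] by (simp add: sid_times[OF H_sid])
next
  case (add m g h)
  from add.IH(1) show ?case
  proof (cases rule: nf_cases)
    case (cups k a)
    from add.IH(2) show ?thesis
    proof (cases rule: nf_cases)
      case (cups k' b)
      with \<open>m = n + 2 * k\<close> have "k' = k" by simp
      with cups \<open>g = a * cups n k\<close> show ?thesis
        using nf_cups[OF \<open>m = n + 2 * k\<close>, of "a + b"] \<open>a \<in> alg m\<close> by (auto simp: distrib_right)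
    qed (use cups in simp)
  next
    case (caps k a)
    from add.IH(2) show ?thesis
    proof (cases rule: nf_cases)
      case (caps k' b)
      with \<open>n = m + 2 * Suc k\<close> have "k' = k" by simp
      with caps \<open>g = caps m (Suc k) * a\<close> show ?thesis
        using nf_caps[OF \<open>n = m + 2 * Suc k\<close>, of "a + b"] \<open>a \<in> alg n\<close>
        by (auto simp: distrib_left)
    qed (use caps in simp)
  qed
next
  case (scale m g c)
  from scale.IH show ?case
  proof (cases rule: nf_cases)
    case (cups k a)
    then show ?thesis using nf_cups[OF cups(1) alg.scale[OF cups(2)], of c] by simp
  next
    case (caps k a)
    then show ?thesis using nf_caps[OF caps(1) alg.scale[OF caps(2)], of c] by simp
  qed
next
  case (gen m g y l r)
  from gen.IH show ?case
  proof (cases rule: nf_cases)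
    case (cups k a)
    then show ?thesis
      using nf_cups[OF cups(1) alg.gen[OF cups(2) gen(2,3)]] by (simp add: mult.assoc)
  next
    case (caps k a)
    have "nf n m (caps m (Suc k) * (place l y (r + 2 * Suc k) * a))"
      using caps gen by (intro nf_caps alg.gen) auto
    then show ?thesis
      using caps_slide[OF gen(2,3), of "Suc k"] caps(3) by (metis mult.assoc)
  qed
next
  case (cup m g m')
  from cup.IH show ?case
  proof (cases rule: nf_cases)
    case (cups k a)
    have "cu m * a = (a \<otimes> sid 2) * cu m"
      using sid_commute[OF alg_H[OF cups(2)] H_gen(1)] by simp
    then have "cu m * g = (a \<otimes> sid 2) * cups n (Suc k)"
      using cups by (simp add: mult.assoc[symmetric])
    then show ?thesis
      using cups cup by (simp only:) (intro nf_cups alg_tensor_sid; simp)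
  next
    case (caps k a)
    \<comment> \<open>A new cup on top of the last cap is the generator \<open>U\<close>, which then
      slides below the remaining caps.\<close>
    have "cu m * ca m = place m U 0"
      unfolding U_def sid_0 by (rule sid_tensor_times[symmetric, OF H_gen(1,2)])
    then have "cu m * g = (place m U 0 * caps (m + 2) k) * a"
      using caps by (simp add: mult.assoc[symmetric])
    also have "\<dots> = caps (m + 2) k * (place m U (0 + 2 * k) * a)"
      by (subst caps_slide) (auto simp: mult.assoc)
    finally show ?thesis
      using caps cup by (simp only:) (intro nf_caps alg.gen; simp)
  qed
next
  case (cap m' g m)
  from cap.IH show ?case
  proof (cases rule: nf_cases)
    case (cups k a)
    show ?thesis
    proof (cases k)
      case 0
      then have "ca m * g = caps m 1 * a"
        using cups cap alg_H[OF cups(2)] H_cu(2)[of n m] by simp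
      then show ?thesis
        using cups cap 0 by (simp only:) (intro nf_caps; simp)
    next
      case (Suc k')
      then have m: "m = n + 2 * k'" using cups cap by simp
      \<comment> \<open>The new cap faces the topmost cup across the algebra element, and
        \<open>alg_trace\<close> removes both.\<close>
      have "ca m * g = (ca m * a * cu m) * cups n k'"
        using cups Suc m by (simp add: mult.assoc)
      moreover have "ca m * a * cu m \<in> alg m"
        using cups cap by (intro alg_trace) simp
      ultimately show ?thesis
        using m by (simp only:) (intro nf_cups; simp)
    qed
  next
    case (caps k a)
    then have "ca m * g = caps m (Suc (Suc k)) * a"
      using cap by (simp add: mult.assoc)
    then show ?thesis
      using caps cap by (simp only:) (intro nf_caps; simp)
  qed
qed

lemma lay_comp: "lay m l g \<Longrightarrow> lay n m h \<Longrightarrow> lay n l (g * h)"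
proof (induction rule: lay.induct)
  case sid
  then show ?case by (simp add: sid_times[OF lay_H])
qed (auto simp: distrib_right mult.assoc intro: lay.intros)

lemma lay_gen: "y \<in> {X, U} \<Longrightarrow> n = l + 2 + r \<Longrightarrow> lay n n (place l y r)"
  using lay.gen[OF lay.sid, of y n l r] times_sid[OF H_place[of y n l r n]] by simp

lemma lay_cu: "lay n (n + 2) (cu n)" and lay_ca: "lay (n + 2) n (ca n)"
  using lay.cup[OF lay.sid HOL.refl, of n] lay.cap[OF lay.sid HOL.refl, of n]
    times_sid[OF H_cu(1)[OF HOL.refl, of n]] times_sid[OF H_cu(2)[OF HOL.refl, of n]] by simp_all

lemma lay_left: "lay n m g \<Longrightarrow> lay (k + n) (k + m) (sid k \<otimes> g)"
proof (induction rule: lay.induct)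
  case (gen m g y l r)
  have "sid k \<otimes> (place l y r * g) = place (k + l) y r * (sid k \<otimes> g)"
    by (subst sid_tensor_times[OF H_place lay_H]) (use gen in auto)
  then show ?case
    using gen by (auto intro: lay.gen)
next
  case (cup m g m')
  have "sid k \<otimes> (cu m * g) = cu (k + m) * (sid k \<otimes> g)"
    by (subst sid_tensor_times[OF H_cu(1) lay_H]) (use cup in auto)
  then show ?case
    using cup by (auto intro: lay.cup)
next
  case (cap m' g m)
  have "sid k \<otimes> (ca m * g) = ca (k + m) * (sid k \<otimes> g)"
    by (subst sid_tensor_times[OF H_cu(2) lay_H]) (use cap in auto)
  then show ?case
    using cap by (auto intro: lay.cap)
qed (auto simp: tensor_add_right intro: lay.intros)

lemma cup_shift: "cl = ul * cr" and cap_shift: "dl = dr * ul"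
proof -
  have "ul * cr = cl * (dl * cr)" by (simp only: u_eq mult.assoc)
  also have "\<dots> = cl" unfolding snake by (rule times_sid) (rule htyping)
  finally show "cl = ul * cr" ..
  have "dr * ul = (dr * cl) * dl" by (simp only: u_eq mult.assoc)
  also have "\<dots> = dl" unfolding snake by (rule sid_times) (rule htyping)
  finally show "dl = dr * ul" ..
qed

text \<open>The new strand displaces cups and caps from the right end; \<open>cup_shift\<close> and
  \<open>cap_shift\<close> put them back at the cost of a \<open>U\<close>.\<close>

lemma lay_right1: "lay n m g \<Longrightarrow> lay (Suc n) (Suc m) (g \<otimes> sid 1)"
proof (induction rule: lay.induct)
  case sid
  show ?case using lay.sid[of "Suc n"] by simp
next
  case (gen m g y l r)
  have "(place l y r * g) \<otimes> sid 1 = place l y (r + 1) * (g \<otimes> sid 1)"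
    by (subst tensor_sid_times[OF H_place lay_H]) (use gen in \<open>auto simp: tensor_assoc\<close>)
  then show ?case
    using gen by (auto intro: lay.gen)
next
  case (cup m g m')
  have "(cu m * g) \<otimes> sid 1 = (sid m \<otimes> cl) * (g \<otimes> sid 1)"
    by (subst tensor_sid_times[OF H_cu(1) lay_H]) (use cup in \<open>auto simp: tensor_assoc\<close>)
  also have "sid m \<otimes> cl = place m U 1 * (sid m \<otimes> cr)"
    unfolding cup_shift by (rule sid_tensor_times) (rule htyping)+
  also have "sid m \<otimes> cr = cu (Suc m)" by simp
  finally have "(cu m * g) \<otimes> sid 1 = place m U 1 * (cu (Suc m) * (g \<otimes> sid 1))"
    by (simp add: mult.assoc)
  moreover have "lay (Suc n) (Suc m') \<dots>"
    by (rule lay.gen[OF lay.cup[OF cup.IH]]) (use cup in auto)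
  ultimately show ?case by simp
next
  case (cap m' g m)
  have "(ca m * g) \<otimes> sid 1 = (sid m \<otimes> dl) * (g \<otimes> sid 1)"
    by (subst tensor_sid_times[OF H_cu(2) lay_H]) (use cap in \<open>auto simp: tensor_assoc\<close>)
  also have "sid m \<otimes> dl = (sid m \<otimes> dr) * place m U 1"
    unfolding cap_shift by (rule sid_tensor_times) (rule htyping)+
  also have "sid m \<otimes> dr = ca (Suc m)" by simp
  finally have "(ca m * g) \<otimes> sid 1 = ca (Suc m) * (place m U 1 * (g \<otimes> sid 1))"
    by (simp add: mult.assoc)
  moreover have "lay (Suc n) (Suc m) \<dots>"
    by (rule lay.cap[OF lay.gen[OF cap.IH]]) (use cap in auto)
  ultimately show ?case by simp
qed (auto simp: tensor_add_left intro: lay.intros)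

lemma lay_right: "lay n m g \<Longrightarrow> lay (n + k) (m + k) (g \<otimes> sid k)"
proof (induction k)
  case (Suc k)
  then have "lay (Suc (n + k)) (Suc (m + k)) ((g \<otimes> sid k) \<otimes> sid 1)"
    by (intro lay_right1) simp
  then show ?case by (simp add: tensor_assoc)
qed simp

lemma lay_tensor: "lay n m g \<Longrightarrow> lay n' m' g' \<Longrightarrow> lay (n + n') (m + m') (g \<otimes> g')"
  unfolding sid_cut[OF lay_H lay_H] by (rule lay_comp[OF lay_right lay_left])

section \<open>Replacing type 2 strands by pairs of type 1 strands\<close>

fun wlen :: "strand list \<Rightarrow> nat" where
  "wlen [] = 0"
| "wlen (S1 # s) = 1 + wlen s"
| "wlen (S2 # s) = 2 + wlen s"

fun mrgs :: "strand list \<Rightarrow> skein" where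
  "mrgs [] = ident []"
| "mrgs (S1 # s) = \<one> \<otimes> mrgs s"
| "mrgs (S2 # s) = mrg \<otimes> mrgs s"

fun spls :: "strand list \<Rightarrow> skein" where
  "spls [] = ident []"
| "spls (S1 # s) = \<one> \<otimes> spls s"
| "spls (S2 # s) = spl \<otimes> spls s"

lemma wlen_append [simp]: "wlen (s @ t) = wlen s + wlen t"
  by (induction s rule: wlen.induct) auto

lemma mrgs_append: "mrgs (s @ t) = mrgs s \<otimes> mrgs t"
  and spls_append: "spls (s @ t) = spls s \<otimes> spls t"
  by (induction s rule: wlen.induct) (auto simp: tensor_assoc)

lemma mrgs_typing [typing]: "mrgs s \<in> Hom (replicate (wlen s) S1) s"
proof (induction s rule: mrgs.induct)
  case (2 s)
  then show ?case using Hom_tensor[OF Hom_ident[of "[S1]"] 2] by simp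
next
  case (3 s)
  then show ?case using Hom_tensor[OF Hom_gen(5) 3] by simp
qed simp

lemma spls_typing [typing]: "spls s \<in> Hom s (replicate (wlen s) S1)"
proof (induction s rule: spls.induct)
  case (2 s)
  then show ?case using Hom_tensor[OF Hom_ident[of "[S1]"] 2] by simp
next
  case (3 s)
  then show ?case using Hom_tensor[OF Hom_gen(6) 3] by simp
qed simp

text \<open>The scalar is a power of \<open>\<alpha>\<close> with one factor for each type 2 letter.
  As it is not zero, passing through doubled strands loses nothing.\<close>

lemma mrgs_spls: "\<exists>c. c \<noteq> 0 \<and> mrgs s * spls s = c *\<^sub>K ident s"
proof (induction s rule: mrgs.induct)
  case 1
  have "ident [] * ident [] = 1 *\<^sub>K ident []"
    by (simp add: ident_times[OF Hom_ident])
  then show ?case by (intro exI[of _ 1]) simp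
next
  case (2 s)
  then obtain c where "c \<noteq> 0" "mrgs s * spls s = c *\<^sub>K ident s" by blast
  then show ?case
    using interchange[OF Hom_ident Hom_ident mrgs_typing spls_typing, of "[S1]" s]
    by (auto simp: ident_times[OF Hom_ident] ident_tensor intro!: exI[of _ c])
next
  case (3 s)
  then obtain c where "c \<noteq> 0" "mrgs s * spls s = c *\<^sub>K ident s" by blast
  then show ?case
    using interchange[OF Hom_gen(5,6) mrgs_typing spls_typing, of s]
    by (auto simp: mrg_spl ident_tensor intro!: exI[of _ "c * \<alpha>"])
qed

lemma lay_spl_mrg: "lay 2 2 (spl * mrg)"
proof -
  have "lay 2 2 (X + U)"
    using lay_gen[of X 2 0 0] lay_gen[of U 2 0 0] by (intro lay.add) auto
  then show ?thesis by (simp add: X_eq_I)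
qed

lemma lay_spls_mrgs: "lay (wlen s) (wlen s) (spls s * mrgs s)"
proof (induction s rule: mrgs.induct)
  case 1
  show ?case
    using lay.sid[of 0] by (simp add: sid_def ident_times[OF Hom_ident])
next
  case (2 s)
  have "spls (S1 # s) * mrgs (S1 # s) = sid 1 \<otimes> (spls s * mrgs s)"
    using interchange[OF Hom_ident Hom_ident spls_typing mrgs_typing, of "[S1]" s]
    by (simp add: ident_times[OF Hom_ident]) (simp add: one_eq_sid)
  then show ?case
    using lay_left[OF 2, of 1] by simp
next
  case (3 s)
  have "spls (S2 # s) * mrgs (S2 # s) = (spl * mrg) \<otimes> (spls s * mrgs s)"
    using interchange[OF Hom_gen(6,5) spls_typing mrgs_typing, of s] by simp
  then show ?case
    using lay_tensor[OF lay_spl_mrg 3] by simp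
qed

lemma lay_nested: "lay 0 4 cup_cup" "lay 4 0 cap_cap"
proof -
  have c: "lay 0 2 cup" "lay 2 0 cap"
    using lay_cu[of 0] lay_ca[of 0] by (simp_all add: numeral_2_eq_2)
  have "lay 2 4 (place 1 cup 1)" "lay 4 2 (place 1 cap 1)"
    using lay_tensor[OF lay.sid[of 1] lay_tensor[OF c(1) lay.sid[of 1]]]
      lay_tensor[OF lay.sid[of 1] lay_tensor[OF c(2) lay.sid[of 1]]] by (simp_all add: numeral_eq_Suc)
  then show "lay 0 4 cup_cup" "lay 4 0 cap_cap"
    using lay_comp c by (auto simp: cup_cup_def cap_cap_def one_eq_sid simp del: One_nat_def)
qed

text \<open>Vertices placed on the type 2 ends turn every elementary piece into a product of cups,
  caps and \<open>spl * mrg = X + U\<close>.\<close>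

lemma lay_web: "\<turnstile> w : s \<leadsto> t \<Longrightarrow> lay (wlen s) (wlen t) (spls t * web_class w * mrgs s)"
proof (induction rule: has_ends.induct)
  case (1 s)
  have "spls s * ident s = spls s" by (rule times_ident) (rule typing)
  then show ?case using lay_spls_mrgs by simp
next
  case (2 a)
  show ?case
  proof (cases a)
    case S1
    have "ident [S1, S1] * cup * ident [] = cup"
      by (simp add: ident_times[OF Hom_gen(1)] times_ident[OF Hom_gen(1)])
    then show ?thesis
      using S1 lay_cu[of 0] by (simp add: ident_tensor numeral_2_eq_2 flip: cup_def)
  next
    case S2
    \<comment> \<open>\<open>spl_cup2\<close> replaces the type 2 cup by nested cups and a merge,
      which pairs with the second \<open>spl\<close> to give \<open>X + U\<close>.\<close>
    have "(spl \<otimes> spl) * cup2 = (ident [S1, S1] \<otimes> spl) * ((spl \<otimes> ident [S2]) * cup2)"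
      by (subst cut_right, (rule typing)+) (simp add: mult.assoc)
    also have "\<dots> = (sid 2 \<otimes> (spl * mrg)) * cup_cup"
      unfolding spl_cup2 ident2_eq_sid[symmetric]
      by (subst ident_tensor_times, (rule typing)+) (simp add: mult.assoc)
    finally have "(spl \<otimes> spl) * cup2 * ident [] = (sid 2 \<otimes> (spl * mrg)) * cup_cup"
      by (simp add: mult.assoc cup_cup_def cup_times_empty)
    moreover have "lay 0 4 \<dots>"
      using lay_left[OF lay_spl_mrg, of 2] lay_nested by (intro lay_comp[of 4]) simp_all
    ultimately show ?thesis
      using S2 by (simp flip: cup2_def)
  qed
next
  case (3 a)
  show ?case
  proof (cases a)
    case S1
    have "ident [] * cap * ident [S1, S1] = cap"
      by (simp add: ident_times[OF Hom_gen(2)] times_ident[OF Hom_gen(2)])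
    then show ?thesis
      using S1 lay_ca[of 0] by (simp add: ident_tensor numeral_2_eq_2 flip: cap_def)
  next
    case S2
    have "cap2 * (mrg \<otimes> mrg) = (cap2 * (mrg \<otimes> ident [S2])) * (ident [S1, S1] \<otimes> mrg)"
      by (subst cut_left, (rule typing)+) (simp add: mult.assoc)
    also have "\<dots> = cap_cap * (sid 2 \<otimes> (spl * mrg))"
      unfolding cap_cap_spl[symmetric] ident2_eq_sid[symmetric]
      by (subst ident_tensor_times, (rule typing)+) (simp add: mult.assoc)
    finally have "ident [] * (cap2 * (mrg \<otimes> mrg)) = cap_cap * (sid 2 \<otimes> (spl * mrg))"
      by (simp add: mult.assoc[symmetric] cap_cap_def empty_times_cap)
    moreover have "lay 4 0 \<dots>"
      using lay_left[OF lay_spl_mrg, of 2] lay_nested by (intro lay_comp[of 4]) simp_all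
    ultimately show ?thesis
      using S2 by (simp add: mult.assoc flip: cap2_def)
  qed
next
  case 4
  have "mrg * ident [S1, S1] = mrg" by (rule times_ident) (rule typing)
  then show ?case
    using lay_spl_mrg by (simp add: ident_tensor mult.assoc numeral_2_eq_2 flip: mrg_def)
next
  case 5
  have "ident [S1, S1] * spl = spl" by (rule ident_times) (rule typing)
  then show ?case
    using lay_spl_mrg by (simp add: ident_tensor numeral_2_eq_2 flip: spl_def)
next
  case (6 w s t v u)
  obtain c where c: "c \<noteq> 0" "mrgs t * spls t = c *\<^sub>K ident t"
    using mrgs_spls by blast
  \<comment> \<open>Stacking the two layered webs leaves \<open>mrgs t * spls t\<close> in the
    middle, a nonzero scalar that is divided out at the end.\<close>
  have "lay (wlen s) (wlen u) ((spls u * web_class v * mrgs t) * (spls t * web_class w * mrgs s))"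
    by (rule lay_comp) fact+
  also have "(spls u * web_class v * mrgs t) * (spls t * web_class w * mrgs s)
      = spls u * web_class v * (mrgs t * spls t) * web_class w * mrgs s"
    by (simp add: mult.assoc)
  also have "\<dots> = c *\<^sub>K (spls u * web_class (v \<cdot> w) * mrgs s)"
    unfolding c using ident_times[OF Hom_web[OF 6(1)]]
    by (simp add: mult.assoc flip: web_class_times)
  finally show ?case
    using lay.scale[of "wlen s" "wlen u" _ "inverse c"] c(1) by fastforce
next
  case (7 v s t w s' t')
  have "spls (t @ t') * web_class (v \<parallel> w) * mrgs (s @ s')
      = (spls t * web_class v * mrgs s) \<otimes> (spls t' * web_class w * mrgs s')"
    unfolding spls_append mrgs_append web_class_tensor[symmetric]
      interchange[OF spls_typing Hom_web[OF 7(1)] spls_typing Hom_web[OF 7(2)]]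
    by (rule interchange)
      (rule typing Hom_times[OF spls_typing Hom_web[OF 7(1)]] Hom_times[OF spls_typing Hom_web[OF 7(2)]])+
  then show ?case
    using lay_tensor[OF 7(3,4)] by simp
qed

lemma wlen_replicate [simp]: "wlen (replicate n S1) = n"
  and mrgs_replicate [simp]: "mrgs (replicate n S1) = sid n"
  and spls_replicate [simp]: "spls (replicate n S1) = sid n"
proof -
  show "mrgs (replicate n S1) = sid n"
    by (induction n) (simp_all add: one_eq_sid, simp add: sid_def)
  show "spls (replicate n S1) = sid n"
    by (induction n) (simp_all add: one_eq_sid, simp add: sid_def)
qed (induction n; simp)

lemma H_subset_alg:
  assumes "x \<in> H n n"
  shows "x \<in> alg n"
  using assms unfolding H_def
proof (induction rule: Hom_induct)
  case zero
  show ?case using alg.scale[OF alg.sid, where c = 0] by simp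
next
  case (add x c w)
  have "nf n n (sid n * web_class w * sid n)"
    using lay_nf[OF lay_web[OF \<open>\<turnstile> w : replicate n S1 \<leadsto> replicate n S1\<close>]] by simp
  moreover have "sid n * web_class w * sid n = web_class w"
    using Hom_web[OF \<open>\<turnstile> w : replicate n S1 \<leadsto> replicate n S1\<close>] by (simp add: sid_times[of _ n n] times_sid[of _ n n] H_def)
  ultimately have "nf n n (web_class w)" by simp
  then have "web_class w \<in> alg n"
  proof (cases rule: nf_cases)
    case (cups k a)
    then show ?thesis by (simp add: times_sid[OF alg_H])
  qed simp
  then show ?case using add by (intro alg.add alg.scale)
qed

section \<open>Elements annihilated by the generators\<close>

text \<open>A test by finitely many webs, all with \<open>n\<close> ends above and below, in place
  of the clasp condition on all lower words; \<open>annl_lower\<close> shows that it suffices. The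
  equation with \<open>sid n\<close> stands for a typing condition.\<close>

definition annl :: "nat \<Rightarrow> skein \<Rightarrow> bool" where
  "annl n P \<longleftrightarrow> sid n * P = P \<and>
     (\<forall>y l r. y \<in> {X, U} \<longrightarrow> n = l + 2 + r \<longrightarrow> (place l y r) * P = 0)"

definition annr :: "nat \<Rightarrow> skein \<Rightarrow> bool" where
  "annr n P \<longleftrightarrow> P * sid n = P \<and>
     (\<forall>y l r. y \<in> {X, U} \<longrightarrow> n = l + 2 + r \<longrightarrow> P * place l y r = 0)"

lemma annlD: "annl n P \<Longrightarrow> y \<in> {X, U} \<Longrightarrow> n = l + 2 + r \<Longrightarrow> (place l y r) * P = 0"
  and annl_sid: "annl n P \<Longrightarrow> sid n * P = P"
  unfolding annl_def by blast+

lemma annrD: "annr n P \<Longrightarrow> y \<in> {X, U} \<Longrightarrow> n = l + 2 + r \<Longrightarrow> P * place l y r = 0"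
  and annr_sid: "annr n P \<Longrightarrow> P * sid n = P"
  unfolding annr_def by blast+

lemma alg_annl: "a \<in> alg n \<Longrightarrow> annl n P \<Longrightarrow> \<exists>c. a * P = c *\<^sub>K P"
proof (induction rule: alg.induct)
  case sid
  then show ?case by (intro exI[of _ 1]) (simp add: annl_sid)
next
  case (add a b)
  then show ?case by (metis distrib_right skein.scale_left_distrib)
next
  case (scale a c)
  then show ?case by (metis scale_times(1) skein.scale_scale)
next
  case (gen a y l r)
  then obtain c where "a * P = c *\<^sub>K P" by blast
  then show ?case
    using annlD[OF gen(5,2,3)] by (intro exI[of _ 0]) (simp add: mult.assoc)
qed

lemma alg_annr: "a \<in> alg n \<Longrightarrow> annr n P \<Longrightarrow> \<exists>c. P * a = c *\<^sub>K P"
proof (induction rule: alg.induct)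
  case sid
  then show ?case by (intro exI[of _ 1]) (simp add: annr_sid)
next
  case (add a b)
  then show ?case by (metis distrib_left skein.scale_left_distrib)
next
  case (scale a c)
  then show ?case by (metis scale_times(2) skein.scale_scale)
next
  case (gen a y l r)
  then show ?case
    using annrD[OF gen(5,2,3)] by (intro exI[of _ 0]) (simp flip: mult.assoc)
qed

text \<open>\<open>U\<close> below a cap gives the cap back with the nonzero factor
  \<open>- \<delta>\<close>, so that \<open>U\<close> killing \<open>P\<close> forces the cap to
  kill \<open>P\<close>.\<close>

lemma caps_annl: "annl n P \<Longrightarrow> n = m + 2 * Suc k \<Longrightarrow> caps m (Suc k) * P = 0"
proof (induction k arbitrary: m)
  case 0
  have "(ca m * (sid m \<otimes> U)) * P = 0"
    using annlD[OF 0(1), of U m 0] 0(2) by (simp add: mult.assoc)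
  moreover have "ca m * (sid m \<otimes> U) = - \<delta> *\<^sub>K ca m"
  proof -
    have "cap * U = - \<delta> *\<^sub>K cap"
      by (simp add: U_def cap_cup empty_times_cap flip: mult.assoc)
    then show ?thesis
      by (simp add: sid_tensor_times[OF H_gen(2,4), symmetric])
  qed
  ultimately have "\<delta> *\<^sub>K (ca m * P) = 0" by simp
  then show ?case
    using 0 annl_sid[OF 0(1)] by (simp add: mult.assoc)
next
  case (Suc k)
  then show ?case using Suc.IH[of "m + 2"] by (simp add: mult.assoc)
qed

lemma cups_annr: "annr n P \<Longrightarrow> n = m + 2 * Suc k \<Longrightarrow> P * cups m (Suc k) = 0"
proof -
  assume P: "annr n P" and n: "n = m + 2 * Suc k"
  define m' where "m' = m + 2 * k"
  have "P * ((sid m' \<otimes> U) * cu m') = 0"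
    using annrD[OF P, of U m' 0] n by (simp add: m'_def flip: mult.assoc)
  moreover have "(sid m' \<otimes> U) * cu m' = - \<delta> *\<^sub>K cu m'"
  proof -
    have "U * cup = - \<delta> *\<^sub>K cup"
      by (simp add: U_def cap_cup cup_times_empty mult.assoc)
    then show ?thesis
      by (simp add: sid_tensor_times[OF H_gen(4,1), symmetric])
  qed
  ultimately have "\<delta> *\<^sub>K (P * cu m') = 0" by simp
  then have "P * cu m' * cups m k = 0"
    by simp
  then show ?thesis
    by (simp add: m'_def mult.assoc)
qed

lemma place_times:
  assumes "v \<in> Hom t u" "w \<in> Hom s t"
  shows "place l (v * w) r = place l v r * place l w r"
proof -
  have "(v * w) \<otimes> sid r = (v \<otimes> sid r) * (w \<otimes> sid r)"
    unfolding sid_def by (rule tensor_times_ident[OF assms])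
  then show ?thesis
    unfolding sid_def
    using ident_tensor_times[OF Hom_tensor[OF assms(1) Hom_ident] Hom_tensor[OF assms(2) Hom_ident]]
    by simp
qed

lemma place_spl_mrg: "place l (spl * mrg) r = place l X r + place l U r"
  by (simp add: X_eq_I tensor_diff_left tensor_diff_right)

text \<open>\<open>mrg\<close> is recovered from \<open>spl * mrg = X + U\<close> up to the nonzero
  value \<open>\<alpha>\<close> of the bigon.\<close>

lemma mrg_annl:
  assumes "annl n P" "n = l + 2 + r"
  shows "place l mrg r * P = 0"
proof -
  have "place l (spl * mrg) r * P = 0"
    using annlD[OF assms(1), of _ l r] assms(2) by (simp add: place_spl_mrg distrib_right)
  then have "place l (mrg * (spl * mrg)) r * P = 0"
    by (simp add: place_times[OF Hom_gen(5) Hom_times[OF Hom_gen(6,5)]] mult.assoc)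
  moreover have "mrg * (spl * mrg) = \<alpha> *\<^sub>K mrg"
    by (simp add: mrg_spl ident_times[OF Hom_gen(5)] flip: mult.assoc)
  ultimately show ?thesis by simp
qed

lemma spl_annr:
  assumes "annr n P" "n = l + 2 + r"
  shows "P * place l spl r = 0"
proof -
  have "P * place l (spl * mrg) r = 0"
    using annrD[OF assms(1), of _ l r] assms(2) by (simp add: place_spl_mrg distrib_left)
  then have "P * place l ((spl * mrg) * spl) r = 0"
    by (simp add: place_times[OF Hom_times[OF Hom_gen(6,5)] Hom_gen(6)] flip: mult.assoc)
  moreover have "(spl * mrg) * spl = \<alpha> *\<^sub>K spl"
    by (simp add: mrg_spl times_ident[OF Hom_gen(6)] mult.assoc)
  ultimately show ?thesis by simp
qed

lemma word_with_S2:
  assumes "wlen t = n" "t \<noteq> replicate n S1"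
  obtains t1 t2 where "t = t1 @ S2 # t2" "n = wlen t1 + 2 + wlen t2"
proof -
  have "S2 \<in> set t"
  proof (rule ccontr)
    assume "S2 \<notin> set t"
    then have "x = S1" if "x \<in> set t" for x
      using that by (cases x) auto
    then have "t = replicate (length t) S1"
      by (metis replicate_length_same)
    with assms show False by (metis wlen_replicate)
  qed
  then show thesis
    using that assms(1) split_list[of S2 t] by auto
qed

lemma mrgs_annl:
  assumes "annl n P" "wlen t = n" "t \<noteq> replicate n S1"
  shows "mrgs t * P = 0"
proof -
  obtain t1 t2 where t: "t = t1 @ S2 # t2" "n = wlen t1 + 2 + wlen t2"
    using word_with_S2[OF assms(2,3)] by blast
  have "mrg \<otimes> mrgs t2 = (ident [S2] \<otimes> mrgs t2) * (mrg \<otimes> sid (wlen t2))"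
    unfolding sid_def by (rule cut_right) (rule typing)+
  then have "mrgs t = (mrgs t1 * sid (wlen t1)) \<otimes> ((ident [S2] \<otimes> mrgs t2) * (mrg \<otimes> sid (wlen t2)))"
    unfolding t(1) mrgs_append using times_ident[OF mrgs_typing, of t1] by (simp add: sid_def)
  also have "\<dots> = (mrgs t1 \<otimes> ident [S2] \<otimes> mrgs t2) * place (wlen t1) mrg (wlen t2)"
    unfolding sid_def
    by (rule interchange[symmetric, OF mrgs_typing Hom_ident
          Hom_tensor[OF Hom_ident mrgs_typing] Hom_tensorI[OF Hom_gen(5) Hom_ident]]) auto
  finally show ?thesis
    using mrg_annl[OF assms(1) t(2)] by (simp add: mult.assoc)
qed

lemma spls_annr:
  assumes "annr n P" "wlen t = n" "t \<noteq> replicate n S1"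
  shows "P * spls t = 0"
proof -
  obtain t1 t2 where t: "t = t1 @ S2 # t2" "n = wlen t1 + 2 + wlen t2"
    using word_with_S2[OF assms(2,3)] by blast
  have "spl \<otimes> spls t2 = (spl \<otimes> sid (wlen t2)) * (ident [S2] \<otimes> spls t2)"
    unfolding sid_def by (rule cut_left) (rule typing)+
  then have "spls t = (sid (wlen t1) * spls t1) \<otimes> ((spl \<otimes> sid (wlen t2)) * (ident [S2] \<otimes> spls t2))"
    unfolding t(1) spls_append using ident_times[OF spls_typing, of t1] by (simp add: sid_def)
  also have "\<dots> = place (wlen t1) spl (wlen t2) * (spls t1 \<otimes> ident [S2] \<otimes> spls t2)"
    unfolding sid_def
    by (rule interchange[symmetric, OF Hom_ident spls_typing
          Hom_tensorI[OF Hom_gen(6) Hom_ident] Hom_tensor[OF Hom_ident spls_typing]]) auto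
  finally show ?thesis
    using spl_annr[OF assms(1) t(2)] by (simp flip: mult.assoc)
qed

text \<open>After doubling, \<open>spls t * w\<close> has a normal form. If
  \<open>wlen t < n\<close>, it ends in a cap that kills \<open>P\<close>; if
  \<open>wlen t = n\<close>, it acts on \<open>P\<close> by a scalar and the merge at a type 2
  letter of \<open>t\<close> kills. Undoing the doubling costs only the nonzero scalar of
  \<open>mrgs_spls\<close>.\<close>

lemma annl_lower:
  assumes w: "w \<in> Hom (replicate n S1) t" and t: "wlen t \<le> n" "t \<noteq> replicate n S1" and P: "annl n P"
  shows "w * P = 0"
  using w
proof (induction rule: Hom_induct)
  case (add x c w)
  define g where "g = spls t * web_class w"
  have "nf n (wlen t) (g * sid n)"
    using lay_nf[OF lay_web[OF \<open>\<turnstile> w : replicate n S1 \<leadsto> t\<close>]] by (simp add: g_def)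
  then have "mrgs t * (g * sid n) * P = 0"
  proof (cases rule: nf_cases)
    case (cups k a)
    then have "k = 0" and n: "wlen t = n" using t by auto
    moreover obtain c where "a * P = c *\<^sub>K P"
      using alg_annl[OF _ P] cups(2) n by auto
    ultimately show ?thesis
      using cups mrgs_annl[OF P n t(2)] annl_sid[OF P] by (simp add: mult.assoc)
  next
    case (caps k a)
    obtain c where "a * P = c *\<^sub>K P"
      using alg_annl[OF caps(2) P] by auto
    then show ?thesis
      using caps_annl[OF P caps(1)] by (simp add: caps(3) mult.assoc del: caps.simps)
  qed
  then have *: "mrgs t * spls t * web_class w * P = 0"
    by (simp add: g_def mult.assoc annl_sid[OF P])
  obtain d where d: "d \<noteq> 0" "mrgs t * spls t = d *\<^sub>K ident t"
    using mrgs_spls by blast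
  have "d *\<^sub>K (web_class w * P) = 0"
    using * ident_times[OF Hom_web[OF \<open>\<turnstile> w : replicate n S1 \<leadsto> t\<close>]] by (simp add: d)
  then have "web_class w * P = 0"
    using d(1) by simp
  then show ?case using add by (simp add: distrib_right)
qed simp

lemma annr_lower:
  assumes w: "w \<in> Hom t (replicate n S1)" and t: "wlen t \<le> n" "t \<noteq> replicate n S1" and P: "annr n P"
  shows "P * w = 0"
  using w
proof (induction rule: Hom_induct)
  case (add x c w)
  define g where "g = web_class w * mrgs t"
  have "nf (wlen t) n (sid n * g)"
    using lay_nf[OF lay_web[OF \<open>\<turnstile> w : t \<leadsto> replicate n S1\<close>]] by (simp add: g_def mult.assoc)
  then have "P * (sid n * g) * spls t = 0"
  proof (cases rule: nf_cases)
    case (cups k a)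
    obtain c where c: "P * a = c *\<^sub>K P"
      using alg_annr[OF cups(2) P] by auto
    show ?thesis
    proof (cases k)
      case 0
      then have n: "wlen t = n" using cups by simp
      then show ?thesis
        using c 0 cups spls_annr[OF P n t(2)] annr_sid[OF P] by (simp flip: mult.assoc)
    next
      case (Suc k')
      then have "P * (sid n * g) = 0"
        using c cups(3) cups_annr[OF P, of "wlen t" k'] cups(1)
        by (simp del: cups.simps flip: mult.assoc)
      then show ?thesis by simp
    qed
  next
    case (caps k a)
    then show ?thesis using t by simp
  qed
  then have *: "P * (web_class w * (mrgs t * spls t)) = 0"
    by (simp add: g_def annr_sid[OF P] flip: mult.assoc)
  obtain d where d: "d \<noteq> 0" "mrgs t * spls t = d *\<^sub>K ident t"
    using mrgs_spls by blast
  have "d *\<^sub>K (P * web_class w) = 0"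
    using * times_ident[OF Hom_web[OF \<open>\<turnstile> w : t \<leadsto> replicate n S1\<close>]] by (simp add: d)
  then have "P * web_class w = 0"
    using d(1) by simp
  then show ?case using add by (simp add: distrib_left)
qed simp

text \<open>The ideal spanned by words with at least one generator. Since \<open>projector n\<close>
  is congruent to \<open>sid n\<close> modulo this ideal, it is absorbed by everything that the
  generators kill, and it has the same value as \<open>sid n\<close> under
  \<open>coef\<close>.\<close>

inductive_set rad :: "nat \<Rightarrow> skein set" for n where
  zero [intro, simp]: "0 \<in> rad n"
| add [intro]: "x \<in> rad n \<Longrightarrow> y \<in> rad n \<Longrightarrow> x + y \<in> rad n"
| gen: "a \<in> alg n \<Longrightarrow> y \<in> {X, U} \<Longrightarrow> n = l + 2 + r \<Longrightarrow> a * place l y r \<in> rad n"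

lemma rad_scale: "x \<in> rad n \<Longrightarrow> c *\<^sub>K x \<in> rad n"
proof (induction rule: rad.induct)
  case (gen b y l r)
  then show ?case
    using rad.gen[of "c *\<^sub>K b" n y l r] by (simp add: alg.scale)
qed (auto simp: skein.scale_right_distrib intro: rad.add)

lemma rad_alg: "x \<in> rad n \<Longrightarrow> x \<in> alg n"
proof (induction rule: rad.induct)
  case zero
  show ?case using alg.scale[OF alg.sid, where c = 0] by simp
next
  case (gen a y l r)
  then show ?case by (intro alg_times alg_gen)
qed (auto intro: alg.add)

lemma rad_right: "a \<in> alg n \<Longrightarrow> x \<in> rad n \<Longrightarrow> x * a \<in> rad n"
proof (induction arbitrary: x rule: alg.induct)
  case sid
  then show ?case using times_sid[OF alg_H[OF rad_alg]] by simp
next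
  case (gen a y l r)
  have "x * place l y r \<in> rad n"
    by (intro rad.gen rad_alg gen)
  from gen(4)[OF this] show ?case by (simp add: mult.assoc)
qed (auto simp: distrib_left intro: rad.add rad_scale)

lemma rad_tensor_sid: "x \<in> rad n \<Longrightarrow> x \<otimes> sid 1 \<in> rad (Suc n)"
proof (induction rule: rad.induct)
  case (gen a y l r)
  have "(a * place l y r) \<otimes> sid 1 = (a \<otimes> sid 1) * place l y (r + 1)"
    by (subst tensor_sid_times[OF alg_H H_place]) (use gen in \<open>auto simp: tensor_assoc\<close>)
  also have "\<dots> \<in> rad (Suc n)"
    by (rule rad.gen) (use gen in auto)
  finally show ?case .
qed (auto simp: tensor_add_left intro: rad.add)

lemma rad_annl: "x \<in> rad n \<Longrightarrow> annl n P \<Longrightarrow> x * P = 0"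
proof (induction rule: rad.induct)
  case (gen a y l r)
  then show ?case using annlD[OF gen(4,2,3)] by (simp add: mult.assoc)
qed (auto simp: distrib_right)

lemma rad_annr: "x \<in> rad n \<Longrightarrow> annr n P \<Longrightarrow> P * x = 0"
proof (induction rule: rad.induct)
  case (gen a y l r)
  obtain c where "P * a = c *\<^sub>K P" using alg_annr[OF gen(1,4)] by blast
  then show ?case using annrD[OF gen(4,2,3)] by (simp flip: mult.assoc)
qed (auto simp: distrib_left)

section \<open>The two-term recursion\<close>

definition gq :: "int \<Rightarrow> K" where "gq n = qhalf powi n + qhalf powi (- n)"

lemma qnum_double: "[2 * n]\<^sub>q = gq n * [n]\<^sub>q"
proof -
  have "qhalf powi (2 * n) = qhalf powi n * qhalf powi n" "qhalf powi (- (2 * n)) = qhalf powi (- n) * qhalf powi (- n)"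
    by (simp_all flip: power_int_add)
  then show ?thesis by (simp add: qnum_def gq_def field_simps)
qed

lemma gq_nonzero: "n \<noteq> 0 \<Longrightarrow> gq n \<noteq> 0"
  using qnum_double[of n] qnum_nonzero[of "2 * n"] by auto

lemma qnum_0 [simp]: "[0]\<^sub>q = 0" and qnum_1 [simp]: "[1]\<^sub>q = 1"
  using qhalf_diff_nonzero by (simp_all add: qnum_def)

lemma qnum_2: "[2]\<^sub>q = qhalf + inverse qhalf"
  using qnum_double[of 1] by (simp add: gq_def)

text \<open>\<open>[6]\<^sub>q / [3]\<^sub>q\<close> is \<open>gq 3\<close>, a polynomial in
  \<open>[2]\<^sub>q\<close>. This turns the scalar identities into polynomial ones.\<close>

lemma qd_eq: "\<delta> = [2]\<^sub>q ^ 4 - 3 * [2]\<^sub>q\<^sup>2"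
proof -
  have h: "qhalf * inverse qhalf = 1" by simp
  have "gq 3 = qhalf ^ 3 + inverse qhalf ^ 3"
    by (simp add: gq_def power_int_minus power_inverse)
  also have "\<dots> = (qhalf + inverse qhalf) ^ 3 - 3 * (qhalf + inverse qhalf)"
    using h by algebra
  finally have "gq 3 = [2]\<^sub>q ^ 3 - 3 * [2]\<^sub>q"
    by (simp add: qnum_2)
  moreover have "\<delta> = gq 3 * [2]\<^sub>q"
    using qnum_double[of 3] by (simp add: qd_def qnum_nonzero)
  ultimately show ?thesis
    by (simp only:) (simp add: algebra_simps power4_eq_xxxx power3_eq_cube power2_eq_square)
qed

text \<open>Solutions of \<open>scalar_identities\<close>: the first identity there is a recursion
  for \<open>xc\<close> with the start \<open>xc 1 = 0\<close>, and the second, once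
  \<open>xc\<close> is known, is a linear equation for \<open>yc n\<close>.\<close>

definition xc :: "nat \<Rightarrow> K" where "xc n = [int n - 1]\<^sub>q / ([2]\<^sub>q * [int n]\<^sub>q)"
definition yc :: "nat \<Rightarrow> K" where
  "yc n = [int n - 1]\<^sub>q * gq (int n) / ([int n]\<^sub>q * gq (int n + 1))"

lemma xc_1 [simp]: "xc (Suc 0) = 0" and yc_1 [simp]: "yc (Suc 0) = 0"
  by (simp_all add: xc_def yc_def)

lemma scalar_identities:
  assumes "n \<ge> 2"
  defines "x \<equiv> xc n" and "x' \<equiv> xc (n - 1)" and "y \<equiv> yc n" and "y' \<equiv> yc (n - 1)"
  shows "1 + \<alpha> * x * (1 - x') = 0"
    and "x * \<beta> + x * x' * (\<delta> - 3 * \<alpha>) + y * \<delta> + y * x' * \<beta> = 0"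
    and "- \<alpha> * x * x' + y * \<alpha> * x' + y * y' = 0"
    and "1 + x * (\<delta> + x' * \<beta>) + y * (- \<delta> + x' * \<delta> + y') = 0"
proof -
  \<comment> \<open>\<open>a\<close> and \<open>b\<close> are the powers of \<open>qhalf\<close>
    with exponents \<open>n\<close> and \<open>- n\<close>, treated as symbols with
    \<open>a * b = 1\<close>. Multiplied by \<open>d\<close>, the quantum integers are polynomials
    in \<open>h\<close>, \<open>k\<close>, \<open>a\<close> and \<open>b\<close>.\<close>
  define h k a b where "h = qhalf" and "k = inverse qhalf" and "a = qhalf powi int n"
    and "b = qhalf powi (- int n)"
  have hk: "h * k = 1" and ab: "a * b = 1"
    by (simp_all add: h_def k_def a_def b_def power_int_minus)
  define d where "d = h - k"
  have d: "d \<noteq> 0" using qhalf_diff_nonzero by (simp add: d_def h_def k_def)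
  define A B C w where "A = [int n]\<^sub>q" and "B = [int n - 1]\<^sub>q" and "C = [int n - 2]\<^sub>q" and "w = [2]\<^sub>q"
  define G G0 G1 where "G = gq (int n)" and "G0 = gq (int n - 1)" and "G1 = gq (int n + 1)"
  have p1: "qhalf powi (int n - 1) = a * k" "qhalf powi (int n - 2) = a * k\<^sup>2" "qhalf powi (int n + 1) = a * h"
    by (simp_all add: a_def h_def k_def power_int_diff power_int_add divide_inverse power_inverse)
  have inv: "b = inverse a" "h = inverse k"
    by (simp_all add: a_def b_def h_def k_def power_int_minus)
  have p2: "qhalf powi (- (int n - 1)) = b * h" "qhalf powi (- (int n - 2)) = b * h\<^sup>2"
      "qhalf powi (- (int n + 1)) = b * k"
    unfolding power_int_minus p1 by (simp_all add: inv power_inverse)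
  note p = p1 p2
  have dA: "d * A = a - b" and dB: "d * B = a * k - b * h" and dC: "d * C = a * k\<^sup>2 - b * h\<^sup>2"
  proof -
    have "A = (a - b) / d" "B = (a * k - b * h) / d" "C = (a * k\<^sup>2 - b * h\<^sup>2) / d"
      by (simp_all only: A_def B_def C_def qnum_def p a_def b_def d_def h_def k_def)
    then show "d * A = a - b" "d * B = a * k - b * h" "d * C = a * k\<^sup>2 - b * h\<^sup>2"
      using d by simp_all
  qed
  have w: "w = h + k" by (simp add: w_def h_def k_def qnum_2)
  have G: "G = a + b" and G0: "G0 = a * k + b * h" and G1: "G1 = a * h + b * k"
    by (simp_all only: G_def G0_def G1_def gq_def p a_def b_def)
  have nz: "A \<noteq> 0" "B \<noteq> 0" "w \<noteq> 0" "G \<noteq> 0" "G1 \<noteq> 0"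
    using assms(1) by (auto simp: A_def B_def w_def G_def G1_def qnum_nonzero gq_nonzero)
  have x: "x = B / (w * A)" and x': "x' = C / (w * B)" and y: "y = B * G / (A * G1)"
    and y': "y' = C * G0 / (B * G)"
    using assms(1) by (simp_all add: x_def x'_def y_def y'_def xc_def yc_def A_def B_def C_def
        w_def G_def G0_def G1_def of_nat_diff)
  have al: "\<alpha> = - (w\<^sup>2)" and de: "\<delta> = w ^ 4 - 3 * w\<^sup>2"
    by (simp_all add: qa_def qd_eq w_def)
  \<comment> \<open>The Chebyshev recursion of the quantum integers; by \<open>G01\<close> below the
    \<open>gq\<close> obey it as well.\<close>
  have AC: "A = w * B - C"
  proof -
    have "d * A = d * (w * B - C)"
      using dA dB dC w hk ab by algebra
    then show ?thesis using d by simp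
  qed
  have G01: "G0 = w * G - G1"
    using G G0 G1 w hk ab by algebra
  \<comment> \<open>\<open>e2\<close> and \<open>e4\<close> are the second and the fourth identity
    multiplied by \<open>A * G1\<close>, the former without a factor \<open>w\<close>. The single
    products are expanded beforehand by \<open>a * b = 1\<close>, which keeps each polynomial
    problem small.\<close>
  have e2: "w * (w\<^sup>2 - 3) * (B * G) + (2 - w\<^sup>2) * (B * G1 + C * G) + w * (C * G1) = 0"
  proof -
    have "d * (w * (w\<^sup>2 - 3) * (B * G) + (2 - w\<^sup>2) * (B * G1 + C * G) + w * (C * G1)) = 0"
    proof -
      have "d * (B * G) = a\<^sup>2 * k - b\<^sup>2 * h + k - h"
        using dB hk ab G by algebra
      moreover have "d * (B * G1) = a\<^sup>2 - b\<^sup>2 + k\<^sup>2 - h\<^sup>2"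
        using dB hk ab G1 by algebra
      moreover have "d * (C * G) = a\<^sup>2 * k\<^sup>2 - b\<^sup>2 * h\<^sup>2 + k\<^sup>2 - h\<^sup>2"
        using dC hk ab G by algebra
      moreover have "d * (C * G1) = a\<^sup>2 * k - b\<^sup>2 * h + k ^ 3 - h ^ 3"
        using dC hk ab G1 by algebra
      ultimately show ?thesis
        using w hk by algebra
    qed
    then show ?thesis using d by simp
  qed
  have e4: "A * G1 + w * (w\<^sup>2 - 3) * (B * G1) + (2 - w\<^sup>2) * (C * G1) - w\<^sup>2 * (w\<^sup>2 - 3) * (B * G)
      + w * (w\<^sup>2 - 3) * (C * G) + C * G0 = 0"
  proof -
    have "d * (A * G1 + w * (w\<^sup>2 - 3) * (B * G1) + (2 - w\<^sup>2) * (C * G1) - w\<^sup>2 * (w\<^sup>2 - 3) * (B * G)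
      + w * (w\<^sup>2 - 3) * (C * G) + C * G0) = 0"
    proof -
      have "d * (A * G1) = a\<^sup>2 * h - b\<^sup>2 * k + k - h"
        using dA hk ab G1 by algebra
      moreover have "d * (B * G1) = a\<^sup>2 - b\<^sup>2 + k\<^sup>2 - h\<^sup>2"
        using dB hk ab G1 by algebra
      moreover have "d * (C * G1) = a\<^sup>2 * k - b\<^sup>2 * h + k ^ 3 - h ^ 3"
        using dC hk ab G1 by algebra
      moreover have "d * (B * G) = a\<^sup>2 * k - b\<^sup>2 * h + k - h"
        using dB hk ab G by algebra
      moreover have "d * (C * G) = a\<^sup>2 * k\<^sup>2 - b\<^sup>2 * h\<^sup>2 + k\<^sup>2 - h\<^sup>2"
        using dC hk ab G by algebra
      moreover have "d * (C * G0) = a\<^sup>2 * k ^ 3 - b\<^sup>2 * h ^ 3 + k - h"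
        using dC hk ab G0 by algebra
      ultimately show ?thesis
        using w hk by algebra
    qed
    then show ?thesis using d by simp
  qed
  show "1 + \<alpha> * x * (1 - x') = 0"
  proof -
    have C: "C = w * B - A" using AC by simp
    show ?thesis
      using nz unfolding x x' al C by (simp add: field_simps power2_eq_square)
  qed
  have "A * G1 * (x * \<beta> + x * x' * (\<delta> - 3 * \<alpha>) + y * \<delta> + y * x' * \<beta>)
      = w * (w * (w\<^sup>2 - 3) * (B * G) + (2 - w\<^sup>2) * (B * G1 + C * G) + w * (C * G1))"
    using nz unfolding x x' y al de
    by (simp add: field_simps) (simp add: algebra_simps power2_eq_square power4_eq_xxxx)
  then show "x * \<beta> + x * x' * (\<delta> - 3 * \<alpha>) + y * \<delta> + y * x' * \<beta> = 0"
    using nz unfolding e2 by simp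
  show "- \<alpha> * x * x' + y * \<alpha> * x' + y * y' = 0"
    using nz unfolding x x' y y' al G01
    by (simp add: field_simps) (simp add: algebra_simps power2_eq_square)?
  have "A * G1 * (1 + x * (\<delta> + x' * \<beta>) + y * (- \<delta> + x' * \<delta> + y'))
     = A * G1 + w * (w\<^sup>2 - 3) * (B * G1) + (2 - w\<^sup>2) * (C * G1) - w\<^sup>2 * (w\<^sup>2 - 3) * (B * G)
      + w * (w\<^sup>2 - 3) * (C * G) + C * G0"
    using nz unfolding x x' y y' al de
    by (simp add: field_simps) (simp add: algebra_simps power2_eq_square power4_eq_xxxx power3_eq_cube)
  then show "1 + x * (\<delta> + x' * \<beta>) + y * (- \<delta> + x' * \<delta> + y') = 0"
    using nz unfolding e4 by simp
qed


text \<open>The computations that follow are needed for multiplication from the left and from the right,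
  hence for the product of skeins and for its opposite.\<close>

locale skein_product =
  fixes prod :: "skein \<Rightarrow> skein \<Rightarrow> skein" (infixl \<open>\<star>\<close> 70)
  assumes assoc: "(a \<star> b) \<star> c = a \<star> (b \<star> c)"
    and add_l: "(a + b) \<star> c = a \<star> c + b \<star> c"
    and add_r: "a \<star> (b + c) = a \<star> b + a \<star> c"
    and scale_l: "(t *\<^sub>K a) \<star> b = t *\<^sub>K (a \<star> b)"
    and scale_r: "a \<star> (t *\<^sub>K b) = t *\<^sub>K (a \<star> b)"
begin

lemma zero_r: "a \<star> 0 = 0" and zero_l: "0 \<star> a = 0"
  using add_r[of a 0 0] add_l[of 0 0 a] by simp_all

lemma diff_l: "(a - b) \<star> c = a \<star> c - b \<star> c"
  using add_l[of "a - b" b c] by (simp add: eq_diff_eq)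

lemma diff_r: "a \<star> (b - c) = a \<star> b - a \<star> c"
  using add_r[of a "b - c" c] by (simp add: eq_diff_eq)

lemma minus_l: "(- a) \<star> b = - (a \<star> b)" and minus_r: "a \<star> (- b) = - (a \<star> b)"
  using diff_l[of 0 a b] diff_r[of a 0 b] by (simp_all add: zero_l zero_r)

lemmas expand = add_l add_r scale_l scale_r zero_r zero_l diff_l diff_r minus_l minus_r

text \<open>To be read with \<open>F\<close> the clasp on \<open>n - 1\<close> strands beside one
  strand and \<open>G\<close> the clasp on \<open>n - 2\<close> strands beside two;
  \<open>x0\<close>, \<open>u0\<close> act on the last pair, \<open>x1\<close>, \<open>u1\<close> on
  the pair before. The middle \<open>F\<close> is expanded, its outer \<open>G\<close> moves out and
  its inner \<open>G\<close> is absorbed, and the relations on three strands apply. Terms with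
  \<open>x1\<close> or \<open>u1\<close> next to \<open>F\<close> vanish; \<open>V\<close> is the
  one term that neither vanishes nor reduces.\<close>

lemma contractions:
  assumes F: "F = G + x' *\<^sub>K (G \<star> x1 \<star> G) + y' *\<^sub>K (G \<star> u1 \<star> G)"
    and G: "x0 \<star> G = G \<star> x0" "u0 \<star> G = G \<star> u0" "G \<star> F = F"
    and F0: "x1 \<star> F = 0" "u1 \<star> F = 0"
    and two: "x0 \<star> x0 = \<alpha> *\<^sub>K x0 + \<beta> *\<^sub>K u0" "x0 \<star> u0 = \<delta> *\<^sub>K u0" "u0 \<star> x0 = \<delta> *\<^sub>K u0"
      "u0 \<star> u0 = - \<delta> *\<^sub>K u0"
    and three: "x0 \<star> x1 \<star> x0 = - \<alpha> *\<^sub>K x0 - \<alpha> *\<^sub>K (x1 \<star> u0 + u0 \<star> x1) + (\<delta> - 3 * \<alpha>) *\<^sub>K u0"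
      "x0 \<star> u1 \<star> x0 = x1 \<star> u0 \<star> x1" "u0 \<star> x1 \<star> x0 = \<alpha> *\<^sub>K (u0 \<star> x1) + \<beta> *\<^sub>K u0"
      "u0 \<star> u1 \<star> x0 = u0 \<star> x1" "x0 \<star> x1 \<star> u0 = \<alpha> *\<^sub>K (x1 \<star> u0) + \<beta> *\<^sub>K u0"
      "x0 \<star> u1 \<star> u0 = x1 \<star> u0" "u0 \<star> x1 \<star> u0 = \<delta> *\<^sub>K u0" "u0 \<star> u1 \<star> u0 = u0"
  defines "V \<equiv> G \<star> x1 \<star> u0 \<star> F"
  shows "x0 \<star> F \<star> x0 \<star> F = (\<alpha> - \<alpha> * x') *\<^sub>K (x0 \<star> F) + (\<beta> + x' * (\<delta> - 3 * \<alpha>)) *\<^sub>K (u0 \<star> F)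
            + (- \<alpha> * x') *\<^sub>K V"
    and "x0 \<star> F \<star> u0 \<star> F = (\<delta> + x' * \<beta>) *\<^sub>K (u0 \<star> F) + (\<alpha> * x' + y') *\<^sub>K V"
    and "u0 \<star> F \<star> x0 \<star> F = (\<delta> + x' * \<beta>) *\<^sub>K (u0 \<star> F)"
    and "u0 \<star> F \<star> u0 \<star> F = (- \<delta> + x' * \<delta> + y') *\<^sub>K (u0 \<star> F)"
proof -
  have main: "p \<star> F \<star> r \<star> F = (p \<star> r) \<star> F + x' *\<^sub>K (G \<star> ((p \<star> x1 \<star> r) \<star> F)) + y' *\<^sub>K (G \<star> ((p \<star> u1 \<star> r) \<star> F))"
    if "p \<star> G = G \<star> p" "r \<star> G = G \<star> r" for p r
  proof -
    have r: "G \<star> (r \<star> F) = r \<star> F"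
      using that(2) G(3) by (metis assoc)
    have "F \<star> (r \<star> F) = r \<star> F + x' *\<^sub>K (G \<star> (x1 \<star> (r \<star> F))) + y' *\<^sub>K (G \<star> (u1 \<star> (r \<star> F)))"
      by (subst F) (simp add: expand assoc r)
    then have "p \<star> (F \<star> (r \<star> F)) = p \<star> (r \<star> F) + x' *\<^sub>K (p \<star> (G \<star> (x1 \<star> (r \<star> F)))) + y' *\<^sub>K (p \<star> (G \<star> (u1 \<star> (r \<star> F))))"
      by (simp add: expand)
    moreover have "p \<star> (G \<star> z) = G \<star> (p \<star> z)" for z
      using that(1) by (metis assoc)
    ultimately show ?thesis by (simp add: assoc)
  qed
  have GF: "G \<star> (u0 \<star> F) = u0 \<star> F" "G \<star> (x0 \<star> F) = x0 \<star> F"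
    using G by (metis assoc)+
  have V: "G \<star> (x1 \<star> (u0 \<star> F)) = V"
    by (simp add: V_def assoc)
  note simps = expand assoc F0 GF V skein.scale_right_distrib skein.scale_left_distrib
    skein.scale_left_diff_distrib skein.scale_right_diff_distrib
  show "u0 \<star> F \<star> x0 \<star> F = (\<delta> + x' * \<beta>) *\<^sub>K (u0 \<star> F)"
    unfolding main[OF G(2,1)] two three by (simp add: simps algebra_simps)
  show "u0 \<star> F \<star> u0 \<star> F = (- \<delta> + x' * \<delta> + y') *\<^sub>K (u0 \<star> F)"
    unfolding main[OF G(2,2)] two three by (simp add: simps algebra_simps)
  show "x0 \<star> F \<star> u0 \<star> F = (\<delta> + x' * \<beta>) *\<^sub>K (u0 \<star> F) + (\<alpha> * x' + y') *\<^sub>K V"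
    unfolding main[OF G(1,2)] two three by (simp add: simps algebra_simps)
  have e1: "G \<star> ((x0 \<star> u1 \<star> x0) \<star> F) = 0"
    unfolding three by (simp add: simps)
  have e2: "G \<star> ((x0 \<star> x1 \<star> x0) \<star> F) = - \<alpha> *\<^sub>K (x0 \<star> F) - \<alpha> *\<^sub>K V + (\<delta> - 3 * \<alpha>) *\<^sub>K (u0 \<star> F)"
    unfolding three by (simp add: simps)
  show "x0 \<star> F \<star> x0 \<star> F = (\<alpha> - \<alpha> * x') *\<^sub>K (x0 \<star> F) + (\<beta> + x' * (\<delta> - 3 * \<alpha>)) *\<^sub>K (u0 \<star> F)
            + (- \<alpha> * x') *\<^sub>K V"
    unfolding main[OF G(1,1)] two e1 e2 by (simp add: simps algebra_simps)
qed

text \<open>The four expressions in \<open>s\<close> are the coefficients of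
  \<open>x0 \<star> F\<close>, \<open>u0 \<star> F\<close> and \<open>V\<close> in
  \<open>x0 \<star> P\<close>, and of \<open>u0 \<star> F\<close> in
  \<open>u0 \<star> P\<close>.\<close>

lemma annihilation:
  assumes P: "P = F + x *\<^sub>K (F \<star> x0 \<star> F) + y *\<^sub>K (F \<star> u0 \<star> F)"
    and c: "x0 \<star> F \<star> x0 \<star> F = (\<alpha> - \<alpha> * x') *\<^sub>K (x0 \<star> F) + (\<beta> + x' * (\<delta> - 3 * \<alpha>)) *\<^sub>K (u0 \<star> F)
            + (- \<alpha> * x') *\<^sub>K V"
      "x0 \<star> F \<star> u0 \<star> F = (\<delta> + x' * \<beta>) *\<^sub>K (u0 \<star> F) + (\<alpha> * x' + y') *\<^sub>K V"
      "u0 \<star> F \<star> x0 \<star> F = (\<delta> + x' * \<beta>) *\<^sub>K (u0 \<star> F)"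
      "u0 \<star> F \<star> u0 \<star> F = (- \<delta> + x' * \<delta> + y') *\<^sub>K (u0 \<star> F)"
    and s: "1 + \<alpha> * x * (1 - x') = 0"
      "x * \<beta> + x * x' * (\<delta> - 3 * \<alpha>) + y * \<delta> + y * x' * \<beta> = 0"
      "- \<alpha> * x * x' + y * \<alpha> * x' + y * y' = 0"
      "1 + x * (\<delta> + x' * \<beta>) + y * (- \<delta> + x' * \<delta> + y') = 0"
  shows "x0 \<star> P = 0" "u0 \<star> P = 0"
proof -
  have "x0 \<star> P = x0 \<star> F + x *\<^sub>K (x0 \<star> F \<star> x0 \<star> F) + y *\<^sub>K (x0 \<star> F \<star> u0 \<star> F)"
    unfolding P by (simp add: expand assoc)
  also have "\<dots> = (1 + \<alpha> * x * (1 - x')) *\<^sub>K (x0 \<star> F)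
      + (x * \<beta> + x * x' * (\<delta> - 3 * \<alpha>) + y * \<delta> + y * x' * \<beta>) *\<^sub>K (u0 \<star> F)
      + (- \<alpha> * x * x' + y * \<alpha> * x' + y * y') *\<^sub>K V"
    unfolding c by (simp add: skein.scale_right_distrib skein.scale_left_distrib
        skein.scale_left_diff_distrib skein.scale_right_diff_distrib algebra_simps)
  finally show "x0 \<star> P = 0" unfolding s by simp
  have "u0 \<star> P = u0 \<star> F + x *\<^sub>K (u0 \<star> F \<star> x0 \<star> F) + y *\<^sub>K (u0 \<star> F \<star> u0 \<star> F)"
    unfolding P by (simp add: expand assoc)
  also have "\<dots> = (1 + x * (\<delta> + x' * \<beta>) + y * (- \<delta> + x' * \<delta> + y')) *\<^sub>K (u0 \<star> F)"
    unfolding c by (simp add: skein.scale_right_distrib skein.scale_left_distrib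
        skein.scale_left_diff_distrib skein.scale_right_diff_distrib algebra_simps)
  finally show "u0 \<star> P = 0" unfolding s by simp
qed

end

interpretation fwd: skein_product "(*)"
  by standard (simp_all add: algebra_simps)

interpretation bwd: skein_product "\<lambda>a b. b * a"
  by standard (simp_all add: algebra_simps)


text \<open>For \<open>n = 0\<close> the second equation contains composites that do not fit; their coefficients
  \<open>xc 1\<close> and \<open>yc 1\<close> vanish.\<close>

primrec projector :: "nat \<Rightarrow> skein" where
  "projector 0 = sid 0"
| "projector (Suc n) = projector n \<otimes> sid 1
     + xc (Suc n) *\<^sub>K ((projector n \<otimes> sid 1) * (sid (n - 1) \<otimes> X) * (projector n \<otimes> sid 1))
     + yc (Suc n) *\<^sub>K ((projector n \<otimes> sid 1) * (sid (n - 1) \<otimes> U) * (projector n \<otimes> sid 1))"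

lemma projector_rad: "projector n \<in> alg n \<and> projector n - sid n \<in> rad n"
proof (induction n)
  case 0
  show ?case by simp
next
  case (Suc n)
  define F where "F = projector n \<otimes> sid 1"
  have F: "F \<in> alg (Suc n)" using Suc by (auto simp: F_def)
  have "(projector n - sid n) \<otimes> sid 1 \<in> rad (Suc n)" using Suc by (intro rad_tensor_sid) simp
  then have r: "F - sid (Suc n) \<in> rad (Suc n)"
    by (simp add: F_def tensor_diff_left)
  show ?case
  proof (cases n)
    case 0
    then show ?thesis by (simp add: rad.zero)
  next
    case (Suc k)
    have g: "F * (sid (n - 1) \<otimes> y) * F \<in> rad (Suc n)" if "y \<in> {X, U}" for y
      using rad.gen[OF F that, of k 0] Suc F by (simp add: rad_right)
    have "projector (Suc n) - sid (Suc n) = (F - sid (Suc n)) + xc (Suc n) *\<^sub>K (F * (sid (n - 1) \<otimes> X) * F)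
        + yc (Suc n) *\<^sub>K (F * (sid (n - 1) \<otimes> U) * F)"
      by (simp add: F_def)
    also have "\<dots> \<in> rad (Suc n)"
      by (intro rad.add rad_scale r g) auto
    finally have "projector (Suc n) - sid (Suc n) \<in> rad (Suc n)" .
    then show ?thesis
      using alg.add[OF rad_alg alg.sid, of "projector (Suc n) - sid (Suc n)" "Suc n"] by simp
  qed
qed

lemma projector_alg: "projector n \<in> alg n"
  using projector_rad by blast

lemma projector_H: "projector n \<in> H n n"
  by (rule alg_H[OF projector_alg])

lemma projector_absorb_left: "annl n P \<Longrightarrow> projector n * P = P"
  using rad_annl[of "projector n - sid n" n P] projector_rad annl_sid by (simp add: left_diff_distrib)

lemma projector_absorb_right: "annr n P \<Longrightarrow> P * projector n = P"
  using rad_annr[of "projector n - sid n" n P] projector_rad annr_sid by (simp add: right_diff_distrib)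

lemma projector_tensor_absorb:
  "annl (Suc n) P \<Longrightarrow> (projector n \<otimes> sid 1) * P = P" "annr (Suc n) P \<Longrightarrow> P * (projector n \<otimes> sid 1) = P"
proof -
  have r: "projector n \<otimes> sid 1 - sid (Suc n) \<in> rad (Suc n)"
    using rad_tensor_sid[of "projector n - sid n" n] projector_rad by (simp add: tensor_diff_left)
  show "annl (Suc n) P \<Longrightarrow> (projector n \<otimes> sid 1) * P = P"
    using rad_annl[OF r, of P] annl_sid by (simp add: left_diff_distrib)
  show "annr (Suc n) P \<Longrightarrow> P * (projector n \<otimes> sid 1) = P"
    using rad_annr[OF r, of P] annr_sid by (simp add: right_diff_distrib)
qed

lemma place_two:
  "(sid k \<otimes> X) * (sid k \<otimes> X) = \<alpha> *\<^sub>K (sid k \<otimes> X) + \<beta> *\<^sub>K (sid k \<otimes> U)"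
  "(sid k \<otimes> X) * (sid k \<otimes> U) = \<delta> *\<^sub>K (sid k \<otimes> U)"
  "(sid k \<otimes> U) * (sid k \<otimes> X) = \<delta> *\<^sub>K (sid k \<otimes> U)"
  "(sid k \<otimes> U) * (sid k \<otimes> U) = - \<delta> *\<^sub>K (sid k \<otimes> U)"
  by (subst sid_tensor_times[symmetric], (rule htyping)+,
      simp add: X_square U_mult tensor_add_right)+

lemma place_three:
  fixes k
  defines "x0 \<equiv> sid k \<otimes> xr" and "u0 \<equiv> sid k \<otimes> ur" and "x1 \<equiv> sid k \<otimes> xl" and "u1 \<equiv> sid k \<otimes> ul"
  shows "x0 * x1 * x0 = - \<alpha> *\<^sub>K x0 - \<alpha> *\<^sub>K (x1 * u0 + u0 * x1) + (\<delta> - 3 * \<alpha>) *\<^sub>K u0"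
      "x0 * u1 * x0 = x1 * u0 * x1" "u0 * x1 * x0 = \<alpha> *\<^sub>K (u0 * x1) + \<beta> *\<^sub>K u0"
      "u0 * u1 * x0 = u0 * x1" "x0 * x1 * u0 = \<alpha> *\<^sub>K (x1 * u0) + \<beta> *\<^sub>K u0"
      "x0 * u1 * u0 = x1 * u0" "u0 * x1 * u0 = \<delta> *\<^sub>K u0" "u0 * u1 * u0 = u0"
  unfolding assms
  by (simp_all only: sid_tensor_times[of _ 3 3 _ 3, symmetric] H_three H_times[of _ 3 3 _ 3]
      X_braid three_strands tensor_add_right tensor_diff_right tensor_scale)

text \<open>Generators within the first \<open>n - 1\<close> strands die on \<open>F\<close> by
  induction. For the last pair, the recursions of two consecutive projectors feed
  \<open>contractions\<close> and \<open>annihilation\<close>, once for each order of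
  multiplication.\<close>

lemma projector_ann: "annl n (projector n) \<and> annr n (projector n)"
proof (induction n rule: less_induct)
  case (less n)
  show ?case
  proof (cases n)
    case 0
    then show ?thesis by (simp add: annl_def annr_def sid_times[OF H_sid])
  next
    case n: (Suc m)
    define F where "F = projector m \<otimes> sid 1"
    have ann: "annl m (projector m)" "annr m (projector m)" using less n by auto
    have FH: "F \<in> H n n" unfolding F_def by (rule H_tensor[OF projector_H H_sid]) (use n in auto)
    have PH: "projector n \<in> H n n" by (rule projector_H)
    show ?thesis
    proof (cases m)
      case 0
      then show ?thesis using n by (simp add: annl_def annr_def sid_times[OF H_sid])
    next
      case m: (Suc k)
      define x0 u0 where "x0 = sid k \<otimes> X" and "u0 = sid k \<otimes> U"
      have P: "projector n = F + xc n *\<^sub>K (F * x0 * F) + yc n *\<^sub>K (F * u0 * F)"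
        using n m by (simp add: F_def x0_def u0_def)
      have inner: "place l y (Suc r) * F = 0" "F * place l y (Suc r) = 0"
        if "y \<in> {X, U}" "m = l + 2 + r" for y l r
      proof -
        have "place l y (Suc r) * F = (place l y r * projector m) \<otimes> sid 1"
          unfolding F_def by (subst tensor_sid_times[OF H_place projector_H]) (use that in \<open>auto simp: tensor_assoc\<close>)
        then show "place l y (Suc r) * F = 0"
          using annlD[OF ann(1) that] by simp
        have "F * place l y (Suc r) = (projector m * place l y r) \<otimes> sid 1"
          unfolding F_def by (subst tensor_sid_times[OF projector_H H_place]) (use that in \<open>auto simp: tensor_assoc\<close>)
        then show "F * place l y (Suc r) = 0"
          using annrD[OF ann(2) that] by simp
      qed
      have "\<exists>V W.
         (x0 * F * x0 * F = (\<alpha> - \<alpha> * xc m) *\<^sub>K (x0 * F) + (\<beta> + xc m * (\<delta> - 3 * \<alpha>)) *\<^sub>K (u0 * F)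
            + (- \<alpha> * xc m) *\<^sub>K V \<and>
          x0 * F * u0 * F = (\<delta> + xc m * \<beta>) *\<^sub>K (u0 * F) + (\<alpha> * xc m + yc m) *\<^sub>K V \<and>
          u0 * F * x0 * F = (\<delta> + xc m * \<beta>) *\<^sub>K (u0 * F) \<and>
          u0 * F * u0 * F = (- \<delta> + xc m * \<delta> + yc m) *\<^sub>K (u0 * F)) \<and>
         (F * (x0 * (F * x0)) = (\<alpha> - \<alpha> * xc m) *\<^sub>K (F * x0) + (\<beta> + xc m * (\<delta> - 3 * \<alpha>)) *\<^sub>K (F * u0)
            + (- \<alpha> * xc m) *\<^sub>K W \<and>
          F * (u0 * (F * x0)) = (\<delta> + xc m * \<beta>) *\<^sub>K (F * u0) + (\<alpha> * xc m + yc m) *\<^sub>K W \<and>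
          F * (x0 * (F * u0)) = (\<delta> + xc m * \<beta>) *\<^sub>K (F * u0) \<and>
          F * (u0 * (F * u0)) = (- \<delta> + xc m * \<delta> + yc m) *\<^sub>K (F * u0))"
      proof (cases k)
        case 0
        \<comment> \<open>Here \<open>xc m = yc m = 0\<close>, so \<open>V\<close> and
          \<open>W\<close> have the coefficient 0 and may be chosen as 0.\<close>
        have "F = sid 2" using m 0 by (simp add: F_def numeral_2_eq_2)
        then show ?thesis
          using 0 m U_mult X_square
          by (intro exI[of _ 0]) (simp add: distrib_left distrib_right x0_def u0_def sid_times[OF H_gen(3)] sid_times[OF H_gen(4)]
              times_sid[OF H_gen(3)] times_sid[OF H_gen(4)])
      next
        case k: (Suc j)
        define x1 u1 G where "x1 = sid j \<otimes> xl" and "u1 = sid j \<otimes> ul" and "G = projector k \<otimes> sid 2"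
        have x0: "x0 = sid j \<otimes> xr" "u0 = sid j \<otimes> ur"
          using k by (simp_all add: x0_def u0_def)
        have z: "x1 * F = 0" "u1 * F = 0" "F * x1 = 0" "F * u1 = 0"
          using inner[of _ j 0] m k by (auto simp: x1_def u1_def)
        have C1: "projector k \<otimes> sid 1 \<in> H m m" by (rule H_tensor[OF projector_H H_sid]) (use m in auto)
        have C2: "sid j \<otimes> y \<in> H m m" if "y \<in> {X, U}" for y
          by (rule H_tensor[OF H_sid H_XU[OF that]]) (use m k in auto)
        have place: "((projector k \<otimes> sid 1) * (sid j \<otimes> y) * (projector k \<otimes> sid 1)) \<otimes> sid 1 = G * place j y 1 * G"
          if "y \<in> {X, U}" for y
          by (simp add: tensor_sid_times[OF H_times[OF C1 C2[OF that]] C1] tensor_sid_times[OF C1 C2[OF that]]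
              G_def tensor_assoc del: One_nat_def)
        have "projector m = projector k \<otimes> sid 1 + xc m *\<^sub>K ((projector k \<otimes> sid 1) * (sid j \<otimes> X) * (projector k \<otimes> sid 1))
            + yc m *\<^sub>K ((projector k \<otimes> sid 1) * (sid j \<otimes> U) * (projector k \<otimes> sid 1))"
          unfolding m k by simp
        then have F: "F = G + xc m *\<^sub>K (G * x1 * G) + yc m *\<^sub>K (G * u1 * G)"
          unfolding F_def
          by (simp only: tensor_add_left tensor_scale place insert_iff simp_thms)
            (simp add: G_def x1_def u1_def tensor_assoc numeral_2_eq_2)
        have comm: "x0 * G = G * x0" "u0 * G = G * u0"
          using sid_commute[OF projector_H[of k] H_gen(3)] sid_commute[OF projector_H[of k] H_gen(4)]
          by (simp_all add: x0_def u0_def G_def)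
        have GF: "G * F = F" "F * G = F"
        proof -
          have "G * F = ((projector k \<otimes> sid 1) * projector m) \<otimes> sid 1"
            unfolding F_def tensor_sid_times[OF C1 projector_H] by (simp add: G_def tensor_assoc numeral_2_eq_2)
          then show "G * F = F"
            using projector_tensor_absorb(1)[of k "projector m"] ann m by (simp add: F_def)
          have "F * G = (projector m * (projector k \<otimes> sid 1)) \<otimes> sid 1"
            unfolding F_def tensor_sid_times[OF projector_H C1] by (simp add: G_def tensor_assoc numeral_2_eq_2)
          then show "F * G = F"
            using projector_tensor_absorb(2)[of k "projector m"] ann m by (simp add: F_def)
        qed
        note two = place_two[of k, folded x0_def u0_def]
        note three = place_three[of j, folded x0 x1_def u1_def]
        note L = fwd.contractions[OF F comm GF(1) z(1,2) two three]
        have F': "F = G + xc m *\<^sub>K (G * (x1 * G)) + yc m *\<^sub>K (G * (u1 * G))"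
          using F by (simp add: mult.assoc)
        note three' = three[unfolded mult.assoc]
        \<comment> \<open>Reading words backwards permutes the relations on three strands among
          themselves; this accounts for the order in which \<open>two\<close> and
          \<open>three'\<close> are listed below.\<close>
        have R1: "x0 * (x1 * x0) = - \<alpha> *\<^sub>K x0 - \<alpha> *\<^sub>K (u0 * x1 + x1 * u0) + (\<delta> - 3 * \<alpha>) *\<^sub>K u0"
          using three'(1) by (simp add: add.commute)
        note R = bwd.contractions[OF F' comm[symmetric] GF(2) z(3,4) two(1,3,2,4) R1 three'(2,5,6,3,4,7,8)]
        show ?thesis
          using L R by blast
      qed
      then obtain V W where
         L: "x0 * F * x0 * F = (\<alpha> - \<alpha> * xc m) *\<^sub>K (x0 * F) + (\<beta> + xc m * (\<delta> - 3 * \<alpha>)) *\<^sub>K (u0 * F)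
            + (- \<alpha> * xc m) *\<^sub>K V"
          "x0 * F * u0 * F = (\<delta> + xc m * \<beta>) *\<^sub>K (u0 * F) + (\<alpha> * xc m + yc m) *\<^sub>K V"
          "u0 * F * x0 * F = (\<delta> + xc m * \<beta>) *\<^sub>K (u0 * F)"
          "u0 * F * u0 * F = (- \<delta> + xc m * \<delta> + yc m) *\<^sub>K (u0 * F)"
         and R: "F * (x0 * (F * x0)) = (\<alpha> - \<alpha> * xc m) *\<^sub>K (F * x0) + (\<beta> + xc m * (\<delta> - 3 * \<alpha>)) *\<^sub>K (F * u0)
            + (- \<alpha> * xc m) *\<^sub>K W"
          "F * (u0 * (F * x0)) = (\<delta> + xc m * \<beta>) *\<^sub>K (F * u0) + (\<alpha> * xc m + yc m) *\<^sub>K W"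
          "F * (x0 * (F * u0)) = (\<delta> + xc m * \<beta>) *\<^sub>K (F * u0)"
          "F * (u0 * (F * u0)) = (- \<delta> + xc m * \<delta> + yc m) *\<^sub>K (F * u0)"
        by blast
      have s: "1 + \<alpha> * xc n * (1 - xc m) = 0"
        "xc n * \<beta> + xc n * xc m * (\<delta> - 3 * \<alpha>) + yc n * \<delta> + yc n * xc m * \<beta> = 0"
        "- \<alpha> * xc n * xc m + yc n * \<alpha> * xc m + yc n * yc m = 0"
        "1 + xc n * (\<delta> + xc m * \<beta>) + yc n * (- \<delta> + xc m * \<delta> + yc m) = 0"
        using scalar_identities[of n] n m by simp_all
      have P': "projector n = F + xc n *\<^sub>K (F * (x0 * F)) + yc n *\<^sub>K (F * (u0 * F))"
        using P by (simp add: mult.assoc)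
      note l = fwd.annihilation[OF P L s]
      note r = bwd.annihilation[OF P' R s]
      have "place l y r * projector n = 0 \<and> projector n * place l y r = 0"
        if "y \<in> {X, U}" "n = l + 2 + r" for y l r
      proof (cases r)
        case 0
        then have "l = k" using that n m by simp
        then show ?thesis
          using 0 that(1) \<open>x0 * projector n = 0\<close> \<open>u0 * projector n = 0\<close> \<open>projector n * x0 = 0\<close> \<open>projector n * u0 = 0\<close>
          by (auto simp: x0_def u0_def)
      next
        case (Suc r')
        then have "place l y r * F = 0" "F * place l y r = 0"
          using inner[of y l r'] that n by auto
        then have "place l y r * (F * z) = 0" "z * F * place l y r = 0" for z
          by (simp_all add: mult.assoc) (simp flip: mult.assoc)
        then show ?thesis
          using \<open>(place l y r) * F = 0\<close> \<open>F * place l y r = 0\<close>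
          unfolding P by (simp add: distrib_left distrib_right mult.assoc)
      qed
      then show ?thesis
        using PH by (auto simp: annl_def annr_def)
    qed
  qed
qed

lemma projector_idem: "projector n * projector n = projector n"
  using projector_absorb_left projector_ann by blast

section \<open>A representation of webs\<close>

datatype state = E1 | E2 | E3 | E4 | B1 | B2 | B3 | B4 | B5

fun strand_of :: "state \<Rightarrow> strand" where
  "strand_of E1 = S1" | "strand_of E2 = S1" | "strand_of E3 = S1" | "strand_of E4 = S1"
| "strand_of B1 = S2" | "strand_of B2 = S2" | "strand_of B3 = S2" | "strand_of B4 = S2"
| "strand_of B5 = S2"

fun arity :: "web \<Rightarrow> nat" where
  "arity (Id s) = length s"
| "arity (Cup a) = 0"
| "arity (Cap a) = 2"
| "arity Merge = 2"
| "arity Split = 1"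
| "arity (v \<cdot> w) = arity w"
| "arity (v \<parallel> w) = arity v + arity w"

definition hq :: K where "hq = qhalf"
definition kq :: K where "kq = inverse qhalf"

lemma hq_kq: "hq * kq = 1" "kq * hq = 1" "hq * (kq * x) = x" "kq * (hq * x) = x"
  by (simp_all add: hq_def kq_def)

text \<open>\<open>E1\<close> to \<open>E4\<close> carry the weights \<open>e1\<close>,
  \<open>e2\<close>, \<open>- e2\<close>, \<open>- e1\<close>, and \<open>B1\<close> to
  \<open>B5\<close> the weights \<open>e1 + e2\<close>, \<open>e1 - e2\<close>, \<open>0\<close>,
  \<open>e2 - e1\<close>, \<open>- e1 - e2\<close>. The pairing is nonzero only on opposite weights,
  and all pieces of webs preserve the total weight.\<close>

definition pairing :: "state list \<Rightarrow> K" where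
  "pairing x = (if x = [E1, E4] then 1
    else if x = [E2, E3] then 1
    else if x = [E3, E2] then - (hq ^ 2)
    else if x = [E4, E1] then - (hq ^ 4)
    else if x = [B1, B5] then - 1
    else if x = [B2, B4] then hq ^ 2
    else if x = [B3, B3] then hq ^ 4
    else if x = [B4, B2] then hq ^ 4
    else if x = [B5, B1] then - (hq ^ 6)
    else 0)"

definition merging :: "state list \<Rightarrow> (state list \<Rightarrow> K) \<Rightarrow> K" where
  "merging x f = (if x = [E1, E2] then (1 + kq ^ 2) * f [B1]
    else if x = [E2, E1] then - (hq + kq) * f [B1]
    else if x = [E1, E3] then (1 + kq ^ 2) * f [B2]
    else if x = [E3, E1] then - (hq + kq) * f [B2]
    else if x = [E2, E4] then f [B4]
    else if x = [E4, E2] then - hq * f [B4]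
    else if x = [E3, E4] then f [B5]
    else if x = [E4, E3] then - hq * f [B5]
    else if x = [E1, E4] then f [B3]
    else if x = [E2, E3] then - (kq ^ 2) * f [B3]
    else if x = [E3, E2] then f [B3]
    else if x = [E4, E1] then - f [B3]
    else 0)"

definition splitting :: "state list \<Rightarrow> (state list \<Rightarrow> K) \<Rightarrow> K" where
  "splitting x f = (if x = [B1] then - f [E1, E2] + hq * f [E2, E1]
    else if x = [B2] then - f [E1, E3] + hq * f [E3, E1]
    else if x = [B3] then - f [E1, E4] + f [E2, E3] - hq ^ 2 * f [E3, E2] + f [E4, E1]
    else if x = [B4] then - (1 + kq ^ 2) * f [E2, E4] + (hq + kq) * f [E4, E2]
    else if x = [B5] then - (1 + kq ^ 2) * f [E3, E4] + (hq + kq) * f [E4, E3]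
    else 0)"

text \<open>\<open>rep w f x\<close> is the value at \<open>f\<close> of the image of the basis vector \<open>x\<close> under the linear map of
  \<open>w\<close>; a vector is represented by the functional it induces on coefficient functions \<open>f\<close>, so that
  no sums over basis vectors are needed. The module is the vector representation of quantum
  \<open>sp(4)\<close> on \<open>E1, \<dots>, E4\<close> and its 5-dimensional companion on \<open>B1, \<dots>, B5\<close>.\<close>

fun rep :: "web \<Rightarrow> (state list \<Rightarrow> K) \<Rightarrow> state list \<Rightarrow> K" where
  "rep (Id s) f x = f x"
| "rep (Cup S1) f x = - (kq ^ 4) * f [E1, E4] - kq ^ 2 * f [E2, E3] + f [E3, E2] + f [E4, E1]"
| "rep (Cup S2) f x = - (kq ^ 6) * f [B1, B5] + kq ^ 4 * f [B2, B4] + kq ^ 4 * f [B3, B3]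
     + kq ^ 2 * f [B4, B2] - f [B5, B1]"
| "rep (Cap a) f x = pairing x * f []"
| "rep Merge f x = merging x f"
| "rep Split f x = splitting x f"
| "rep (v \<cdot> w) f x = rep w (rep v f) x"
| "rep (v \<parallel> w) f x = rep v (\<lambda>a. rep w (\<lambda>b. f (a @ b)) (drop (arity v) x)) (take (arity v) x)"

lemma merging_linear:
  "merging x (\<lambda>y. f y + g y) = merging x f + merging x g"
  "merging x (\<lambda>y. c * f y) = c * merging x f"
  by (simp_all add: merging_def algebra_simps)

lemma splitting_linear:
  "splitting x (\<lambda>y. f y + g y) = splitting x f + splitting x g"
  "splitting x (\<lambda>y. c * f y) = c * splitting x f"
  by (simp_all add: splitting_def algebra_simps)

lemma rep_add: "rep w (\<lambda>y. f y + g y) x = rep w f x + rep w g x"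
proof (induction w arbitrary: f g x)
  case (Cup a)
  then show ?case by (cases a) (simp_all add: algebra_simps)
next
  case (Comp v w)
  have "rep v (\<lambda>y. f y + g y) = (\<lambda>y. rep v f y + rep v g y)"
    by (rule ext) (rule Comp)
  then show ?case by (simp add: Comp)
qed (simp_all add: merging_linear splitting_linear distrib_left)

lemma rep_scale: "rep w (\<lambda>y. c * f y) x = c * rep w f x"
proof (induction w arbitrary: f x)
  case (Cup a)
  then show ?case by (cases a) (simp_all add: algebra_simps)
next
  case (Comp v w)
  have "rep v (\<lambda>y. c * f y) = (\<lambda>y. c * rep v f y)"
    by (rule ext) (rule Comp)
  then show ?case by (simp add: Comp)
qed (simp_all add: merging_linear splitting_linear)

lemma rep_zero: "rep w (\<lambda>y. 0) x = 0"
  using rep_scale[of w 0 "\<lambda>y. 0" x] by simp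

lemma rep_uminus: "rep w (\<lambda>y. - f y) x = - rep w f x"
  using rep_scale[of w "- 1" f x] by simp

lemma rep_diff: "rep w (\<lambda>y. f y - g y) x = rep w f x - rep w g x"
  using rep_add[of w f "\<lambda>y. - g y" x] by (simp add: rep_uminus)

lemmas rep_linear = rep_add rep_scale rep_zero rep_uminus rep_diff

lemma merging_swap: "merging x (\<lambda>a. rep w (h a) y) = rep w (\<lambda>b. merging x (\<lambda>a. h a b)) y"
  by (simp add: merging_def rep_linear)

lemma splitting_swap: "splitting x (\<lambda>a. rep w (h a) y) = rep w (\<lambda>b. splitting x (\<lambda>a. h a b)) y"
  by (simp add: splitting_def rep_linear)

text \<open>A Fubini rule: the functionals of two juxtaposed webs may be evaluated in either order.
  The interchange move comes down to it.\<close>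

lemma rep_swap: "rep v (\<lambda>a. rep w (h a) y) x = rep w (\<lambda>b. rep v (\<lambda>a. h a b) x) y"
proof (induction v arbitrary: h x)
  case (Cup a)
  then show ?case by (cases a) (simp_all add: rep_linear)
next
  case (Comp v1 v2)
  have "rep v1 (\<lambda>a. rep w (h a) y) = (\<lambda>x. rep w (\<lambda>b. rep v1 (\<lambda>a. h a b) x) y)"
    by (rule ext) (rule Comp)
  then show ?case by (simp add: Comp)
qed (simp_all add: rep_linear merging_swap splitting_swap)

lemma arity_eq: "\<turnstile> w : s \<leadsto> t \<Longrightarrow> arity w = length s"
  by (induction rule: has_ends.induct) auto

text \<open>The typing relation as a function, which makes endpoints unique and computable by the
  simplifier; \<open>None\<close> marks ill-formed expressions.\<close>

fun ends :: "web \<Rightarrow> (strand list \<times> strand list) option" where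
  "ends (Id s) = Some (s, s)"
| "ends (Cup a) = Some ([], [a, a])"
| "ends (Cap a) = Some ([a, a], [])"
| "ends Merge = Some ([S1, S1], [S2])"
| "ends Split = Some ([S2], [S1, S1])"
| "ends (v \<cdot> w) = (case ends w of None \<Rightarrow> None | Some (s, t) \<Rightarrow>
     (case ends v of None \<Rightarrow> None | Some (t', u) \<Rightarrow> if t = t' then Some (s, u) else None))"
| "ends (v \<parallel> w) = (case ends v of None \<Rightarrow> None | Some (s, t) \<Rightarrow>
     (case ends w of None \<Rightarrow> None | Some (s', t') \<Rightarrow> Some (s @ s', t @ t')))"

lemma has_ends_iff: "\<turnstile> w : s \<leadsto> t \<longleftrightarrow> ends w = Some (s, t)"
proof
  show "\<turnstile> w : s \<leadsto> t \<Longrightarrow> ends w = Some (s, t)"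
    by (induction rule: has_ends.induct) auto
  show "ends w = Some (s, t) \<Longrightarrow> \<turnstile> w : s \<leadsto> t"
  proof (induction w arbitrary: s t)
    case (Comp v w)
    from Comp.prems obtain r where "ends w = Some (s, r)" "ends v = Some (r, t)"
      by (auto split: option.splits if_splits)
    with Comp.IH show ?case using has_ends.intros(6)[of w s r v t] by simp
  next
    case (Tensor v w)
    from Tensor.prems obtain a b c d where "ends v = Some (a, b)" "ends w = Some (c, d)"
      and "s = a @ c" "t = b @ d"
      by (auto split: option.splits)
    with Tensor.IH show ?case using has_ends.intros(7)[of v a b w c d] by simp
  qed (auto intro: has_ends.intros(1-5))
qed

lemma merging_cong: "(\<And>y. map strand_of y = [S2] \<Longrightarrow> f y = g y) \<Longrightarrow> merging x f = merging x g"
  by (simp add: merging_def)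

lemma splitting_cong: "(\<And>y. map strand_of y = [S1, S1] \<Longrightarrow> f y = g y) \<Longrightarrow> splitting x f = splitting x g"
  by (simp add: splitting_def)

text \<open>Well-typed webs take well-typed states to combinations of well-typed states. Hence
  identities that hold only on such states can be used inside larger webs.\<close>

lemma rep_cong:
  "\<turnstile> w : s \<leadsto> t \<Longrightarrow> map strand_of x = s \<Longrightarrow> (\<And>y. map strand_of y = t \<Longrightarrow> f y = g y) \<Longrightarrow> rep w f x = rep w g x"
proof (induction arbitrary: x f g rule: has_ends.induct)
  case (2 a)
  then show ?case by (cases a) simp_all
next
  case 4
  show ?case unfolding rep.simps by (rule merging_cong) (rule 4(2))
next
  case 5
  show ?case unfolding rep.simps by (rule splitting_cong) (rule 5(2))
next
  case (7 v s t w s' t')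
  have len: "arity v = length s" using 7(1) by (rule arity_eq)
  have x: "map strand_of (take (arity v) x) = s" "map strand_of (drop (arity v) x) = s'"
    using 7(5) by (simp_all add: len flip: take_map drop_map)
  have "rep w (\<lambda>b. f (a @ b)) (drop (arity v) x) = rep w (\<lambda>b. g (a @ b)) (drop (arity v) x)"
    if "map strand_of a = t" for a
    by (rule 7(4)[OF x(2)], rule 7(6)) (simp add: that)
  then show ?case
    unfolding rep.simps by (rule 7(3)[OF x(1)])
next
  case (6 w s t v u)
  show ?case
    unfolding rep.simps by (rule 6(3)[OF 6(5)], rule 6(4), assumption, rule 6(6))
next
  case (1 s)
  then show ?case by simp
next
  case (3 a)
  then show ?case by simp
qed

lemma isotopic_ends: "v \<approx> w \<Longrightarrow> ends v = ends w"
proof (induction rule: isotopic.induct)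
  case (cong_comp v v' w w')
  show ?case unfolding ends.simps cong_comp(3,4) by (rule HOL.refl)
next
  case (cong_tensor v v' w w')
  show ?case unfolding ends.simps cong_tensor(3,4) by (rule HOL.refl)
next
  case (comp_assoc u v w)
  show ?case by (simp split: option.split prod.split)
next
  case (tensor_assoc u v w)
  show ?case by (simp split: option.split prod.split)
next
  case (comp_id_left w s t)
  then show ?case unfolding has_ends_iff by simp
next
  case (comp_id_right w s t)
  then show ?case unfolding has_ends_iff by simp
next
  case (interchange w s t v u w' s' t' v' u')
  then show ?case unfolding has_ends_iff by simp
next
  case (sym v w)
  show ?case by (rule sym(2)[THEN HOL.sym])
next
  case (trans u v w)
  show ?case by (rule HOL.trans[OF trans(3,4)])
next
  case (tensor_empty_left w)
  show ?case by (simp split: option.split)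
next
  case (tensor_empty_right w)
  show ?case by (simp split: option.split)
next
  case turn_left
  show ?case by simp
next
  case turn_right
  show ?case by simp
next
  case (refl w)
  show ?case by (rule HOL.refl)
next
  case (tensor_id s t)
  show ?case by simp
next
  case (zigzag_left a)
  show ?case by simp
next
  case (zigzag_right a)
  show ?case by simp
qed

lemma rep_zigzag:
  assumes "map strand_of x = [a]"
  shows "rep ((Cap a \<parallel> Id [a]) \<cdot> (Id [a] \<parallel> Cup a)) f x = f x"
    and "rep ((Id [a] \<parallel> Cap a) \<cdot> (Cup a \<parallel> Id [a])) f x = f x"
proof -
  obtain e where x: "x = [e]" "strand_of e = a" using assms by auto
  show "rep ((Cap a \<parallel> Id [a]) \<cdot> (Id [a] \<parallel> Cup a)) f x = f x"
    using x by (cases e) (auto simp: pairing_def hq_kq eval_nat_numeral)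
  show "rep ((Id [a] \<parallel> Cap a) \<cdot> (Cup a \<parallel> Id [a])) f x = f x"
    using x by (cases e) (auto simp: pairing_def hq_kq eval_nat_numeral)
qed

lemma rep_turn:
  assumes "map strand_of x = [S2]"
  shows "rep ((Cap S2 \<parallel> Id [S1, S1]) \<cdot> (Id [S2] \<parallel> Merge \<parallel> Id [S1, S1])
      \<cdot> (Id [S2] \<parallel> ((Id [S1] \<parallel> Cup S1 \<parallel> Id [S1]) \<cdot> Cup S1))) f x = rep Split f x"
    and "rep ((Id [S1, S1] \<parallel> Cap S2) \<cdot> (Id [S1, S1] \<parallel> Merge \<parallel> Id [S2])
      \<cdot> (((Id [S1] \<parallel> Cup S1 \<parallel> Id [S1]) \<cdot> Cup S1) \<parallel> Id [S2])) f x = rep Split f x"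
proof -
  obtain e where x: "x = [e]" "strand_of e = S2" using assms by auto
  show "rep ((Cap S2 \<parallel> Id [S1, S1]) \<cdot> (Id [S2] \<parallel> Merge \<parallel> Id [S1, S1])
      \<cdot> (Id [S2] \<parallel> ((Id [S1] \<parallel> Cup S1 \<parallel> Id [S1]) \<cdot> Cup S1))) f x = rep Split f x"
    using x by (cases e) (auto simp: pairing_def merging_def splitting_def hq_kq eval_nat_numeral algebra_simps)
  show "rep ((Id [S1, S1] \<parallel> Cap S2) \<cdot> (Id [S1, S1] \<parallel> Merge \<parallel> Id [S2])
      \<cdot> (((Id [S1] \<parallel> Cup S1 \<parallel> Id [S1]) \<cdot> Cup S1) \<parallel> Id [S2])) f x = rep Split f x"
    using x by (cases e) (auto simp: pairing_def merging_def splitting_def hq_kq eval_nat_numeral algebra_simps)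
qed

text \<open>Inputs have to match the type \<open>s\<close> because \<open>rep (Id s)\<close> does
  not inspect its input, whereas a zigzag sends a single state of the other type to zero.\<close>

lemma rep_isotopic:
  "v \<approx> w \<Longrightarrow> ends v = Some (s, t) \<Longrightarrow> map strand_of x = s \<Longrightarrow> rep v f x = rep w f x"
proof (induction arbitrary: s t f x rule: isotopic.induct)
  case (refl w)
  show ?case by (rule HOL.refl)
next
  case (sym v w)
  then show ?case using isotopic_ends[OF sym(1)] by simp
next
  case (trans u v w)
  then show ?case using isotopic_ends[OF trans(1)] by simp
next
  case (cong_comp v v' w w')
  then obtain r where r: "ends w = Some (s, r)" "ends v = Some (r, t)"
    by (auto split: option.splits if_splits)
  have "rep w (rep v f) x = rep w (rep v' f) x"
    by (rule rep_cong[OF r(1)[folded has_ends_iff] cong_comp(6)]) (rule cong_comp(3)[OF r(2)])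
  then show ?case
    using cong_comp(4)[OF r(1) cong_comp(6)] by simp
next
  case (cong_tensor v v' w w')
  then obtain a b c d where r: "ends v = Some (a, b)" "ends w = Some (c, d)" "s = a @ c"
    by (auto split: option.splits)
  have ar: "arity v = length a" "arity v' = length a"
    using arity_eq[of v a b] arity_eq[of v' a b] r isotopic_ends[OF cong_tensor(1)]
    by (simp_all add: has_ends_iff)
  have x: "map strand_of (take (length a) x) = a" "map strand_of (drop (length a) x) = c"
    using cong_tensor(6) r(3) by (simp_all flip: take_map drop_map)
  show ?case
    unfolding rep.simps ar cong_tensor(3)[OF r(1) x(1)] cong_tensor(4)[OF r(2) x(2)] ..
next
  case (comp_id_left w s' t')
  have "rep (Id t') f = f" by (rule ext) simp
  then show ?case by simp
next
  case (comp_assoc u v w)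
  have "rep (u \<cdot> v) f = rep v (rep u f)" by (rule ext) simp
  then show ?case by simp
next
  case (tensor_assoc u v w)
  show ?case
    by (simp add: min_def take_drop add.commute)
next
  case (tensor_empty_right w)
  then have "ends w = Some (s, t)" by (auto split: option.splits)
  then have "arity w = length x"
    using tensor_empty_right(2) arity_eq[of w s t] by (auto simp: has_ends_iff)
  then show ?case by simp
next
  case (interchange w a b v c w' a' b' v' c')
  note ar = interchange(1-4)[THEN arity_eq]
  have "s = a @ a'"
    using interchange by (simp add: has_ends_iff)
  then have x: "map strand_of (take (length a) x) = a" "map strand_of (drop (length a) x) = a'"
    using interchange(6) by (simp_all flip: take_map drop_map)
  have "rep w (\<lambda>p. rep w' (\<lambda>r. rep v (\<lambda>e. rep v' (\<lambda>d. f (e @ d)) (drop (length b) (p @ r))) (take (length b) (p @ r))) (drop (length a) x)) (take (length a) x)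
    = rep w (\<lambda>p. rep w' (\<lambda>r. rep v (\<lambda>e. rep v' (\<lambda>d. f (e @ d)) r) p) (drop (length a) x)) (take (length a) x)"
  proof (rule rep_cong[OF interchange(1) x(1)])
    fix p assume "map strand_of p = b"
    then have "length p = length b" by auto
    then show "rep w' (\<lambda>r. rep v (\<lambda>e. rep v' (\<lambda>d. f (e @ d)) (drop (length b) (p @ r))) (take (length b) (p @ r))) (drop (length a) x)
       = rep w' (\<lambda>r. rep v (\<lambda>e. rep v' (\<lambda>d. f (e @ d)) r) p) (drop (length a) x)"
      by simp
  qed
  also have "\<dots> = rep w (\<lambda>p. rep v (\<lambda>e. rep w' (\<lambda>r. rep v' (\<lambda>d. f (e @ d)) r) (drop (length a) x)) p) (take (length a) x)"
    by (simp only: rep_swap[of w' v])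
  finally show ?case by (simp add: ar)
next
  case (zigzag_left a)
  then show ?case using rep_zigzag(1)[of x a f] by simp
next
  case (zigzag_right a)
  then show ?case using rep_zigzag(2)[of x a f] by simp
next
  case turn_left
  then show ?case by (intro rep_turn(1)) simp
next
  case turn_right
  then show ?case by (intro rep_turn(2)) simp
qed simp_all

section \<open>Linear functionals on combinations of webs and their descent to the quotient\<close>

definition lin :: "(web \<Rightarrow> K) \<Rightarrow> lweb \<Rightarrow> K" where
  "lin h r = (\<Sum>w\<in>Poly_Mapping.keys r. Poly_Mapping.lookup r w * h w)"

lemma lin_superset:
  assumes "finite A" "Poly_Mapping.keys r \<subseteq> A"
  shows "lin h r = (\<Sum>w\<in>A. Poly_Mapping.lookup r w * h w)"
  unfolding lin_def by (rule sum.mono_neutral_left) (use assms in \<open>auto simp: in_keys_iff\<close>)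

lemma lin_add: "lin h (x + y) = lin h x + lin h y"
proof -
  define A where "A = Poly_Mapping.keys x \<union> Poly_Mapping.keys y"
  have A: "finite A" "Poly_Mapping.keys x \<subseteq> A" "Poly_Mapping.keys y \<subseteq> A" "Poly_Mapping.keys (x + y) \<subseteq> A"
    using Poly_Mapping.keys_add[of x y] by (auto simp: A_def)
  show ?thesis
    unfolding lin_superset[OF A(1,2)] lin_superset[OF A(1,3)] lin_superset[OF A(1,4)]
    by (simp add: lookup_add distrib_right sum.distrib)
qed

lemma lin_zero [simp]: "lin h 0 = 0"
  by (simp add: lin_def)

lemma lin_single [simp]: "lin h (Poly_Mapping.single w c) = c * h w"
  by (simp add: lin_def)

lemma lin_scale: "lin h (lscale c x) = c * lin h x"
  unfolding lin_superset[OF finite_keys keys_lscale_subset]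
  by (simp add: lin_def sum_distrib_left mult.assoc)

lemma lin_uminus: "lin h (- x) = - lin h x"
  using lin_scale[of h "- 1" x] by (simp add: lscale_minus_one)

lemma lin_diff: "lin h (x - y) = lin h x - lin h y"
  using lin_add[of h x "- y"] by (simp add: lin_uminus)

lemma lin_sum: "lin h (sum g A) = (\<Sum>a\<in>A. lin h (g a))"
  by (induction A rule: infinite_finite_induct) (auto simp: lin_add)

lemma lin_bilinear_ext:
  "lin h (bilinear_ext f x y) = (\<Sum>a\<in>Poly_Mapping.keys x. Poly_Mapping.lookup x a * lin (\<lambda>b. h (f a b)) y)"
  unfolding bilinear_ext_def lin_sum lin_single by (simp add: lin_def sum_distrib_left mult.assoc)

lemma lin_bilinear_ext':
  "lin h (bilinear_ext f x y) = (\<Sum>b\<in>Poly_Mapping.keys y. Poly_Mapping.lookup y b * lin (\<lambda>a. h (f a b)) x)"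
  unfolding bilinear_ext_def lin_sum lin_single
  by (subst sum.swap) (simp add: lin_def sum_distrib_left mult_ac)

text \<open>Webs with other ends go to 0: ill-formed expressions are null, and so the functional has
  to vanish on them.\<close>

definition ev :: "strand list \<Rightarrow> strand list \<Rightarrow> (state list \<Rightarrow> K) \<Rightarrow> state list \<Rightarrow> web \<Rightarrow> K" where
  "ev s t f x w = (if ends w = Some (s, t) then rep w f x else 0)"

lemma lin_const_zero [simp]: "lin (\<lambda>w. 0) r = 0"
  by (simp add: lin_def)

lemma rep_lin: "rep w (\<lambda>y. lin (h y) r) x = lin (\<lambda>u. rep w (\<lambda>y. h y u) x) r"
proof -
  have "rep w (\<lambda>y. \<Sum>u\<in>A. c u * h y u) x = (\<Sum>u\<in>A. c u * rep w (\<lambda>y. h y u) x)" for A c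
    by (induction A rule: infinite_finite_induct) (simp_all add: rep_linear)
  then show ?thesis by (simp add: lin_def)
qed


lemma qnum_5: "[5]\<^sub>q = hq ^ 4 + hq\<^sup>2 + 1 + kq\<^sup>2 + kq ^ 4"
proof -
  have "[5]\<^sub>q = (hq ^ 5 - kq ^ 5) / (hq - kq)"
    by (simp add: qnum_def hq_def kq_def power_int_minus power_inverse)
  moreover have "hq - kq \<noteq> 0"
    using qhalf_diff_nonzero by (simp add: hq_def kq_def)
  moreover have "hq ^ 5 - kq ^ 5 = (hq ^ 4 + hq\<^sup>2 + 1 + kq\<^sup>2 + kq ^ 4) * (hq - kq)"
    using hq_kq(1) by algebra
  ultimately show ?thesis by simp
qed

lemma gq_3: "gq 3 = hq ^ 3 + kq ^ 3"
  by (simp add: gq_def hq_def kq_def power_int_minus power_inverse)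

lemma qnum_2': "[2]\<^sub>q = hq + kq"
  by (simp add: qnum_2 hq_def kq_def)

lemma loop_values:
  "[6]\<^sub>q * [2]\<^sub>q / [3]\<^sub>q = hq ^ 4 + hq\<^sup>2 + kq\<^sup>2 + kq ^ 4"
  "[6]\<^sub>q * [5]\<^sub>q / ([3]\<^sub>q * [2]\<^sub>q) = hq ^ 6 + hq\<^sup>2 + 1 + kq\<^sup>2 + kq ^ 6"
proof -
  have 6: "[6]\<^sub>q = gq 3 * [3]\<^sub>q" using qnum_double[of 3] by simp
  have nz: "[3]\<^sub>q \<noteq> 0" "[2]\<^sub>q \<noteq> 0" by (simp_all add: qnum_nonzero)
  have "[6]\<^sub>q * [2]\<^sub>q / [3]\<^sub>q = gq 3 * [2]\<^sub>q" using nz by (simp add: 6)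
  also have "\<dots> = hq ^ 4 + hq\<^sup>2 + kq\<^sup>2 + kq ^ 4"
    unfolding gq_3 qnum_2' using hq_kq(1) by algebra
  finally show "[6]\<^sub>q * [2]\<^sub>q / [3]\<^sub>q = hq ^ 4 + hq\<^sup>2 + kq\<^sup>2 + kq ^ 4" .
  have "gq 3 * [5]\<^sub>q = (hq ^ 6 + hq\<^sup>2 + 1 + kq\<^sup>2 + kq ^ 6) * [2]\<^sub>q"
    unfolding gq_3 qnum_2' qnum_5 using hq_kq(1) by algebra
  then show "[6]\<^sub>q * [5]\<^sub>q / ([3]\<^sub>q * [2]\<^sub>q) = hq ^ 6 + hq\<^sup>2 + 1 + kq\<^sup>2 + kq ^ 6"
    using nz by (simp add: 6 field_simps)
qed

lemma S1_cases: "strand_of e = S1 \<Longrightarrow> e \<in> {E1, E2, E3, E4}"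
  and S2_cases: "strand_of e = S2 \<Longrightarrow> e \<in> {B1, B2, B3, B4, B5}"
  by (cases e; simp)+

lemmas rep_simps = pairing_def merging_def splitting_def hq_kq eval_nat_numeral algebra_simps

lemma rep_bigon:
  assumes "map strand_of x = [S2]"
  shows "rep (Merge \<cdot> Split) f x = - ([2]\<^sub>q\<^sup>2) * f x"
proof -
  obtain e where x: "x = [e]" "strand_of e = S2" using assms by auto
  show ?thesis
    using S2_cases[OF x(2)] unfolding x(1) qnum_2' by (elim insertE emptyE) (simp_all add: rep_simps)
qed

lemma rep_triangle:
  assumes "map strand_of x = [S2, S2]"
  shows "rep (Merge \<cdot> (Id [S1] \<parallel> Cap S1 \<parallel> Id [S1]) \<cdot> (Split \<parallel> Split)) f x = 0"
proof -
  obtain e e' where x: "x = [e, e']" "strand_of e = S2" "strand_of e' = S2" using assms by auto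
  show ?thesis
    using S2_cases[OF x(2)] S2_cases[OF x(3)] unfolding x(1)
    by (elim insertE emptyE) (simp_all add: rep_simps)
qed

lemma rep_square:
  assumes "map strand_of x = [S1, S1]"
  shows "rep I_web f x - rep J_web f x = rep U_web f x - rep V_web f x"
proof -
  obtain e e' where x: "x = [e, e']" "strand_of e = S1" "strand_of e' = S1" using assms by auto
  show ?thesis
    using S1_cases[OF x(2)] S1_cases[OF x(3)] unfolding x(1) I_web_def J_web_def U_web_def V_web_def
    by (elim insertE emptyE) (simp_all add: rep_simps)
qed

lemma local_rel_ev:
  assumes "r \<in> local_rel" "map strand_of x = s"
  shows "lin (ev s t f x) r = 0"
  using assms(1)
proof cases
  case loop1
  show ?thesis
    unfolding loop1 lin_diff lin_scale lin_single loop_values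
    using assms(2) by (auto simp: ev_def rep_simps)
next
  case loop2
  show ?thesis
    unfolding loop2 lin_diff lin_scale lin_single loop_values
    using assms(2) by (auto simp: ev_def rep_simps)
next
  case monogon
  then show ?thesis
    using assms(2) by (auto simp: ev_def rep_simps)
next
  case bigon
  then show ?thesis
    using assms(2) rep_bigon[of x f] by (auto simp: lin_diff lin_scale ev_def)
next
  case triangle
  then show ?thesis
    using assms(2) rep_triangle[of x f] by (auto simp: ev_def)
next
  case square
  have "ends I_web = Some ([S1, S1], [S1, S1])" "ends J_web = Some ([S1, S1], [S1, S1])"
    "ends U_web = Some ([S1, S1], [S1, S1])" "ends V_web = Some ([S1, S1], [S1, S1])"
    by (simp_all add: I_web_def J_web_def U_web_def V_web_def)
  then show ?thesis
    using square assms(2) rep_square[of x f] by (auto simp: lin_diff ev_def)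
qed


text \<open>The claim is general in \<open>f\<close>, \<open>x\<close> and the words because a
  surrounding web is absorbed into them: a web on top changes \<open>f\<close>, a web below leads to
  other states \<open>x\<close>, and a neighbour splits the state and fixes part of the argument of
  \<open>f\<close>.\<close>

lemma null_ev: "r \<in> null \<Longrightarrow> map strand_of x = s \<Longrightarrow> lin (ev s t f x) r = 0"
proof (induction arbitrary: s t f x rule: null.induct)
  case (add x y)
  then show ?case by (simp add: lin_add)
next
  case (scale x c)
  then show ?case by (simp add: lin_scale)
next
  case (ill_formed w)
  then show ?case by (simp add: ev_def has_ends_iff)
next
  case (isotopy v w)
  then show ?case
    using isotopic_ends[OF isotopy(1)] rep_isotopic[OF isotopy(1)] by (simp add: ev_def lin_diff)
next
  case (local r)
  then show ?case by (rule local_rel_ev)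
next
  case (below r y)
  have "lin (\<lambda>b. ev s t f x (a \<cdot> b)) r = 0" for a
  proof (cases "\<exists>p. ends a = Some (p, t)")
    case True
    then obtain p where p: "ends a = Some (p, t)" by blast
    have "(\<lambda>b. ev s t f x (a \<cdot> b)) = ev s p (rep a f) x"
      by (rule ext) (auto simp: ev_def p split: option.splits)
    then show ?thesis using below by simp
  next
    case False
    then have "(\<lambda>b. ev s t f x (a \<cdot> b)) = (\<lambda>b. 0)"
      by (intro ext) (auto simp: ev_def split: option.splits if_splits)
    then show ?thesis by simp
  qed
  then show ?case by (simp add: lin_bilinear_ext)
next
  case (above r y)
  have "lin (\<lambda>a. ev s t f x (a \<cdot> b)) r = 0" for b
  proof (cases "\<exists>p. ends b = Some (s, p)")
    case True
    then obtain p where p: "ends b = Some (s, p)" by blast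
    have "(\<lambda>a. ev s t f x (a \<cdot> b)) = (\<lambda>a. rep b (\<lambda>y. ev p t f y a) x)"
      by (rule ext) (auto simp: ev_def p rep_zero split: option.splits)
    then have "lin (\<lambda>a. ev s t f x (a \<cdot> b)) r = rep b (\<lambda>y. lin (ev p t f y) r) x"
      by (simp add: rep_lin)
    also have "\<dots> = rep b (\<lambda>y. 0) x"
      by (rule rep_cong[OF p[folded has_ends_iff] above(3)]) (rule above(2))
    finally show ?thesis by (simp add: rep_zero)
  next
    case False
    then have "(\<lambda>a. ev s t f x (a \<cdot> b)) = (\<lambda>b. 0)"
      by (intro ext) (auto simp: ev_def split: option.splits if_splits)
    then show ?thesis by simp
  qed
  then show ?case by (simp add: lin_bilinear_ext')
next
  case (right r y)
  have "lin (\<lambda>b. ev s t f x (a \<parallel> b)) r = 0" for a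
  proof (cases "\<exists>p u c d. ends a = Some (p, u) \<and> s = p @ c \<and> t = u @ d")
    case True
    then obtain p u c d where p: "ends a = Some (p, u)" "s = p @ c" "t = u @ d" by blast
    have ar: "arity a = length p" using p(1) by (simp add: arity_eq has_ends_iff[symmetric])
    have x: "map strand_of (drop (length p) x) = c"
      using right(3) p(2) by (simp flip: drop_map)
    have "(\<lambda>b. ev s t f x (a \<parallel> b))
        = (\<lambda>b. rep a (\<lambda>y. ev c d (\<lambda>z. f (y @ z)) (drop (length p) x) b) (take (length p) x))"
      by (rule ext) (auto simp: ev_def p ar rep_zero split: option.splits)
    then have "lin (\<lambda>b. ev s t f x (a \<parallel> b)) r
        = rep a (\<lambda>y. lin (ev c d (\<lambda>z. f (y @ z)) (drop (length p) x)) r) (take (length p) x)"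
      by (simp add: rep_lin)
    then show ?thesis using right(2)[OF x] by (simp add: rep_zero)
  next
    case False
    then have "(\<lambda>b. ev s t f x (a \<parallel> b)) = (\<lambda>b. 0)"
      by (intro ext) (auto simp: ev_def split: option.splits if_splits)
    then show ?thesis by simp
  qed
  then show ?case by (simp add: lin_bilinear_ext)
next
  case (left r y)
  have "lin (\<lambda>a. ev s t f x (a \<parallel> b)) r = 0" for b
  proof (cases "\<exists>p u c d. ends b = Some (c, d) \<and> s = p @ c \<and> t = u @ d")
    case True
    then obtain p u c d where p: "ends b = Some (c, d)" "s = p @ c" "t = u @ d" by blast
    have ar: "arity a = length p" if "ends a = Some (p, u)" for a
      using that by (simp add: arity_eq has_ends_iff[symmetric])
    have x: "map strand_of (take (length p) x) = p"
      using left(3) p(2) by (simp flip: take_map)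
    have "(\<lambda>a. ev s t f x (a \<parallel> b))
        = ev p u (\<lambda>y. rep b (\<lambda>z. f (y @ z)) (drop (length p) x)) (take (length p) x)"
      by (rule ext) (auto simp: ev_def p ar split: option.splits)
    then show ?thesis using left(2)[OF x] by simp
  next
    case False
    then have "(\<lambda>a. ev s t f x (a \<parallel> b)) = (\<lambda>b. 0)"
      by (intro ext) (auto simp: ev_def split: option.splits if_splits)
    then show ?thesis by simp
  qed
  then show ?case by (simp add: lin_bilinear_ext')
qed simp



lift_definition coef :: "nat \<Rightarrow> skein \<Rightarrow> K" is
  "\<lambda>n r. lin (ev (replicate n S1) (replicate n S1) (\<lambda>y. if y = replicate n E1 then 1 else 0) (replicate n E1)) r"
proof -
  fix n x y assume "skein_eq x y"
  then show "lin (ev (replicate n S1) (replicate n S1) (\<lambda>y. if y = replicate n E1 then 1 else 0) (replicate n E1)) x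
      = lin (ev (replicate n S1) (replicate n S1) (\<lambda>y. if y = replicate n E1 then 1 else 0) (replicate n E1)) y"
    using null_ev[of "x - y" "replicate n E1" "replicate n S1"] by (simp add: skein_eq_def lin_diff)
qed

lemma coef_add: "coef n (x + y) = coef n x + coef n y"
  by transfer (simp add: lin_add)

lemma coef_zero [simp]: "coef n 0 = 0"
  by transfer simp

lemma coef_scale: "coef n (c *\<^sub>K x) = c * coef n x"
  by transfer (simp add: lin_scale)

lemma coef_web: "coef n (web_class w) = ev (replicate n S1) (replicate n S1) (\<lambda>y. if y = replicate n E1 then 1 else 0) (replicate n E1) w"
  by transfer simp

lemma coef_sid: "coef n (sid n) = 1"
  by (simp add: sid_def coef_web ev_def)

text \<open>Two adjacent \<open>E1\<close> have the total weight \<open>2 e1\<close>, which occurs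
  neither in the module on \<open>B1\<close> to \<open>B5\<close> nor in the trivial one, so a merge
  or a cap vanishes on them.\<close>

lemma coef_lower:
  assumes "y = Merge \<or> y = Cap S1" "n = l + 2 + r"
  shows "coef n (a * (sid l \<otimes> web_class y \<otimes> sid r)) = 0"
proof (induction a rule: skein_induct)
  case (add a c w)
  have E: "replicate n E1 = replicate l E1 @ E1 # E1 # replicate r E1"
    unfolding assms(2) replicate_add by (simp add: numeral_2_eq_2)
  have "rep (Id (replicate l S1) \<parallel> y \<parallel> Id (replicate r S1)) f (replicate n E1) = 0" for f
    using assms(1) unfolding E by (auto simp: pairing_def merging_def)
  then have "coef n (web_class w * (sid l \<otimes> web_class y \<otimes> sid r)) = 0"
    by (simp add: sid_def web_class_tensor web_class_times coef_web ev_def)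
  then show ?case
    using add by (simp add: distrib_right coef_add coef_scale)
qed simp

lemma coef_rad: "x \<in> rad n \<Longrightarrow> coef n x = 0"
proof (induction rule: rad.induct)
  case (gen a y l r)
  have cap: "coef n (b * place l cap r) = 0" "coef n (b * place l mrg r) = 0" for b
    using coef_lower[OF _ gen(3), of _ b] by (auto simp: cap_def mrg_def)
  have U: "coef n (a * place l U r) = 0"
    unfolding U_def place_times[OF Hom_gen(1,2)] mult.assoc[symmetric] by (rule cap)
  have I: "coef n (a * place l (spl * mrg) r) = 0"
    unfolding place_times[OF Hom_gen(6,5)] mult.assoc[symmetric] by (rule cap)
  then have "coef n (a * place l X r) = 0"
    using U by (simp add: place_spl_mrg distrib_left coef_add)
  then show ?case using U gen(2) by auto
qed (simp_all add: coef_add)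

lemma projector_nonzero: "projector n \<noteq> 0"
proof
  assume "projector n = 0"
  then have "coef n (- 1 *\<^sub>K sid n) = 0"
    using projector_rad[of n] coef_rad[of "projector n - sid n" n] by simp
  then show False
    by (simp only: coef_scale coef_sid) simp
qed

section \<open>Uniqueness of the clasp\<close>

text \<open>The first linear form is \<open>wlen\<close> and need not drop, since replacing two
  letters 1 by one letter 2 preserves it. The second form drops in every step, which excludes the
  word itself.\<close>

lemma weight_less_levels:
  "\<mu> \<prec> \<nu> \<Longrightarrow> fst \<mu> + 2 * snd \<mu> \<le> fst \<nu> + 2 * snd \<nu> \<and> 2 * fst \<mu> + 3 * snd \<mu> < 2 * fst \<nu> + 3 * snd \<nu>"
  by (induction rule: weight_less.induct) auto

lemma wlen_weight: "int (wlen s) = fst (weight s) + 2 * snd (weight s)"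
  by (induction s rule: wlen.induct) (auto simp: weight_def)

lemma weight_append: "weight (s @ t) = (fst (weight s) + fst (weight t), snd (weight s) + snd (weight t))"
  by (simp add: weight_def)

lemma weight_replicate [simp]: "weight (replicate n S1) = (int n, 0)"
  by (induction n) (auto simp: weight_def)

lemma lower_word:
  assumes "weight t \<prec> weight (replicate n S1)"
  shows "wlen t \<le> n" "t \<noteq> replicate n S1"
  using weight_less_levels[OF assms] wlen_weight[of t] by auto

text \<open>The chain is \<open>(n, 0)\<close>, \<open>(n - 2, 1)\<close>, \<open>(n, - 1)\<close>,
  \<open>(n - 2, 0)\<close>; its third member is not dominant.\<close>

lemma weight_cap: "n = l + 2 + r \<Longrightarrow> weight (replicate (l + r) S1) \<prec> weight (replicate n S1)"
proof -
  assume n: "n = l + 2 + r"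
  have a: "(int n - 2, 1) \<prec> (int n, 0)"
    using weight_less.intros(1)[of "int n" 0] by simp
  have b: "(int n, - 1) \<prec> (int n - 2, 1)"
    using weight_less.intros(2)[of "int n - 2" 1] by simp
  have c: "(int n - 2, 0) \<prec> (int n, - 1)"
    using weight_less.intros(1)[of "int n" "- 1"] by simp
  have "int (l + r) = int n - 2" using n by simp
  then show ?thesis
    unfolding weight_replicate
    using weight_less.intros(3)[OF weight_less.intros(3)[OF c b] a] by (simp only:)
qed

lemma weight_mrg: "n = l + 2 + r \<Longrightarrow> weight (replicate l S1 @ S2 # replicate r S1) \<prec> weight (replicate n S1)"
proof -
  assume n: "n = l + 2 + r"
  have "weight (S2 # replicate r S1) = (int r, 1)"
    using weight_replicate[of r] by (simp add: weight_def)
  then have "weight (replicate l S1 @ S2 # replicate r S1) = (int n - 2, 0 + 1)"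
    using n by (simp add: weight_append)
  then show ?thesis
    unfolding weight_replicate using weight_less.intros(1)[of "int n" 0] by (simp only:)
qed

lemma is_clasp_cl: "is_clasp (replicate n S1) (projector n)"
  unfolding is_clasp_def comp_eq_times
  using projector_H[of n] projector_nonzero projector_idem projector_ann[of n] lower_word
    annl_lower[of _ n _ "projector n"] annr_lower[of _ _ n "projector n"] unfolding H_def by blast

text \<open>\<open>U\<close> factors through the word with two letters removed and
  \<open>spl * mrg\<close> through the word with a letter 2 in their place. Both words have lower
  weight, and \<open>X\<close> is the difference of the two webs.\<close>

lemma clasp_annihilates:
  assumes "is_clasp (replicate n S1) Q"
  shows "annl n Q" "annr n Q"
proof -
  have Q: "Q \<in> H n n" using assms by (simp add: is_clasp_def H_def)
  have ann: "w * Q = 0" "Q * w' = 0"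
    if "weight t \<prec> weight (replicate n S1)" "w \<in> Hom (replicate n S1) t" "w' \<in> Hom t (replicate n S1)" for t w w'
    using assms that by (simp_all add: is_clasp_def comp_eq_times)
  have "place l y r * Q = 0 \<and> Q * place l y r = 0" if y: "y \<in> {X, U}" and n: "n = l + 2 + r" for y l r
  proof -
    have rep: "replicate l S1 @ S1 # S1 # replicate r S1 = replicate n S1"
      unfolding n replicate_add by (simp add: numeral_2_eq_2)
    have cap: "place l cap r \<in> Hom (replicate n S1) (replicate (l + r) S1)"
      "place l cup r \<in> Hom (replicate (l + r) S1) (replicate n S1)"
      unfolding sid_def using rep
      by (auto intro!: Hom_tensorI[OF Hom_ident Hom_tensor[OF Hom_gen(2) Hom_ident]]
          Hom_tensorI[OF Hom_ident Hom_tensor[OF Hom_gen(1) Hom_ident]] simp: replicate_add)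
    have mrg: "place l mrg r \<in> Hom (replicate n S1) (replicate l S1 @ S2 # replicate r S1)"
      "place l spl r \<in> Hom (replicate l S1 @ S2 # replicate r S1) (replicate n S1)"
      unfolding sid_def using rep
      by (auto intro!: Hom_tensorI[OF Hom_ident Hom_tensor[OF Hom_gen(5) Hom_ident]]
          Hom_tensorI[OF Hom_ident Hom_tensor[OF Hom_gen(6) Hom_ident]])
    have U: "place l U r * Q = 0" "Q * place l U r = 0"
      using ann[OF weight_cap[OF n] cap]
      unfolding U_def place_times[OF Hom_gen(1,2)] by (simp_all add: mult.assoc) (simp flip: mult.assoc)
    have I: "place l (spl * mrg) r * Q = 0" "Q * place l (spl * mrg) r = 0"
      using ann[OF weight_mrg[OF n] mrg]
      unfolding place_times[OF Hom_gen(6,5)] by (simp_all add: mult.assoc) (simp flip: mult.assoc)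
    have "place l X r = place l (spl * mrg) r - place l U r"
      by (simp add: place_spl_mrg)
    then show ?thesis
      using U I y by (auto simp: left_diff_distrib right_diff_distrib)
  qed
  then show "annl n Q" "annr n Q"
    using Q by (auto simp: annl_def annr_def)
qed

text \<open>\<open>Q * projector n\<close> is evaluated twice: \<open>Q\<close>, being in the
  algebra, acts on the projector by a scalar, and \<open>Q\<close> absorbs the projector.
  Idempotence of \<open>Q\<close> makes the scalar 1.\<close>

lemma clasp_unique:
  assumes "is_clasp (replicate n S1) Q"
  shows "Q = projector n"
proof -
  have Q: "Q \<in> alg n" "Q \<noteq> 0" "Q * Q = Q"
    using assms by (auto simp: is_clasp_def comp_eq_times H_def intro: H_subset_alg)
  obtain c where c: "Q * projector n = c *\<^sub>K projector n"
    using alg_annl[OF Q(1)] projector_ann by blast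
  have Qc: "Q = c *\<^sub>K projector n"
    using projector_absorb_right[OF clasp_annihilates(2)[OF assms]] c by simp
  have "c *\<^sub>K Q = Q"
    using Q(3) by (metis Qc c scale_times(2))
  then have "c = 1"
    using Q(2) by (metis skein.scale_cancel_right skein.scale_one)
  then show ?thesis using Qc by simp
qed

lemma f_clasp_eq: "f_clasp n = projector n"
  unfolding f_clasp_def clasp_def using is_clasp_cl clasp_unique by (rule the_equality)

section \<open>Expanding the recursion\<close>

declare projector.simps(2) [simp del]

lemma rad_tensor_sids: "x \<in> rad n \<Longrightarrow> m = n + k \<Longrightarrow> x \<otimes> sid k \<in> rad m"
proof (induction k arbitrary: m)
  case (Suc k)
  have "(x \<otimes> sid k) \<otimes> sid 1 \<in> rad (Suc (n + k))"
    by (rule rad_tensor_sid) (simp add: Suc)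
  then show ?case using Suc.prems by (simp add: tensor_assoc)
qed simp

definition base :: "nat \<Rightarrow> skein" where "base n = projector (n - 1) \<otimes> sid 1"

lemma base_H: "n \<ge> 1 \<Longrightarrow> base n \<in> H n n"
  unfolding base_def by (rule H_tensor[OF projector_H H_sid]) auto

lemma base_kill:
  assumes "y \<in> {X, U}" "n = l + 2 + r" "r \<ge> 1"
  shows "place l y r * base n = 0"
proof -
  obtain r' where r: "r = Suc r'" using assms(3) by (cases r) auto
  have "place l y r * base n = (place l y r' * projector (n - 1)) \<otimes> sid 1"
    unfolding base_def by (subst tensor_sid_times[OF H_place projector_H]) (use assms r in \<open>auto simp: tensor_assoc\<close>)
  then show ?thesis
    using annlD[of "n - 1" "projector (n - 1)" y l r'] projector_ann assms r by simp
qed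

text \<open>Within the first \<open>n - 1\<close> strands the smaller projector is the identity
  modulo words that \<open>projector (n - 1)\<close> kills.\<close>

lemma base_absorb:
  assumes "1 \<le> j" "j \<le> n"
  shows "(projector (n - j) \<otimes> sid j) * base n = base n"
proof -
  obtain k where k: "j = Suc k" using assms by (cases j) auto
  have "(projector (n - j) - sid (n - j)) \<otimes> sid k \<in> rad (n - 1)"
    by (rule rad_tensor_sids[of _ "n - j"]) (use projector_rad assms k in auto)
  then have "((projector (n - j) - sid (n - j)) \<otimes> sid k) * projector (n - 1) = 0"
    using projector_ann by (intro rad_annl) auto
  moreover have "(projector (n - j) - sid (n - j)) \<otimes> sid k = projector (n - j) \<otimes> sid k - sid (n - 1)"
    using assms k by (simp add: tensor_diff_left)
  ultimately have *: "(projector (n - j) \<otimes> sid k) * projector (n - 1) = projector (n - 1)"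
    using projector_H[of "n - 1"] by (simp add: left_diff_distrib)
  have "projector (n - j) \<otimes> sid k \<in> H (n - 1) (n - 1)"
    by (rule H_tensor[OF projector_H H_sid]) (use assms k in auto)
  then have "(projector (n - j) \<otimes> sid j) * base n = ((projector (n - j) \<otimes> sid k) * projector (n - 1)) \<otimes> sid 1"
    unfolding base_def by (subst tensor_sid_times[OF _ projector_H]) (auto simp: tensor_assoc k)
  then show ?thesis unfolding * by (simp add: base_def)
qed

lemma D_first: "D_web n 0 1 = base n"
  by (simp add: D_web_def base_def f_clasp_eq one_eq_sid)

lemma D_cup:
  "1 \<le> i \<Longrightarrow> D_web n i (Suc i) = place (n - 1 - i) cup (i - 1) * (sid (n - 2) \<otimes> cap) * base n"
  by (simp add: D_web_def base_def f_clasp_eq comp_eq_times mult.assoc cup_def cap_def sid_def)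

lemma D_cross:
  assumes "i < j"
  shows "D_web n i (Suc j) = place (n - Suc j) X (j - 1) * D_web n i j"
proof -
  obtain k where j: "j = Suc (i + k)" using assms less_iff_Suc_add by auto
  have "Suc j - i - 1 = Suc k" "j - i - 1 = k" using j by auto
  then show ?thesis
    unfolding D_web_def by (simp add: comp_eq_times X_def sid_def j)
qed

text \<open>\<open>U\<close> on the next pair moves the cup one place to the left by a zigzag. For
  \<open>j = 1\<close> it creates the cup, along with the cap from the bottom point 0 to the
  clasp.\<close>

lemma D_next:
  assumes "1 \<le> j" "j < n"
  shows "D_web n j (Suc j) = place (n - Suc j) U (j - 1) * D_web n (j - 1) j"
proof (cases "j = 1")
  case True
  have "place (n - 2) U 0 = place (n - 2) cup 0 * place (n - 2) cap 0"
    unfolding U_def by (rule place_times[OF Hom_gen(1,2)])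
  then show ?thesis
    using True D_cup[of 1 n] D_first[of n] by (simp add: numeral_2_eq_2)
next
  case False
  then obtain k where j: "j = Suc (Suc k)" using assms
    by (metis One_nat_def Suc_le_D not0_implies_Suc not_one_le_zero)
  define m where "m = n - Suc j"
  have n: "n - j = Suc m" using assms by (simp add: m_def)
  have c: "dl * cr = sid 1" by (rule snake(1))
  have "place m cap (Suc k) * place (Suc m) cup k = place m (dl * cr) k"
    using place_times[OF H_three(7)[unfolded H_def] H_three(6)[unfolded H_def], of m k]
    by (simp add: tensor_assoc)
  also have "\<dots> = sid (m + 1 + k)" unfolding c by simp
  finally have cc: "place m cap (Suc k) * place (Suc m) cup k = sid (m + 1 + k)" .
  have "place m U (Suc k) = place m cup (Suc k) * place m cap (Suc k)"
    unfolding U_def by (rule place_times[OF Hom_gen(1,2)])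
  then have "place m U (Suc k) * place (Suc m) cup k
      = place m cup (Suc k) * sid (m + 1 + k)"
    by (simp only: mult.assoc cc)
  also have "\<dots> = place m cup (Suc k)"
    by (rule times_sid[of _ _ "m + 2 + Suc k"], rule H_tensor[OF H_sid H_tensor[OF H_gen(1) H_sid]]) auto
  finally have e: "place m U (Suc k) * place (Suc m) cup k = place m cup (Suc k)" .
  have "D_web n (j - 1) j = place (Suc m) cup k * (sid (n - 2) \<otimes> cap) * base n"
    using D_cup[of "Suc k" n] n assms by (simp add: j)
  then have "place (n - Suc j) U (j - 1) * D_web n (j - 1) j
      = (place m U (Suc k) * place (Suc m) cup k) * (sid (n - 2) \<otimes> cap) * base n"
    by (simp add: m_def j mult.assoc)
  also have "\<dots> = D_web n j (Suc j)"
    unfolding e using D_cup[of j n] assms by (simp add: m_def j)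
  finally show ?thesis ..
qed

text \<open>Arc and crossings stay within the \<open>j\<close> rightmost strands above the clasp.
  Anything on the other \<open>n - j\<close> strands can therefore slide past them down to
  \<open>base n\<close>.\<close>

lemma D_local:
  assumes "i < j" "j \<le> n"
  shows "\<exists>w \<in> H j j. D_web n i j = (sid (n - j) \<otimes> w) * base n"
  using assms
proof (induction j)
  case (Suc j)
  show ?case
  proof (cases "i = j")
    case True
    show ?thesis
    proof (cases "i = 0")
      case True
      then show ?thesis
        using D_first[of n] base_H[of n] Suc.prems \<open>i = j\<close> by (intro bexI[of _ "sid 1"]) auto
    next
      case False
      then obtain k where i: "i = Suc k" by (cases i) auto
      define w where "w = (cup \<otimes> sid k) * (sid k \<otimes> cap)"
      have ty: "cup \<otimes> sid k \<in> H k (Suc j)" "sid k \<otimes> cap \<in> H (Suc j) k"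
        using \<open>i = j\<close> i by (auto intro!: H_tensor[OF H_gen(1) H_sid] H_tensor[OF H_sid H_gen(2)])
      have "sid (n - Suc j) \<otimes> w = place (n - Suc j) cup k * (sid (n - Suc j) \<otimes> sid k \<otimes> cap)"
        unfolding w_def by (rule sid_tensor_times[OF ty])
      also have "sid (n - Suc j) \<otimes> sid k \<otimes> cap = sid (n - 2) \<otimes> cap"
      proof -
        have "n - Suc j + k = n - 2" using Suc.prems \<open>i = j\<close> i by simp
        then show ?thesis by (simp only: sid_tensor)
      qed
      finally show ?thesis
        using D_cup[of i n] i \<open>i = j\<close> H_times[OF ty] by (intro bexI[of _ w]) (auto simp: w_def)
    qed
  next
    case False
    with Suc obtain w where w: "w \<in> H j j" "D_web n i j = (sid (n - j) \<otimes> w) * base n" by auto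
    have j: "j \<ge> 1" using False Suc.prems by simp
    have ty: "X \<otimes> sid (j - 1) \<in> H (Suc j) (Suc j)" "sid 1 \<otimes> w \<in> H (Suc j) (Suc j)"
      using j by (auto intro!: H_tensor[OF H_gen(3) H_sid] H_tensor[OF H_sid w(1)])
    have "sid (n - Suc j) \<otimes> ((X \<otimes> sid (j - 1)) * (sid 1 \<otimes> w))
       = place (n - Suc j) X (j - 1) * (sid (n - Suc j) \<otimes> sid 1 \<otimes> w)"
      by (rule sid_tensor_times[OF ty])
    also have "sid (n - Suc j) \<otimes> sid 1 \<otimes> w = sid (n - j) \<otimes> w"
    proof -
      have "n - Suc j + 1 = n - j" using Suc.prems by simp
      then show ?thesis by (simp only: sid_tensor)
    qed
    finally show ?thesis
      using w D_cross[of i j n] False Suc.prems H_times[OF ty]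
      by (intro bexI[of _ "(X \<otimes> sid (j - 1)) * (sid 1 \<otimes> w)"]) (auto simp: mult.assoc)
  qed
qed simp

lemma D_commute:
  assumes "i < j" "j \<le> n" "a \<in> H (n - j) (n - j)"
  shows "(a \<otimes> sid j) * base n = 0 \<Longrightarrow> (a \<otimes> sid j) * D_web n i j = 0"
    and "(a \<otimes> sid j) * base n = base n \<Longrightarrow> (a \<otimes> sid j) * D_web n i j = D_web n i j"
proof -
  obtain w where w: "w \<in> H j j" "D_web n i j = (sid (n - j) \<otimes> w) * base n"
    using D_local[OF assms(1,2)] by blast
  have "(a \<otimes> sid j) * D_web n i j = (sid (n - j) \<otimes> w) * ((a \<otimes> sid j) * base n)"
    unfolding w(2) mult.assoc[symmetric] sid_commute[OF assms(3) w(1)] ..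
  then show "(a \<otimes> sid j) * base n = 0 \<Longrightarrow> (a \<otimes> sid j) * D_web n i j = 0"
    "(a \<otimes> sid j) * base n = base n \<Longrightarrow> (a \<otimes> sid j) * D_web n i j = D_web n i j"
    by (simp_all add: w(2))
qed

lemma D_kill:
  assumes "i < j" "j \<le> r" "n = l + 2 + r" "y \<in> {X, U}"
  shows "place l y r * D_web n i j = 0"
proof -
  have "place l y r = place l y (r - j) \<otimes> sid j"
    using assms by (simp add: tensor_assoc)
  moreover have "(place l y (r - j) \<otimes> sid j) * D_web n i j = 0"
  proof (rule D_commute(1)[OF assms(1) _ H_place[OF assms(4)]])
    show "(place l y (r - j) \<otimes> sid j) * base n = 0"
      using base_kill[OF assms(4,3)] assms calculation by simp
  qed (use assms in auto)
  ultimately show ?thesis by simp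
qed

lemma D_absorb: "i < j \<Longrightarrow> j \<le> n \<Longrightarrow> (projector (n - j) \<otimes> sid j) * D_web n i j = D_web n i j"
  by (rule D_commute(2)[OF _ _ projector_H base_absorb]) auto

text \<open>Because \<open>i + 2 \<le> j\<close>, the web has a crossing right below this
  \<open>U\<close>. \<open>cap_slide\<close> moves it one pair to the left, onto strands that the
  arc ending at \<open>j - 1\<close> does not touch, where \<open>D_kill\<close> applies.\<close>

lemma U_D_zero:
  assumes "i + 2 \<le> j" "j < n"
  shows "place (n - Suc j) U (j - 1) * D_web n i j = 0"
proof -
  obtain k where j: "j = Suc (Suc k)" using assms by (metis add_2_eq_Suc' le_Suc_ex add_Suc)
  define m where "m = n - Suc j"
  have n: "n - j = Suc m" "n = m + 2 + Suc k" using assms j by (auto simp: m_def)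
  have ty: "ul \<in> Hom (replicate 3 S1) (replicate 3 S1)" "xr \<in> Hom (replicate 3 S1) (replicate 3 S1)"
    "ur \<in> Hom (replicate 3 S1) (replicate 3 S1)" "xl \<in> Hom (replicate 3 S1) (replicate 3 S1)"
    using H_three by (simp_all add: H_def)
  have D: "D_web n i j = place (Suc m) X k * D_web n i (Suc k)"
    using D_cross[of i "Suc k" n] assms n j by simp
  have "place m U (Suc k) * place (Suc m) X k = place m (ul * xr) k"
    unfolding place_times[OF ty(1,2)] by (simp add: tensor_assoc)
  also have "\<dots> = place m (ul * ur) k * place m X (Suc k)"
    unfolding cap_slide place_times[OF Hom_times[OF ty(1,3)] ty(4)] by (simp add: tensor_assoc)
  finally have "place m U (Suc k) * D_web n i j
     = place m (ul * ur) k * (place m X (Suc k) * D_web n i (Suc k))"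
    unfolding D by (metis mult.assoc)
  also have "place m X (Suc k) * D_web n i (Suc k) = 0"
    by (rule D_kill) (use assms j n in auto)
  finally show ?thesis by (simp add: m_def j)
qed

text \<open>An intermediate stage of the expansion, with the projector on the
  \<open>n - j + 1\<close> leftmost strands not yet expanded. It starts at
  \<open>Z n 0 1 = projector n\<close> and ends at \<open>Z n i n = D_web n i n\<close>. Projector
  and arc overlap in the strand that ends at the point \<open>j\<close>.\<close>

definition Z :: "nat \<Rightarrow> nat \<Rightarrow> nat \<Rightarrow> skein" where
  "Z n i j = (projector (Suc (n - j)) \<otimes> sid (j - 1)) * D_web n i j"

lemma Z_last: "i < n \<Longrightarrow> Z n i n = D_web n i n"
proof -
  assume i: "i < n"
  then have "projector 1 \<otimes> sid (n - 1) = projector (n - n) \<otimes> sid n"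
    by (simp add: projector.simps(2))
  then show ?thesis
    using D_absorb[OF i order_refl] by (simp add: Z_def)
qed

text \<open>One application of the recursion to the remaining projector: its lower smaller projector
  is absorbed by the web, \<open>X\<close> lengthens the arc by a crossing, and \<open>U\<close>
  either starts the next arc, from a diagonal position, or gives zero.\<close>

lemma Z_step:
  assumes "i < j" "j < n"
  shows "Z n i j = D_web n i j + xc (Suc (n - j)) *\<^sub>K Z n i (Suc j)
    + (if j = Suc i then yc (Suc (n - j)) *\<^sub>K Z n j (Suc j) else 0)"
proof -
  define m where "m = n - Suc j"
  have m: "n - j = Suc m" using assms by (simp add: m_def)
  define G where "G = projector (Suc m) \<otimes> sid j"
  have GH: "projector (Suc m) \<otimes> sid 1 \<in> H (m + 2) (m + 2)"
    by (rule H_tensor[OF projector_H H_sid]) auto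
  have place: "((projector (Suc m) \<otimes> sid 1) * (sid m \<otimes> y) * (projector (Suc m) \<otimes> sid 1)) \<otimes> sid (j - 1)
      = G * place m y (j - 1) * G" if "y \<in> {X, U}" for y
  proof -
    have y: "sid m \<otimes> y \<in> H (m + 2) (m + 2)"
      by (rule H_tensor[OF H_sid H_XU[OF that]]) auto
    show ?thesis
      using assms
      by (simp add: tensor_sid_times[OF H_times[OF GH y] GH] tensor_sid_times[OF GH y] G_def tensor_assoc
          del: One_nat_def)
  qed
  have "projector (Suc (n - j)) \<otimes> sid (j - 1) = (projector (Suc m) \<otimes> sid 1) \<otimes> sid (j - 1)
      + xc (Suc (n - j)) *\<^sub>K (((projector (Suc m) \<otimes> sid 1) * (sid m \<otimes> X) * (projector (Suc m) \<otimes> sid 1)) \<otimes> sid (j - 1))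
      + yc (Suc (n - j)) *\<^sub>K (((projector (Suc m) \<otimes> sid 1) * (sid m \<otimes> U) * (projector (Suc m) \<otimes> sid 1)) \<otimes> sid (j - 1))"
    unfolding m projector.simps(2)[of "Suc m"] diff_Suc_1 tensor_add_left tensor_scale ..
  also have "(projector (Suc m) \<otimes> sid 1) \<otimes> sid (j - 1) = G"
    using assms by (simp add: G_def tensor_assoc)
  finally have projector: "projector (Suc (n - j)) \<otimes> sid (j - 1) = G
      + xc (Suc (n - j)) *\<^sub>K (G * place m X (j - 1) * G)
      + yc (Suc (n - j)) *\<^sub>K (G * place m U (j - 1) * G)"
    by (simp only: place insert_iff simp_thms)
  have GD: "G * D_web n i j = D_web n i j"
    using D_absorb[of i j n] assms m by (simp add: G_def)
  have "Z n i j = D_web n i j + xc (Suc (n - j)) *\<^sub>K (G * (place m X (j - 1) * D_web n i j))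
      + yc (Suc (n - j)) *\<^sub>K (G * (place m U (j - 1) * D_web n i j))"
    unfolding Z_def projector by (simp only: distrib_right scale_times mult.assoc GD)
  also have "G * (place m X (j - 1) * D_web n i j) = Z n i (Suc j)"
    using D_cross[OF assms(1), of n] by (simp add: Z_def G_def m_def)
  also have "G * (place m U (j - 1) * D_web n i j) = (if j = Suc i then Z n j (Suc j) else 0)"
  proof (cases "j = Suc i")
    case True
    then show ?thesis
      using D_next[of j n] assms by (simp add: Z_def G_def m_def)
  next
    case False
    then show ?thesis
      using U_D_zero[of i j n] assms by (simp add: m_def)
  qed
  finally show ?thesis by simp
qed

text \<open>The coefficients are the telescoped products of \<open>xc (Suc (n - p))\<close> for
  \<open>p\<close> from \<open>j\<close> to \<open>l - 1\<close>, along the branch on which only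
  crossings are added.\<close>

definition row :: "nat \<Rightarrow> nat \<Rightarrow> nat \<Rightarrow> skein" where
  "row n i j = (\<Sum>l = j..n. ([2]\<^sub>q powi (int j - int l) * [int n - int l + 1]\<^sub>q / [int n - int j + 1]\<^sub>q) *\<^sub>K D_web n i l)"

lemma row_last: "row n i n = D_web n i n"
  by (simp add: row_def)

lemma row_step:
  assumes "j < n"
  shows "row n i j = D_web n i j + xc (Suc (n - j)) *\<^sub>K row n i (Suc j)"
proof -
  have nz: "[int n - int j]\<^sub>q \<noteq> 0" "[int n - int j + 1]\<^sub>q \<noteq> 0" "[2]\<^sub>q \<noteq> 0"
    using assms by (simp_all add: qnum_nonzero)
  have x: "xc (Suc (n - j)) = [int n - int j]\<^sub>q / ([2]\<^sub>q * [int n - int j + 1]\<^sub>q)"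
    using assms by (simp add: xc_def of_nat_diff algebra_simps)
  have "xc (Suc (n - j)) * ([2]\<^sub>q powi (int (Suc j) - int l) * [int n - int l + 1]\<^sub>q / [int n - int (Suc j) + 1]\<^sub>q)
      = [2]\<^sub>q powi (int j - int l) * [int n - int l + 1]\<^sub>q / [int n - int j + 1]\<^sub>q" for l
  proof -
    have "int (Suc j) - int l = (int j - int l) + 1" by simp
    then have "[2]\<^sub>q powi (int (Suc j) - int l) = [2]\<^sub>q powi (int j - int l) * [2]\<^sub>q"
      using power_int_add[of "[2]\<^sub>q" "int j - int l" 1] nz(3) by (simp only: power_int_1_right simp_thms)
    then show ?thesis unfolding x using nz by simp
  qed
  then show ?thesis
    unfolding row_def using assms nz
    by (subst sum.atLeast_Suc_atMost) (simp_all add: skein.scale_sum_right)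
qed

text \<open>Off the diagonal \<open>j = i + 1\<close> the \<open>U\<close> branch is zero, and
  \<open>Z\<close> obeys the recursion of \<open>row_step\<close>.\<close>

lemma Z_eq_row: "i + 2 \<le> j \<Longrightarrow> j \<le> n \<Longrightarrow> Z n i j = row n i j"
proof (induction "n - j" arbitrary: j)
  case 0
  then show ?case using Z_last[of i n] row_last by simp
next
  case (Suc k)
  then have "Z n i (Suc j) = row n i (Suc j)" by (intro Suc.hyps(1)) auto
  then show ?case
    using Suc Z_step[of i j n] row_step[of j n i] by simp
qed

text \<open>A potential for \<open>yc\<close>: for \<open>i + 1 < n\<close>, the quotient of
  \<open>rowc n (i + 1)\<close> by \<open>rowc n i\<close> is \<open>yc (n - i)\<close>, so that
  products of these coefficients telescope.\<close>

definition rowc :: "nat \<Rightarrow> nat \<Rightarrow> K" where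
  "rowc n i = [int n - int i]\<^sub>q * gq (int n - int i + 1)"

text \<open>At a diagonal position the expansion either adds crossings, which yields a full row, or
  passes by \<open>U\<close> to the next diagonal position with the factor
  \<open>yc\<close>.\<close>

lemma Z_diagonal:
  "i < n \<Longrightarrow> Z n i (Suc i) = (\<Sum>k = i..n - 1. (rowc n k / rowc n i) *\<^sub>K row n k (Suc k))"
proof (induction "n - i" arbitrary: i)
  case (Suc d)
  have nz: "rowc n k \<noteq> 0" if "k < n" for k
    using that by (simp add: rowc_def qnum_nonzero gq_nonzero)
  show ?case
  proof (cases "Suc i = n")
    case True
    then show ?thesis
      using Z_last[of i n] row_last[of n i] nz[of i] by auto
  next
    case False
    then have i: "Suc i < n" using Suc by simp
    have IH: "Z n (Suc i) (Suc (Suc i)) = (\<Sum>k = Suc i..n - 1. (rowc n k / rowc n (Suc i)) *\<^sub>K row n k (Suc k))"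
      using Suc i by (intro Suc.hyps(1)) auto
    have y: "yc (Suc (n - Suc i)) = rowc n (Suc i) / rowc n i"
      using i by (simp add: yc_def rowc_def of_nat_diff algebra_simps)
    have "Z n i (Suc i) = D_web n i (Suc i) + xc (Suc (n - Suc i)) *\<^sub>K row n i (Suc (Suc i))
        + yc (Suc (n - Suc i)) *\<^sub>K Z n (Suc i) (Suc (Suc i))"
      using Z_step[of i "Suc i" n] Z_eq_row[of i "Suc (Suc i)" n] i by simp
    also have "\<dots> = row n i (Suc i) + yc (Suc (n - Suc i)) *\<^sub>K Z n (Suc i) (Suc (Suc i))"
      using row_step[OF i, of i] by simp
    also have "\<dots> = (\<Sum>k = i..n - 1. (rowc n k / rowc n i) *\<^sub>K row n k (Suc k))"
      unfolding IH y using i nz[of i] nz[of "Suc i"]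
      by (subst (2) sum.atLeast_Suc_atMost) (auto simp: skein.scale_sum_right)
    finally show ?thesis .
  qed
qed simp

theorem theorem4p2:
  fixes n :: nat
  assumes "n \<ge> 1"
  shows "f_clasp n = (\<Sum>i = 0..n - 1. \<Sum>j = i + 1..n.
           ([2]\<^sub>q powi (int i - int j + 1)
             * ([int n + 1]\<^sub>q * [int n - int j + 1]\<^sub>q * [2 * int n - 2 * int i + 2]\<^sub>q)
             / ([int n]\<^sub>q * [2 * int n + 2]\<^sub>q * [int n - int i + 1]\<^sub>q))
           *\<^sub>K D_web n i j)"
proof -
  \<comment> \<open>Absorbing one copy of the smaller clasp from the right produces the initial
    stage of the expansion.\<close>
  have "projector n = projector n * base n"
    using projector_tensor_absorb(2)[of "n - 1" "projector n"] projector_ann[of n] assms by (simp add: base_def)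
  also have "\<dots> = Z n 0 (Suc 0)"
    using D_first[of n] assms by (simp add: Z_def)
  also have "\<dots> = (\<Sum>k = 0..n - 1. (rowc n k / rowc n 0) *\<^sub>K row n k (Suc k))"
    using assms by (intro Z_diagonal) simp
  also have "\<dots> = (\<Sum>i = 0..n - 1. \<Sum>j = i + 1..n.
           ([2]\<^sub>q powi (int i - int j + 1)
             * ([int n + 1]\<^sub>q * [int n - int j + 1]\<^sub>q * [2 * int n - 2 * int i + 2]\<^sub>q)
             / ([int n]\<^sub>q * [2 * int n + 2]\<^sub>q * [int n - int i + 1]\<^sub>q))
           *\<^sub>K D_web n i j)"
  proof (rule sum.cong[OF HOL.refl])
    fix i assume "i \<in> {0..n - 1}"
    then have i: "i < n" using assms by auto
    have nz: "[int n - int i]\<^sub>q \<noteq> 0" "[int n]\<^sub>q \<noteq> 0" "[int n + 1]\<^sub>q \<noteq> 0" "[int n - int i + 1]\<^sub>q \<noteq> 0"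
      "gq (int n + 1) \<noteq> 0"
      using i by (simp_all add: qnum_nonzero gq_nonzero)
    \<comment> \<open>The doubled quantum integers of the statement account for the factors
      \<open>gq\<close> in \<open>rowc\<close>.\<close>
    have dbl: "[2 * int n - 2 * int i + 2]\<^sub>q = gq (int n - int i + 1) * [int n - int i + 1]\<^sub>q"
      "[2 * int n + 2]\<^sub>q = gq (int n + 1) * [int n + 1]\<^sub>q"
      using qnum_double[of "int n - int i + 1"] qnum_double[of "int n + 1"] by (simp_all add: algebra_simps)
    have "(rowc n i / rowc n 0) * ([2]\<^sub>q powi (int (Suc i) - int j) * [int n - int j + 1]\<^sub>q / [int n - int (Suc i) + 1]\<^sub>q)
      = [2]\<^sub>q powi (int i - int j + 1)
             * ([int n + 1]\<^sub>q * [int n - int j + 1]\<^sub>q * [2 * int n - 2 * int i + 2]\<^sub>q)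
             / ([int n]\<^sub>q * [2 * int n + 2]\<^sub>q * [int n - int i + 1]\<^sub>q)" for j
    proof -
      have "int (Suc i) - int j = int i - int j + 1" "int n - int (Suc i) + 1 = int n - int i" by simp_all
      then show ?thesis
        unfolding dbl rowc_def using nz by (simp add: field_simps)
    qed
    then show "(rowc n i / rowc n 0) *\<^sub>K row n i (Suc i) = (\<Sum>j = i + 1..n.
           ([2]\<^sub>q powi (int i - int j + 1)
             * ([int n + 1]\<^sub>q * [int n - int j + 1]\<^sub>q * [2 * int n - 2 * int i + 2]\<^sub>q)
             / ([int n]\<^sub>q * [2 * int n + 2]\<^sub>q * [int n - int i + 1]\<^sub>q))
           *\<^sub>K D_web n i j)"
      unfolding row_def skein.scale_sum_right by simp
  qed
  finally show ?thesis unfolding f_clasp_eq .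
qed

end
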